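(* The Riemann hypothesis (all zeros of $\xi(s)$ lie on $\Re(s)=1/2$) is true if and only if the function $g(t):=-\Psi(t)$, $t\in\mathbb{R}$, is a screw function on $\mathbb{R}$, i.e. $g\in\mathcal{G}_\infty$.
   Context: $\xi(s)=\frac12 s(s-1)\pi^{-s/2}\Gamma(s/2)\zeta(s)$. $\Lambda$ is the von Mangoldt function, $G$ is Catalan's constant, $C=\pi^2+8G$, and $\Phi(z,s,a)=\sum_{n\ge0}(n+a)^{-s}z^n$. For $t\ge0$, \[\Psi(t):=4(e^{t/2}+e^{-t/2}-2)-\sum_{n\le e^t}\frac{\Lambda(n)}{\sqrt n}(t-\log n)+\frac t2\Big[\frac{\Gamma'}{\Gamma}\Big(\frac14\Big)-\log\pi\Big]+\frac14\Big(C-e^{-t/2}\Phi(e^{-2t},2,1/4)\Big),\] and $\Psi$ is extended to $\mathbb{R}$ as an even function, $\Psi(-t)=\Psi(t)$. For $0<a\le\infty$, the class $\mathcal{G}_a$ consists of all continuous functions $g$ on $(-2a,2a)$ with $g(-t)=\overline{g(t)}$ such that the kernel $G_g(t,u):=g(t-u)-g(t)-g(-u)+g(0)$ is non-negative definite on $(-a,a)$: $\sum_{i,j=1}^n G_g(t_i,t_j)\xi_i\overline{\xi_j}\ge0$ for all $n\in\mathbb{N}$, $\xi_i\in\mathbb{C}$, $|t_i|<a$. *)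

theory Defs
  imports
    "HOL-Complex_Analysis.Complex_Analysis"
    "HOL-Number_Theory.Prime_Powers"
    "HOL-Library.Extended_Real"
begin

section \<open>The Riemann zeta function\<close>

definition zeta_series :: "complex \<Rightarrow> complex" where
  "zeta_series s = (\<Sum>n. of_nat (Suc n) powr (-s))"

(* The value 0 at the pole is a convention that makes the description unique;
   existence and uniqueness are theorem zeta_ex1 below. *)
definition zeta :: "complex \<Rightarrow> complex" where
  "zeta = (THE f. f holomorphic_on (- {1}) \<and> (\<forall>s. Re s > 1 \<longrightarrow> f s = zeta_series s) \<and> f 1 = 0)"

lemma holomorphic_on_suminf_local:
  fixes f :: "nat \<Rightarrow> complex \<Rightarrow> complex"
  assumes "open S" and hol: "\<And>n. f n holomorphic_on S"
    and bd: "\<And>x. x \<in> S \<Longrightarrow> \<exists>d>0. \<exists>M. cball x d \<subseteq> S \<and> summable M \<and>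
                (\<forall>n. \<forall>y\<in>cball x d. norm (f n y) \<le> M n)"
  shows "(\<lambda>s. \<Sum>n. f n s) holomorphic_on S"
proof (rule holomorphic_uniform_sequence[of S "\<lambda>N s. \<Sum>n<N. f n s"])
  show "\<And>n. (\<lambda>s. \<Sum>n<n. f n s) holomorphic_on S"
    by (intro holomorphic_intros hol)
  fix x assume "x \<in> S"
  from bd[OF this] obtain d M where d: "d > 0" "cball x d \<subseteq> S" "summable M"
    "\<And>n y. y \<in> cball x d \<Longrightarrow> norm (f n y) \<le> M n" by blast
  have "uniform_limit (cball x d) (\<lambda>N s. \<Sum>n<N. f n s) (\<lambda>s. \<Sum>n. f n s) sequentially"
    by (rule Weierstrass_m_test) (use d in auto)
  with d show "\<exists>d>0. cball x d \<subseteq> S \<and> uniform_limit (cball x d) (\<lambda>N s. \<Sum>n<N. f n s) (\<lambda>s. \<Sum>n. f n s) sequentially"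
    by blast
qed fact+

lemma norm_Suc_powr: "norm (of_nat (Suc n) powr (s::complex)) = real (Suc n) powr Re s"
  using norm_powr_real_powr[of "of_nat (Suc n)" s] by simp

lemma summable_Suc_powr: "c < -1 \<Longrightarrow> summable (\<lambda>n. real (Suc n) powr c)"
  using summable_Suc_iff[of "\<lambda>n. real n powr c"] summable_real_powr_iff[of c] by simp

lemma cball_Re_ge: "y \<in> cball x d \<Longrightarrow> Re y \<ge> Re x - d"
  using abs_Re_le_cmod[of "x - y"] by (auto simp: dist_norm)

lemma open_Re_gt: "open {s::complex. Re s > c}"
  by (simp add: open_halfspace_Re_gt)

lemma connected_Re_gt: "connected {s::complex. Re s > c}"
  by (simp add: convex_halfspace_Re_gt convex_connected)

lemma zeta_series_sums:
  assumes "Re s > 1" shows "(\<lambda>n. of_nat (Suc n) powr (-s)) sums zeta_series s"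
  unfolding zeta_series_def
proof (rule summable_sums, rule summable_norm_cancel)
  show "summable (\<lambda>n. norm (of_nat (Suc n) powr (-s)))"
    unfolding norm_Suc_powr using assms by (intro summable_Suc_powr) auto
qed

lemma holomorphic_zeta_series: "zeta_series holomorphic_on {s. Re s > 1}"
  unfolding zeta_series_def[abs_def]
proof (rule holomorphic_on_suminf_local)
  show "(\<lambda>s. of_nat (Suc n) powr (-s)) holomorphic_on {s. Re s > 1}" for n
    by (intro holomorphic_intros)
  fix x assume "x \<in> {s. Re s > 1}"
  then have x: "Re x > 1" by simp
  define d where "d = (Re x - 1) / 2"
  have y: "Re y \<ge> 1 + d" if "y \<in> cball x d" for y
    using cball_Re_ge[OF that] by (simp add: d_def field_simps)
  show "\<exists>d>0. \<exists>M. cball x d \<subseteq> {s. Re s > 1} \<and> summable M \<and>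
      (\<forall>n. \<forall>y\<in>cball x d. norm (of_nat (Suc n) powr (-y)) \<le> M n)"
  proof (rule exI[of _ d], intro conjI, goal_cases)
    case 1 show ?case using x by (simp add: d_def)
    case 2 show ?case
    proof (rule exI[of _ "\<lambda>n. real (Suc n) powr (-(1+d))"], intro conjI)
      show "cball x d \<subseteq> {s. Re s > 1}"
      proof
        fix y' assume "y' \<in> cball x d"
        from y[OF this] x show "y' \<in> {s. Re s > 1}" by (simp add: d_def field_simps)
      qed
      show "summable (\<lambda>n. real (Suc n) powr (-(1+d)))"
        using x by (intro summable_Suc_powr) (auto simp: d_def)
      show "\<forall>n. \<forall>y\<in>cball x d. norm (of_nat (Suc n) powr (-y)) \<le> real (Suc n) powr (-(1+d))"
      proof (intro allI ballI)
        fix n y' assume "y' \<in> cball x d"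
        from y[OF this] show "norm (of_nat (Suc n) powr (-y')) \<le> real (Suc n) powr (-(1+d))"
          unfolding norm_Suc_powr by (intro powr_mono) auto
      qed
    qed
  qed
qed (rule open_Re_gt)

definition falling :: "nat \<Rightarrow> complex \<Rightarrow> complex" where
  "falling i a = (\<Prod>j<i. a - of_nat j)"

lemma powr_Taylor_bound:
  assumes "Re a \<le> of_nat (Suc K)"
  shows "norm (of_nat (Suc (Suc n)) powr a
            - (\<Sum>i\<le>K. falling i a * of_nat (Suc n) powr (a - of_nat i) / fact i))
         \<le> norm (falling (Suc K) a) * real (Suc n) powr (Re a - of_nat (Suc K))"
proof -
  define f where "f = (\<lambda>i x. falling i a * x powr (a - of_nat i))"
  define S where "S = closed_segment (of_nat (Suc n)) (of_nat (Suc (Suc n)) :: complex)"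
  have S: "\<exists>r. x = of_real r \<and> r \<ge> real (Suc n)" if "x \<in> S" for x
  proof -
    have "of_nat (Suc n) = complex_of_real (Suc n)" "of_nat (Suc (Suc n)) = complex_of_real (Suc (Suc n))"
      by simp_all
    then have "x \<in> of_real ` closed_segment (real (Suc n)) (real (Suc (Suc n)))"
      using that unfolding S_def by (metis closed_segment_of_real)
    then show ?thesis by (auto simp: closed_segment_eq_real_ivl)
  qed
  have "cmod (f 0 (of_nat (Suc (Suc n))) -
          (\<Sum>i\<le>K. f i (of_nat (Suc n)) * (of_nat (Suc (Suc n)) - of_nat (Suc n)) ^ i / fact i))
        \<le> (norm (falling (Suc K) a) * real (Suc n) powr (Re a - of_nat (Suc K)))
            * cmod (of_nat (Suc (Suc n)) - of_nat (Suc n)) ^ Suc K / fact K"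
  proof (rule complex_Taylor[where S = S])
    show "convex S" by (simp add: S_def)
    show "of_nat (Suc n) \<in> S" "of_nat (Suc (Suc n)) \<in> S" by (simp_all add: S_def)
    fix x assume "x \<in> S"
    from S[OF this] obtain r where r: "x = of_real r" "r \<ge> real (Suc n)" by blast
    then have r0: "r > 0" by linarith
    have np: "x \<notin> \<real>\<^sub>\<le>\<^sub>0" using r r0 by simp
    show "(f i has_field_derivative f (Suc i) x) (at x within S)" for i
      unfolding f_def using np
      by (auto intro!: derivative_eq_intros simp: falling_def algebra_simps)
    have "cmod (f (Suc K) x) = norm (falling (Suc K) a) * r powr (Re a - of_nat (Suc K))"
      using r0 unfolding f_def r norm_mult by (subst norm_powr_real_powr) auto
    also have "\<dots> \<le> norm (falling (Suc K) a) * real (Suc n) powr (Re a - of_nat (Suc K))"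
      using assms r by (intro mult_left_mono powr_mono2') auto
    finally show "cmod (f (Suc K) x) \<le> norm (falling (Suc K) a) * real (Suc n) powr (Re a - of_nat (Suc K))" .
  qed
  also have "of_nat (Suc (Suc n)) - of_nat (Suc n) = (1::complex)" by simp
  also have "(norm (falling (Suc K) a) * real (Suc n) powr (Re a - of_nat (Suc K))) * norm (1::complex) ^ Suc K / fact K
     \<le> norm (falling (Suc K) a) * real (Suc n) powr (Re a - of_nat (Suc K))"
  proof -
    have "X / fact K \<le> X" if "X \<ge> 0" for X :: real
      using that fact_ge_1[of K, where 'a=real] by (simp add: divide_le_eq mult_le_cancel_left1)
    then show ?thesis by simp
  qed
  finally show ?thesis by (simp add: f_def falling_def[of 0])
qed

lemma zeta_half_plane:
  "\<exists>F. F holomorphic_on {s. Re s > 1 - real m} \<and> (\<forall>s. Re s > 1 \<longrightarrow> F s = (s - 1) * zeta_series s)"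
proof (induction m)
  case 0
  show ?case
    by (rule exI[of _ "\<lambda>s. (s - 1) * zeta_series s"])
       (auto intro!: holomorphic_intros holomorphic_zeta_series)
next
  case (Suc m)
  then obtain F where F: "F holomorphic_on {s. Re s > 1 - real m}"
    "\<And>s. Re s > 1 \<Longrightarrow> F s = (s - 1) * zeta_series s" by blast
  define R where "R = (\<lambda>n s. of_nat (Suc (Suc n)) powr (1 - s)
      - (\<Sum>i\<le>Suc m. falling i (1 - s) * of_nat (Suc n) powr (1 - s - of_nat i) / fact i) :: complex)"
  define D where "D = {s::complex. Re s > - real m}"
  have "(\<lambda>s. \<Sum>n. R n s) holomorphic_on D"
  proof (rule holomorphic_on_suminf_local)
    show "open D" unfolding D_def by (rule open_Re_gt)
    show "R n holomorphic_on D" for n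
      unfolding R_def falling_def by (intro holomorphic_intros) auto
    fix x assume "x \<in> D"
    then have x: "Re x > - real m" by (simp add: D_def)
    define d where "d = (Re x + real m) / 2"
    have d: "d > 0" using x by (simp add: d_def)
    have y: "Re y \<ge> d - real m" if "y \<in> cball x d" for y
      using cball_Re_ge[OF that] by (simp add: d_def field_simps)
    have "compact ((\<lambda>s. falling (Suc (Suc m)) (1 - s)) ` cball x d)"
      unfolding falling_def by (intro compact_continuous_image continuous_intros) auto
    from compact_imp_bounded[OF this] obtain B where
      B: "\<And>y. y \<in> cball x d \<Longrightarrow> norm (falling (Suc (Suc m)) (1 - y)) \<le> B"
      unfolding bounded_iff by blast
    have B0: "B \<ge> 0" using B[of x] d norm_ge_zero order_trans by (metis centre_in_cball less_imp_le)
    define M where "M = (\<lambda>n. B * real (Suc n) powr (- 1 - d))"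
    have "norm (R n y) \<le> M n" if "y \<in> cball x d" for n y
    proof -
      have "norm (R n y) \<le> norm (falling (Suc (Suc m)) (1 - y)) *
          real (Suc n) powr (Re (1 - y) - of_nat (Suc (Suc m)))"
        unfolding R_def by (rule powr_Taylor_bound) (use y[OF that] d in auto)
      also have "\<dots> \<le> M n"
        unfolding M_def using y[OF that] d
        by (intro mult_mono B that powr_mono B0) auto
      finally show ?thesis .
    qed
    moreover have "summable M"
      unfolding M_def using d by (intro summable_mult summable_Suc_powr) auto
    moreover have "cball x d \<subseteq> D"
      using y d by (fastforce simp: D_def)
    ultimately show "\<exists>d>0. \<exists>M. cball x d \<subseteq> D \<and> summable M \<and> (\<forall>n. \<forall>y\<in>cball x d. norm (R n y) \<le> M n)"
      using d by blast
  qed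
  moreover have "F holomorphic_on ((\<lambda>s. s + of_nat (Suc j)) ` D)" for j
    by (rule holomorphic_on_subset[OF F(1)]) (auto simp: D_def)
  then have "(F \<circ> (\<lambda>s. s + of_nat (Suc j))) holomorphic_on D" for j
    by (intro holomorphic_on_compose holomorphic_intros)
  then have "(\<lambda>s. F (s + of_nat (Suc j))) holomorphic_on D" for j
    by (simp only: o_def)
  moreover have "(\<lambda>s. falling (Suc j) (1 - s)) holomorphic_on D" for j
    unfolding falling_def by (intro holomorphic_intros)
  ultimately have hol: "(\<lambda>s. 1 + (\<Sum>n. R n s) -
      (\<Sum>j<m. falling (Suc j) (1 - s) / fact (j + 2) * F (s + of_nat (Suc j)))) holomorphic_on D"
    by (intro holomorphic_intros) auto
  have eq: "1 + (\<Sum>n. R n s) -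
      (\<Sum>j<m. falling (Suc j) (1 - s) / fact (j + 2) * F (s + of_nat (Suc j))) = (s - 1) * zeta_series s"
    if s: "Re s > 1" for s
  proof -
    have R: "R n s = (of_nat (Suc (Suc n)) powr (1 - s) - of_nat (Suc n) powr (1 - s))
        - (1 - s) * of_nat (Suc n) powr (-s)
        - (\<Sum>j<m. falling (j + 2) (1 - s) / fact (j + 2) * of_nat (Suc n) powr (-(s + of_nat (Suc j))))" for n
    proof -
      have "(\<Sum>i\<le>Suc m. g i) = g 0 + (g 1 + (\<Sum>j<m. g (j + 2)))" for g :: "nat \<Rightarrow> complex"
        unfolding lessThan_Suc_atMost[symmetric]
        by (simp only: sum.lessThan_Suc_shift) simp
      note * = this[of "\<lambda>i. falling i (1 - s) * of_nat (Suc n) powr (1 - s - of_nat i) / fact i"]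
      show ?thesis unfolding R_def *
        by (simp add: falling_def algebra_simps)
    qed
    have "(\<lambda>n. of_nat (Suc n) powr (1 - s)) \<longlonglongrightarrow> 0"
    proof (rule tendsto_norm_zero_cancel)
      show "(\<lambda>n. norm (of_nat (Suc n) powr (1 - s))) \<longlonglongrightarrow> 0"
        unfolding norm_Suc_powr
        by (rule tendsto_neg_powr)
           (use s filterlim_compose[OF filterlim_real_sequentially filterlim_Suc] in auto)
    qed
    then have "(\<lambda>n. of_nat (Suc (Suc n)) powr (1 - s) - of_nat (Suc n) powr (1 - s)) sums (0 - of_nat (Suc 0) powr (1 - s))"
      by (rule telescope_sums)
    then have 1: "(\<lambda>n. of_nat (Suc (Suc n)) powr (1 - s) - of_nat (Suc n) powr (1 - s)) sums (- 1)"
      by simp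
    have "(\<lambda>n. R n s) sums (- 1 - (1 - s) * zeta_series s -
       (\<Sum>j<m. falling (j + 2) (1 - s) / fact (j + 2) * zeta_series (s + of_nat (Suc j))))"
      unfolding R
      by (intro sums_diff sums_mult sums_sum 1 zeta_series_sums) (use s in auto)
    from sums_unique[OF this] have 2: "(\<Sum>n. R n s) = - 1 - (1 - s) * zeta_series s -
       (\<Sum>j<m. falling (j + 2) (1 - s) / fact (j + 2) * zeta_series (s + of_nat (Suc j)))" by simp
    have "F (s + of_nat (Suc j)) = (s + of_nat j) * zeta_series (s + of_nat (Suc j))" for j
      using s by (subst F(2)) auto
    moreover have "falling (j + 2) (1 - s) = - falling (Suc j) (1 - s) * (s + of_nat j)" for j
      by (simp add: falling_def algebra_simps)
    ultimately have "(\<Sum>j<m. falling (Suc j) (1 - s) / fact (j + 2) * F (s + of_nat (Suc j))) =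
       - (\<Sum>j<m. falling (j + 2) (1 - s) / fact (j + 2) * zeta_series (s + of_nat (Suc j)))"
      unfolding sum_negf[symmetric] by (intro sum.cong refl) (simp del: fact_Suc)
    then show ?thesis unfolding 2 by (simp add: algebra_simps del: fact_Suc)
  qed
  have D: "D = {s. Re s > 1 - real (Suc m)}" by (auto simp: D_def)
  show ?case using hol eq unfolding D by blast
qed

theorem zeta_ex1:
  "\<exists>!f. f holomorphic_on (- {1}) \<and> (\<forall>s. Re s > 1 \<longrightarrow> f s = zeta_series s) \<and> f 1 = 0"
proof -
  from zeta_half_plane obtain F where
    F: "\<And>m. F m holomorphic_on {s. Re s > 1 - real m}"
       "\<And>m s. Re s > 1 \<Longrightarrow> F m s = (s - 1) * zeta_series s"
    by metis
  have agree: "F m s = F k s" if "Re s > 1 - real m" "m \<le> k" for m k s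
  proof (rule analytic_continuation_open[where f = "F m" and g = "F k" and
        s = "{s. Re s > 1}" and s' = "{s. Re s > 1 - real m}"])
    show "F k holomorphic_on {s. Re s > 1 - real m}"
      by (rule holomorphic_on_subset[OF F(1)]) (use that in auto)
    show "{s::complex. Re s > 1} \<noteq> {}" by (auto intro!: exI[of _ 2])
  qed (use that F in \<open>auto simp: open_Re_gt connected_Re_gt\<close>)
  define G where "G = (\<lambda>s. F (nat \<lceil>2 - Re s\<rceil>) s)"
  have G: "G s = F m s" if "Re s > 1 - real m" for s m
  proof -
    have "Re s > 1 - real (nat \<lceil>2 - Re s\<rceil>)" by linarith
    then show ?thesis unfolding G_def using agree that by (metis nle_le)
  qed
  have "G holomorphic_on (\<Union>m. {s. Re s > 1 - real m})"
  proof (rule holomorphic_on_UN_open)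
    show "G holomorphic_on {s. Re s > 1 - real m}" for m
      using F(1)[of m] by (rule holomorphic_transform) (simp add: G)
  qed (rule open_Re_gt)
  moreover have "x \<in> (\<Union>m. {s. Re s > 1 - real m})" for x
  proof -
    have "Re x > 1 - real (nat \<lceil>2 - Re x\<rceil>)" by linarith
    then show ?thesis by blast
  qed
  ultimately have Gh: "G holomorphic_on UNIV" by (metis UNIV_I subsetI subset_antisym)
  define f where "f = (\<lambda>s. G s / (s - 1))"
  have "f holomorphic_on (- {1})"
    unfolding f_def by (intro holomorphic_intros holomorphic_on_subset[OF Gh]) auto
  moreover have "f s = zeta_series s" if "Re s > 1" for s
    using that G[of 0 s] F(2)[of s 0] by (auto simp: f_def)
  moreover have "f 1 = 0" by (simp add: f_def)
  moreover have "g = h" if g: "g holomorphic_on (- {1})" "\<forall>s. Re s > 1 \<longrightarrow> g s = zeta_series s" "g 1 = 0"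
    and h: "h holomorphic_on (- {1})" "\<forall>s. Re s > 1 \<longrightarrow> h s = zeta_series s" "h 1 = 0" for g h
  proof
    fix s :: complex
    show "g s = h s"
    proof (cases "s = 1")
      case False
      show ?thesis
      proof (rule analytic_continuation_open[where f = g and g = h and
            s = "{s. Re s > 1}" and s' = "- {1}"])
        show "{s::complex. Re s > 1} \<noteq> {}" by (auto intro!: exI[of _ 2])
        show "connected (- {1::complex})"
          by (rule connected_punctured_universe) simp
      qed (use g h False in \<open>auto simp: open_Re_gt\<close>)
    qed (use g h in auto)
  qed
  ultimately show ?thesis by (intro ex1I[of _ f]) blast+
qed

lemma holomorphic_zeta: "zeta holomorphic_on (- {1})"
  and zeta_eq_series: "Re s > 1 \<Longrightarrow> zeta s = zeta_series s"
  using theI'[OF zeta_ex1] unfolding zeta_def[symmetric] by auto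

section \<open>The Riemann xi function\<close>

(* remove_sings matters: in HOL the pointwise product vanishes at s = 0, 1 and at the
   poles s = -2, -4, ... of Gamma (s/2), where the library sets Gamma to 0, whereas
   the entire function xi takes its (nonzero) limit there. *)
definition xi :: "complex \<Rightarrow> complex" where
  "xi = remove_sings (\<lambda>s. 1/2 * s * (s - 1) * of_real pi powr (- s/2) * Gamma (s/2) * zeta s)"

definition riemann_hypothesis :: bool where
  "riemann_hypothesis \<longleftrightarrow> (\<forall>s. xi s = 0 \<longrightarrow> Re s = 1/2)"

section \<open>The function Psi\<close>

definition catalan :: real where
  "catalan = (\<Sum>n. (-1) ^ n / real (2 * n + 1) ^ 2)"

definition lerch_phi :: "real \<Rightarrow> real \<Rightarrow> real \<Rightarrow> real" where
  "lerch_phi z s a = (\<Sum>n. (real n + a) powr (- s) * z ^ n)"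

definition Psi_nonneg :: "real \<Rightarrow> real" where
  "Psi_nonneg t =
     4 * (exp (t/2) + exp (- t/2) - 2)
     - (\<Sum>n | 1 \<le> n \<and> real n \<le> exp t. mangoldt n / sqrt (real n) * (t - ln (real n)))
     + t/2 * (Digamma (1/4) - ln pi)
     + 1/4 * ((pi\<^sup>2 + 8 * catalan) - exp (- t/2) * lerch_phi (exp (- 2*t)) 2 (1/4))"

definition Psi :: "real \<Rightarrow> real" where
  "Psi t = Psi_nonneg \<bar>t\<bar>"

section \<open>Screw functions\<close>

definition screw_kernel :: "(real \<Rightarrow> complex) \<Rightarrow> real \<Rightarrow> real \<Rightarrow> complex" where
  "screw_kernel g t u = g (t - u) - g t - g (- u) + g 0"

(* Elements are total functions, constrained only on (-2a,2a), so for finite a the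
   values outside are irrelevant. *)
definition screw_class :: "ereal \<Rightarrow> (real \<Rightarrow> complex) set" where
  "screw_class a = {g.
     continuous_on {t. ereal \<bar>t\<bar> < 2 * a} g \<and>
     (\<forall>t. ereal \<bar>t\<bar> < 2 * a \<longrightarrow> g (- t) = cnj (g t)) \<and>
     (\<forall>(n::nat) (t :: nat \<Rightarrow> real) (\<xi> :: nat \<Rightarrow> complex).
        (\<forall>i<n. ereal \<bar>t i\<bar> < a) \<longrightarrow>
        (\<Sum>i<n. \<Sum>j<n. screw_kernel g (t i) (t j) * \<xi> i * cnj (\<xi> j)) \<in> \<real>\<^sub>\<ge>\<^sub>0)}"

end

theory Submission
  imports Defs "HOL-Real_Asymp.Real_Asymp"
begin

text \<open>
  Everything rests on the identity that the Laplace transform of \<open>Psi\<close> at \<open>s > 1/2\<close> equals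
  \<open>F(s) / s^2\<close>, where \<open>F(s)\<close> is the logarithmic derivative of \<open>xi\<close> at \<open>1/2 + s\<close>.

  If \<open>-Psi\<close> is a screw function, non-negativity of the kernel at the points \<open>t\<close> and \<open>-t\<close> gives
  \<open>Psi(2 t) - Psi(0) \<le> 4 (Psi(t) - Psi(0))\<close>, so \<open>Psi\<close> grows at most quadratically and its Laplace
  transform is holomorphic for \<open>Re s > 0\<close>. Hence \<open>xi' / xi\<close> continues holomorphically to
  \<open>Re s > 1/2\<close>, where \<open>xi\<close> therefore has no zeros; the functional equation excludes the left half.

  Conversely, \<open>xi(1/2 + s) = h(s^2)\<close> with \<open>h\<close> entire of order less than one. Removing the zeros of
  \<open>h\<close> in a disc by Blaschke factors and estimating what is left by Borel and Caratheodory expresses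
  \<open>h' / h\<close> as the limit of the sums of \<open>1 / (w - z)\<close> over the zeros \<open>z\<close> in growing discs, without
  a Hadamard product. Under the Riemann hypothesis these zeros are real and non-positive, \<open>z = -y\<close>,
  and \<open>2 / (s (s^2 + y))\<close> is the Laplace transform of \<open>2 (1 - cos (sqrt y t)) / y\<close>. By uniqueness of
  Laplace transforms \<open>Psi\<close> is a sum of such functions, each of which is the negative of a screw function.

  The functional equation comes from expanding \<open>1 / (exp x - 1) - 1 / x + 1/2\<close> into partial fractions
  and taking Mellin transforms on \<open>-1 < s < 0\<close>.
\<close>

section \<open>Logarithmic derivatives of entire functions\<close>

text \<open>Exchanges of sum and integral rest on positivity: the Lerch part and the prime part of
  \<open>Psi\<close>, the Mellin integrands and the terms belonging to the zeros are all series of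
  non-negative functions, so no dominating function has to be found, and Laplace transforms are
  computed at real \<open>s\<close> only. Complex arguments are reached through the identity
  theorem.

  The variable \<open>w = s^2\<close> is what makes a Hadamard product avoidable. In
  \<open>s\<close>, the logarithm of the maximum modulus of \<open>xi\<close> is bounded by a
  multiple of \<open>r log r\<close>, too much for an estimate that divides by \<open>r\<close>; in
  \<open>w\<close> the bound becomes \<open>sqrt R log R\<close>, which is \<open>o(R)\<close>, so
  the error in the logarithmic derivative tends to 0 and no exponential factor can survive.

  The strip \<open>-1 < s < 0\<close> is dictated by the function
  \<open>1 / (exp x - 1) - 1 / x + 1/2\<close>: it is of order \<open>x\<close> at 0 and tends to
  1/2 at infinity, so its Mellin integral converges exactly there. Expanding it in partial fractions
  produces \<open>zeta (1 - s)\<close>, while continuation from \<open>s > 1\<close> produces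
  \<open>zeta s\<close>.\<close>

lemma Borel_Caratheodory_deriv:
  assumes holq: "q holomorphic_on ball c r" and r: "0 < r"
    and A: "\<And>w. w \<in> ball c r \<Longrightarrow> Re (q w) < A"
    and w: "dist c w \<le> r / 4"
  shows "norm (deriv q w) \<le> 8 * (A - Re (q c)) / r"
proof -
  define d where "d = A - Re (q c)"
  have d: "d > 0" using A[of c] r by (simp add: d_def)
  define v where "v = (\<lambda>u. q (c + of_real r * u) - q c)"
  have inb: "c + of_real r * u \<in> ball c r" if "norm u < 1" for u
    using that r by (simp add: dist_norm norm_mult)
  have Rev: "Re (v u) < d" if "norm u < 1" for u
    using A[OF inb[OF that]] by (simp add: v_def d_def)
  have v_hol: "v holomorphic_on ball 0 1"
  proof -
    have "(q \<circ> (\<lambda>u. c + of_real r * u)) holomorphic_on ball 0 1"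
      by (rule holomorphic_on_compose_gen[where t = "ball c r"])
         (use inb in \<open>auto intro!: holomorphic_intros holq simp: image_subset_iff\<close>)
    then show ?thesis unfolding v_def o_def by (intro holomorphic_intros)
  qed
  have ne: "2 * of_real d - v u \<noteq> 0" if "norm u < 1" for u
  proof
    assume "2 * of_real d - v u = 0"
    then have "v u = 2 * of_real d" by simp
    then have "Re (v u) = 2 * d" by simp
    with Rev[OF that] d show False by simp
  qed
  \<comment> \<open>\<open>Re (v u) < d\<close> says that \<open>v u\<close> lies closer to 0 than
    to \<open>2 * d\<close>. Hence \<open>v / (2 * d - v)\<close> maps the unit disc into itself and
    fixes 0, so the Schwarz lemma applies.\<close>
  have less: "norm (v u) < norm (2 * of_real d - v u)" if "norm u < 1" for u
  proof -
    have "(norm (v u))\<^sup>2 < (norm (2 * of_real d - v u))\<^sup>2"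
      using Rev[OF that] d by (simp add: cmod_power2 power2_diff algebra_simps) (simp add: power2_eq_square)
    then show ?thesis by (rule power2_less_imp_less) simp
  qed
  have half: "norm (v u) \<le> 2 * d" if u: "norm u \<le> 1/2" for u
  proof -
    have "norm ((\<lambda>u. v u / (2 * of_real d - v u)) u) \<le> norm u"
    proof (rule Schwarz_Lemma(1))
      show "(\<lambda>u. v u / (2 * of_real d - v u)) holomorphic_on ball 0 1"
        by (intro holomorphic_intros v_hol) (use ne in auto)
      show "v 0 / (2 * complex_of_real d - v 0) = 0" by (simp add: v_def)
      show "norm (v z / (2 * of_real d - v z)) < 1" if "norm z < 1" for z
        using less[OF that] ne[OF that] by (simp add: norm_divide divide_simps)
    qed (use u in auto)
    then have "norm (v u) \<le> norm u * norm (2 * of_real d - v u)"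
      using ne[of u] u by (simp add: norm_divide divide_simps)
    also have "\<dots> \<le> (1/2) * (2 * d + norm (v u))"
    proof (intro mult_mono u)
      show "norm (2 * of_real d - v u) \<le> 2 * d + norm (v u)"
        using norm_triangle_ineq4[of "2 * of_real d" "v u"] d by (simp add: norm_mult)
    qed auto
    finally show ?thesis by simp
  qed
  have near: "norm (q x - q c) \<le> 2 * d" if "dist c x \<le> r / 2" for x
  proof -
    have "norm ((x - c) / of_real r) \<le> 1/2"
      using that r by (simp add: norm_divide dist_norm norm_minus_commute divide_simps)
    from half[OF this] show ?thesis using r by (simp add: v_def)
  qed
  \<comment> \<open>The circle of radius \<open>r / 4\<close> about \<open>w\<close> stays within
    distance \<open>r / 2\<close> of \<open>c\<close>, where \<open>near\<close> holds; Cauchy's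
    inequality then gives \<open>2 * d / (r / 4)\<close>, the source of the constant 8.\<close>
  have sub: "cball w (r/4) \<subseteq> ball c r" and sub': "x \<in> cball w (r/4) \<Longrightarrow> dist c x \<le> r/2" for x
    using w r by (auto simp: dist_norm) (smt (verit) dist_norm dist_triangle2 dist_commute field_sum_of_halves)+
  have "norm ((deriv ^^ 1) (\<lambda>x. q x - q c) w) \<le> fact 1 * (2 * d) / (r/4) ^ 1"
  proof (rule Cauchy_inequality)
    show "(\<lambda>x. q x - q c) holomorphic_on ball w (r/4)"
      using sub by (intro holomorphic_intros holomorphic_on_subset[OF holq]) auto
    show "continuous_on (cball w (r/4)) (\<lambda>x. q x - q c)"
      using sub by (intro continuous_intros holomorphic_on_imp_continuous_on holomorphic_on_subset[OF holq]) auto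
    show "norm (q x - q c) \<le> 2 * d" if "norm (w - x) = r / 4" for x
      by (rule near, rule sub') (use that in \<open>simp add: dist_norm\<close>)
  qed (use r in auto)
  moreover have "deriv (\<lambda>x. q x - q c) w = deriv q w"
  proof -
    have "q field_differentiable at w"
      using holq sub r by (meson centre_in_cball holomorphic_on_imp_differentiable_at open_ball subset_iff zero_le_divide_iff less_imp_le zero_le_numeral)
    then show ?thesis by simp
  qed
  ultimately show ?thesis using r by (simp add: d_def field_simps)
qed

text \<open>A zero-free \<open>H\<close> has a holomorphic logarithm \<open>q\<close> on the disc,
  with \<open>Re q = ln |H|\<close> and \<open>q' = H' / H\<close>, so an upper bound for
  \<open>|H|\<close> controls the logarithmic derivative through
  \<open>Borel_Caratheodory_deriv\<close>.\<close>

lemma log_deriv_bound: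
  assumes hol: "H holomorphic_on ball c r" and r: "0 < r"
    and nz: "\<And>w. w \<in> ball c r \<Longrightarrow> H w \<noteq> 0"
    and M: "\<And>w. w \<in> ball c r \<Longrightarrow> norm (H w) < exp A"
    and w: "dist c w \<le> r / 4"
  shows "norm (deriv H w / H w) \<le> 8 * (A - ln (norm (H c))) / r"
proof -
  obtain q where q: "q holomorphic_on ball c r" "\<And>z. z \<in> ball c r \<Longrightarrow> H z = exp (q z)"
    using holomorphic_logarithm_exists[OF convex_ball open_ball hol] nz r by (metis centre_in_ball)
  have wb: "w \<in> ball c r" using w r by simp
  have "norm (H z) = exp (Re (q z))" if "z \<in> ball c r" for z
    using q(2)[OF that] by simp
  then have Re: "Re (q z) = ln (norm (H z))" if "z \<in> ball c r" for z using that by simp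
  have "norm (deriv q w) \<le> 8 * (A - Re (q c)) / r"
  proof (rule Borel_Caratheodory_deriv[OF q(1) r _ w])
    show "Re (q z) < A" if "z \<in> ball c r" for z
      using M[OF that] q(2)[OF that] by simp
  qed
  moreover have "deriv H w = deriv (\<lambda>z. exp (q z)) w"
    by (rule deriv_cong_ev) (use q wb in \<open>auto intro!: eventually_nhds_in_open[of "ball c r" w, THEN eventually_mono]\<close>)
  moreover have "(q has_field_derivative deriv q w) (at w)"
    using q(1) wb holomorphic_derivI open_ball by blast
  then have "((\<lambda>z. exp (q z)) has_field_derivative exp (q w) * deriv q w) (at w)"
    by (auto intro!: derivative_eq_intros)
  then have "deriv (\<lambda>z. exp (q z)) w = exp (q w) * deriv q w" by (rule DERIV_imp_deriv)
  ultimately show ?thesis using q(2)[OF wb] Re[of c] r by simp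
qed

text \<open>The hypothesis at \<open>b\<close> excludes the zero function. The quotient is
  \<open>zor_poly\<close> near \<open>a\<close> and the plain quotient elsewhere; the two agree on
  the overlap, so the glued function is entire.\<close>

lemma entire_divide_zero:
  assumes G: "G holomorphic_on UNIV" and nz: "G b \<noteq> 0"
  obtains G1 where "G1 holomorphic_on UNIV" "G1 a \<noteq> 0"
    "\<And>w. G w = (w - a) ^ nat (zorder G a) * G1 w"
proof -
  define n where "n = nat (zorder G a)"
  from zorder_exist_zero[OF G open_UNIV connected_UNIV UNIV_I, of a] nz
  obtain r where r: "r > 0" "zor_poly G a holomorphic_on cball a r"
    "\<And>w. w \<in> cball a r \<Longrightarrow> G w = zor_poly G a w * (w - a) ^ n \<and> zor_poly G a w \<noteq> 0"
    unfolding n_def by blast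
  define G1 where "G1 = (\<lambda>w. if w = a then zor_poly G a a else G w / (w - a) ^ n)"
  have eq: "G1 w = zor_poly G a w" if "w \<in> cball a r" for w
    using r(3)[OF that] by (auto simp: G1_def)
  have "G1 holomorphic_on ball a r"
    by (rule holomorphic_transform[of "zor_poly G a"])
       (use eq r(2) in \<open>auto intro: holomorphic_on_subset\<close>)
  moreover have "G1 holomorphic_on - {a}"
    by (rule holomorphic_transform[of "\<lambda>w. G w / (w - a) ^ n"])
       (auto intro!: holomorphic_intros holomorphic_on_subset[OF G] simp: G1_def)
  ultimately have "G1 holomorphic_on ball a r \<union> - {a}"
    by (intro holomorphic_on_Un) auto
  moreover have "ball a r \<union> - {a} = UNIV" using r(1) by auto
  moreover have "G1 a \<noteq> 0" using eq[of a] r(3)[of a] r(1) by simp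
  moreover have "G w = (w - a) ^ n * G1 w" for w
    using r(3)[of a] r(1) by (auto simp: G1_def)
  ultimately show ?thesis using that n_def by auto
qed

text \<open>The exponents are the orders of \<open>h\<close> itself. When \<open>a\<close> is split
  off the partially divided \<open>G\<close>, its order there equals that of \<open>h\<close>
  because the factors removed before do not vanish at \<open>a\<close>.\<close>

lemma entire_factor_finite_zeros:
  assumes h: "h holomorphic_on UNIV" and nz: "h b \<noteq> 0" and A: "finite A"
  obtains G where "G holomorphic_on UNIV" "\<And>z. z \<in> A \<Longrightarrow> G z \<noteq> 0"
    "\<And>w. h w = (\<Prod>z\<in>A. (w - z) ^ nat (zorder h z)) * G w"
  using A
proof (induction A arbitrary: thesis rule: finite_induct)
  case empty
  show ?case by (rule empty[of h]) (use h in auto)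
next
  case (insert a A)
  define P where "P = (\<lambda>w. \<Prod>z\<in>A. (w - z) ^ nat (zorder h z))"
  obtain G where G: "G holomorphic_on UNIV" "\<And>z. z \<in> A \<Longrightarrow> G z \<noteq> 0" "\<And>w. h w = P w * G w"
    using insert.IH unfolding P_def by blast
  have Gb: "G b \<noteq> 0" using nz G(3)[of b] by auto
  obtain G1 where G1: "G1 holomorphic_on UNIV" "G1 a \<noteq> 0" "\<And>w. G w = (w - a) ^ nat (zorder G a) * G1 w"
    using entire_divide_zero[OF G(1) Gb] by blast
  have Pa: "P a \<noteq> 0" using insert.hyps by (auto simp: P_def)
  have "zorder G a \<ge> 0"
    using zorder_exist_zero[OF G(1) open_UNIV connected_UNIV UNIV_I, of a] Gb by (metis UNIV_I less_imp_le order_refl)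
  then have "zorder h a = zorder G a"
    by (intro zorder_eqI[of UNIV _ "\<lambda>w. P w * G1 w"])
       (use G1 G Pa in \<open>auto intro!: holomorphic_intros simp: P_def power_int_def\<close>)
  then have "h w = (\<Prod>z\<in>insert a A. (w - z) ^ nat (zorder h z)) * G1 w" for w
    using insert.hyps G(3)[of w] G1(3)[of w] by (simp add: P_def)
  moreover have "G1 z \<noteq> 0" if "z \<in> insert a A" for z
    using that G1 G(2)[of z] G1(3)[of z] by auto
  ultimately show ?case using insert.prems[of G1] G1(1) by blast
qed

lemma has_field_derivative_prod_power:
  fixes f :: "'a \<Rightarrow> complex \<Rightarrow> complex"
  assumes "finite A" "\<And>z. z \<in> A \<Longrightarrow> (f z has_field_derivative f' z) (at w)" "\<And>z. z \<in> A \<Longrightarrow> f z w \<noteq> 0"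
  shows "((\<lambda>u. \<Prod>z\<in>A. f z u ^ m z) has_field_derivative
      (\<Prod>z\<in>A. f z w ^ m z) * (\<Sum>z\<in>A. of_nat (m z) * (f' z / f z w))) (at w)"
  using assms
proof (induction A rule: finite_induct)
  case (insert a A)
  have *: "((\<lambda>u. f a u ^ m a) has_field_derivative f a w ^ m a * (of_nat (m a) * (f' a / f a w))) (at w)"
  proof -
    have "((\<lambda>u. f a u ^ m a) has_field_derivative of_nat (m a) * f a w ^ (m a - 1) * f' a) (at w)"
      by (rule DERIV_power[THEN DERIV_cong]) (use insert.prems in \<open>auto simp: mult_ac\<close>)
    moreover have "f a w ^ m a * (of_nat (m a) * (f' a / f a w)) = of_nat (m a) * f a w ^ (m a - 1) * f' a"
      using insert.prems(2)[of a] by (cases "m a") (auto simp: field_simps)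
    ultimately show ?thesis by simp
  qed
  have "((\<lambda>u. f a u ^ m a * (\<Prod>z\<in>A. f z u ^ m z)) has_field_derivative
     f a w ^ m a * (of_nat (m a) * (f' a / f a w)) * (\<Prod>z\<in>A. f z w ^ m z) +
     (\<Prod>z\<in>A. f z w ^ m z) * (\<Sum>z\<in>A. of_nat (m z) * (f' z / f z w)) * f a w ^ m a) (at w)"
    by (intro DERIV_mult * insert.IH insert.prems) auto
  then show ?case using insert.hyps by (simp add: algebra_simps)
qed auto

lemma entire_finite_zeros_cball:
  assumes hol: "h holomorphic_on UNIV" and hc: "h c \<noteq> 0"
  shows "finite {z. dist c z \<le> R \<and> h z = 0}"
proof (cases "{z. dist c z \<le> R \<and> h z = 0} = {}")
  case False
  then obtain z where "h z = 0" by blast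
  then have nc: "\<not> h constant_on UNIV" using hc unfolding constant_on_def by force
  have "{z. dist c z \<le> R \<and> h z = 0} = {z \<in> cball c R. h z = 0}" by auto
  then show ?thesis
    using holomorphic_compact_finite_zeros[OF hol open_UNIV connected_UNIV compact_cball[of c R] subset_UNIV nc]
    by simp
next
  case True
  then show ?thesis by (simp only: finite.emptyI)
qed

text \<open>The factors \<open>u - z\<close> are exchanged for Blaschke-type factors of equal
  modulus on the circle of radius \<open>2 * R\<close>. The resulting \<open>H\<close> has the
  growth of \<open>h\<close> but no zeros in the disc of radius \<open>R\<close>. Then
  \<open>h' / h\<close> minus the sum over zeros equals \<open>H' / H\<close> minus the contribution
  of the new factors, and both tend to 0 because \<open>L R / R\<close> does.\<close>

theorem log_deriv_zeros:
  fixes h :: "complex \<Rightarrow> complex" and L :: "real \<Rightarrow> real"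
  assumes hol: "h holomorphic_on UNIV" and hc: "h c \<noteq> 0"
    and L: "\<And>R w. R > 0 \<Longrightarrow> dist c w \<le> R \<Longrightarrow> norm (h w) \<le> exp (L R)"
    and Llim: "((\<lambda>R. L R / R) \<longlongrightarrow> 0) at_top"
    and hw: "h w \<noteq> 0"
  shows "((\<lambda>R. \<Sum>z | dist c z \<le> R \<and> h z = 0. of_nat (nat (zorder h z)) / (w - z)) \<longlongrightarrow> deriv h w / h w) at_top"
proof -
  define m where "m = (\<lambda>z. nat (zorder h z))"
  define l where "l = ln (norm (h c))"
  have main: "norm ((\<Sum>z | dist c z \<le> R \<and> h z = 0. of_nat (m z) / (w - z)) - deriv h w / h w)
      \<le> 8 * (L (2 * R) + 1 - l) / R + (L (2 * R) - l) / (R * ln 2)" (is "norm ?D \<le> _")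
    if R: "R \<ge> 1" "dist c w \<le> R / 4" for R
  proof -
    define Z where "Z = {z. dist c z \<le> R \<and> h z = 0}"
    have finZ: "finite Z"
      unfolding Z_def by (rule entire_finite_zeros_cball[OF hol hc])
    obtain G where G: "G holomorphic_on UNIV" "\<And>z. z \<in> Z \<Longrightarrow> G z \<noteq> 0"
      "\<And>u. h u = (\<Prod>z\<in>Z. (u - z) ^ m z) * G u"
      using entire_factor_finite_zeros[OF hol hc finZ] unfolding m_def by blast
    have Gnz: "G u \<noteq> 0" if "dist c u \<le> R" for u
      using G(2)[of u] G(3)[of u] that by (auto simp: Z_def)
    \<comment> \<open>\<open>B z u\<close> has the same modulus as \<open>u - z\<close> on the circle of radius \<open>2 R\<close>, but no zero in the disc.\<close>
    define B where "B = (\<lambda>z u. (of_real (4 * R\<^sup>2) - cnj (z - c) * (u - c)) / of_real (2 * R))"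
    define H where "H = (\<lambda>u. (\<Prod>z\<in>Z. B z u ^ m z) * G u)"
    have Hhol: "H holomorphic_on UNIV"
      unfolding H_def B_def using R by (intro holomorphic_intros G) auto
    have Bsphere: "norm (B z u) = norm (u - z)" if "dist c u = 2 * R" for z u
    proof -
      have n: "norm (u - c) = 2 * R" using that by (simp add: dist_norm norm_minus_commute)
      have "of_real (4 * R\<^sup>2) = (u - c) * cnj (u - c)"
        using complex_norm_square[of "u - c"] unfolding n by (simp add: power_mult_distrib)
      then have "of_real (4 * R\<^sup>2) - cnj (z - c) * (u - c) = (u - c) * cnj (u - z)"
        by (simp add: algebra_simps)
      then have "norm (of_real (4 * R\<^sup>2) - cnj (z - c) * (u - c)) = 2 * R * norm (u - z)"
        by (simp add: norm_mult n del: complex_cnj_diff)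
      then show ?thesis using R unfolding B_def by (simp add: norm_divide)
    qed
    have Hbound: "norm (H u) \<le> exp (L (2 * R))" if "dist c u \<le> 2 * R" for u
    proof (rule maximum_modulus_frontier[of H "cball c (2*R)" _ u])
      show "norm (H x) \<le> exp (L (2 * R))" if "x \<in> frontier (cball c (2 * R))" for x
      proof -
        have x: "dist c x = 2 * R" using that R by simp
        have "norm (H x) = norm (h x)"
          unfolding H_def G(3)[of x] by (simp add: norm_mult prod_norm[symmetric] norm_power Bsphere[OF x])
        also have "\<dots> \<le> exp (L (2 * R))" using L[of "2 * R" x] x R by simp
        finally show ?thesis .
      qed
      show "H holomorphic_on interior (cball c (2*R))"
        by (rule holomorphic_on_subset[OF Hhol]) simp
      show "continuous_on (closure (cball c (2*R))) H"
        by (rule holomorphic_on_imp_continuous_on, rule holomorphic_on_subset[OF Hhol]) simp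
      show "bounded (cball c (2*R))" by simp
      show "u \<in> cball c (2*R)" using that by simp
    qed
    \<comment> \<open>A Jensen-type count: at the centre a new factor has modulus
      \<open>2 * R\<close>, at least twice \<open>norm (c - z)\<close>, so each zero in the disc at
      least doubles \<open>norm (H c)\<close> relative to \<open>norm (h c)\<close>. As
      \<open>norm (H c)\<close> is bounded by \<open>exp (L (2 * R))\<close>, this limits
      \<open>N\<close>.\<close>
    define N where "N = (\<Sum>z\<in>Z. m z)"
    have Hc: "2 ^ N * norm (h c) \<le> norm (H c)"
    proof -
      have "2 ^ N * (\<Prod>z\<in>Z. norm (c - z) ^ m z) = (\<Prod>z\<in>Z. (2 * norm (c - z)) ^ m z)"
        by (simp add: N_def power_sum prod.distrib power_mult_distrib)
      also have "\<dots> \<le> (\<Prod>z\<in>Z. norm (B z c) ^ m z)"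
      proof (intro prod_mono conjI power_mono)
        fix z assume "z \<in> Z"
        then have "norm (c - z) \<le> R" by (simp add: Z_def dist_norm)
        moreover have "norm (B z c) = 2 * R"
          using R by (simp add: B_def norm_divide norm_mult power2_eq_square)
        ultimately show "2 * norm (c - z) \<le> norm (B z c)" by simp
      qed auto
      finally have "2 ^ N * (\<Prod>z\<in>Z. norm (c - z) ^ m z) * norm (G c) \<le> (\<Prod>z\<in>Z. norm (B z c) ^ m z) * norm (G c)"
        by (rule mult_right_mono) simp
      then show ?thesis unfolding H_def G(3)[of c]
        by (simp add: norm_mult prod_norm[symmetric] norm_power mult.assoc)
    qed
    have hc0: "norm (h c) > 0" using hc by simp
    have Hc0: "norm (H c) > 0" using Hc hc0 by (smt (verit) mult_pos_pos zero_less_power)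
    have "real N * ln 2 + l = ln (2 ^ N * norm (h c))"
      using hc0 by (simp add: ln_mult ln_realpow l_def)
    also have "\<dots> \<le> ln (norm (H c))" using Hc hc0 Hc0 by simp
    finally have lH: "real N * ln 2 + l \<le> ln (norm (H c))" .
    have "norm (H c) \<le> exp (L (2 * R))" using Hbound[of c] R by simp
    then have "ln (norm (H c)) \<le> L (2 * R)" using Hc0 by (metis ln_exp ln_le_cancel_iff exp_gt_zero)
    with lH have N: "real N * ln 2 \<le> L (2 * R) - l" by simp
    have l: "l \<le> ln (norm (H c))" using lH by (smt (verit) mult_nonneg_nonneg of_nat_0_le_iff ln_ge_zero)
    \<comment> \<open>Points of the disc of radius \<open>R\<close> give
      \<open>|z - c| |u - c| <= R^2\<close>, against \<open>4 * R^2\<close>. The radius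
      \<open>2 * R\<close> leaves this gap, which keeps \<open>B z\<close> away from 0 and bounds
      its logarithmic derivative by \<open>1 / (3 * R)\<close>.\<close>
    have Bden: "norm (of_real (4 * R\<^sup>2) - cnj (z - c) * (u - c)) \<ge> 3 * R\<^sup>2"
      if "z \<in> Z" "dist c u \<le> R" for z u
    proof -
      have "norm (cnj (z - c) * (u - c)) \<le> R * R"
        unfolding norm_mult complex_mod_cnj
        by (rule mult_mono) (use that R in \<open>auto simp: Z_def dist_norm norm_minus_commute\<close>)
      moreover have "norm (complex_of_real (4 * R\<^sup>2)) = 4 * R\<^sup>2" by (simp only: norm_of_real) simp
      ultimately show ?thesis
        using norm_triangle_ineq2[of "complex_of_real (4 * R\<^sup>2)" "cnj (z - c) * (u - c)"]
        unfolding power2_eq_square by linarith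
    qed
    have Bnz: "B z u \<noteq> 0" if "z \<in> Z" "dist c u \<le> R" for z u
    proof -
      have "3 * R\<^sup>2 > 0" using R by simp
      then show ?thesis using Bden[OF that] R unfolding B_def by (metis divide_eq_0_iff norm_zero not_less of_real_eq_0_iff mult_eq_0_iff zero_neq_numeral not_one_le_zero)
    qed
    have Hnz: "H u \<noteq> 0" if "dist c u \<le> R" for u
      unfolding H_def using Gnz[OF that] Bnz[OF _ that] finZ by auto
    have 1: "norm (deriv H w / H w) \<le> 8 * (L (2 * R) + 1 - ln (norm (H c))) / R"
    proof (rule log_deriv_bound)
      show "H holomorphic_on ball c R" by (rule holomorphic_on_subset[OF Hhol]) auto
      show "norm (H u) < exp (L (2 * R) + 1)" if "u \<in> ball c R" for u
      proof -
        have "norm (H u) \<le> exp (L (2 * R))" using Hbound[of u] that R by auto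
        also have "\<dots> < exp (L (2 * R) + 1)" by simp
        finally show ?thesis .
      qed
    qed (use R Hnz in auto)
    have wR: "dist c w \<le> R" using R by simp
    have wZ: "w - z \<noteq> 0" if "z \<in> Z" for z using that hw by (auto simp: Z_def)
    have dG: "(G has_field_derivative deriv G w) (at w)"
      using G(1) holomorphic_derivI by blast
    define S1 where "S1 = (\<Sum>z\<in>Z. of_nat (m z) * (1 / (w - z)))"
    define S2 where "S2 = (\<Sum>z\<in>Z. of_nat (m z) * ((- cnj (z - c) / of_real (2 * R)) / B z w))"
    have "((\<lambda>u. (\<Prod>z\<in>Z. (u - z) ^ m z) * G u) has_field_derivative
        (\<Prod>z\<in>Z. (w - z) ^ m z) * S1 * G w + deriv G w * (\<Prod>z\<in>Z. (w - z) ^ m z)) (at w)"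
      unfolding S1_def
      by (intro DERIV_mult has_field_derivative_prod_power dG finZ)
         (use wZ in \<open>auto intro!: derivative_eq_intros\<close>)
    then have dh: "deriv h w = (\<Prod>z\<in>Z. (w - z) ^ m z) * S1 * G w + deriv G w * (\<Prod>z\<in>Z. (w - z) ^ m z)"
      unfolding G(3)[symmetric] by (rule DERIV_imp_deriv)
    have "(\<Prod>z\<in>Z. (w - z) ^ m z) \<noteq> 0" using wZ finZ by auto
    then have h': "deriv h w / h w = S1 + deriv G w / G w"
      unfolding dh G(3)[of w] using Gnz[OF wR] by (simp add: field_simps)
    have "((\<lambda>u. (\<Prod>z\<in>Z. B z u ^ m z) * G u) has_field_derivative
        (\<Prod>z\<in>Z. B z w ^ m z) * S2 * G w + deriv G w * (\<Prod>z\<in>Z. B z w ^ m z)) (at w)"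
      unfolding S2_def
      by (intro DERIV_mult has_field_derivative_prod_power dG finZ Bnz wR)
         (use R in \<open>auto intro!: derivative_eq_intros simp: B_def field_simps\<close>)
    then have dH: "deriv H w = (\<Prod>z\<in>Z. B z w ^ m z) * S2 * G w + deriv G w * (\<Prod>z\<in>Z. B z w ^ m z)"
      unfolding H_def[symmetric] by (rule DERIV_imp_deriv)
    have "(\<Prod>z\<in>Z. B z w ^ m z) \<noteq> 0" using Bnz[OF _ wR] finZ by auto
    then have H': "deriv H w / H w = S2 + deriv G w / G w"
      unfolding dH unfolding H_def using Gnz[OF wR] by (simp add: field_simps)
    have "norm S2 \<le> (\<Sum>z\<in>Z. real (m z) * (1 / R))"
      unfolding S2_def
    proof (rule sum_norm_le)
      fix z assume z: "z \<in> Z"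
      have "norm ((- cnj (z - c) / of_real (2 * R)) / B z w) =
          norm (z - c) / norm (of_real (4 * R\<^sup>2) - cnj (z - c) * (w - c))"
        using R unfolding B_def by (simp add: norm_divide del: complex_cnj_diff of_real_mult)
      also have "\<dots> \<le> R / (3 * R\<^sup>2)"
        by (rule frac_le) (use z R Bden[OF z wR] in \<open>auto simp: Z_def dist_norm norm_minus_commute\<close>)
      also have "\<dots> \<le> 1 / R" using R by (simp add: power2_eq_square field_simps)
      finally show "norm (of_nat (m z) * ((- cnj (z - c) / of_real (2 * R)) / B z w)) \<le> real (m z) * (1 / R)"
        unfolding norm_mult by (intro mult_mono) auto
    qed
    also have "\<dots> = real N / R" by (simp add: N_def sum_divide_distrib)
    also have "\<dots> \<le> (L (2 * R) - l) / (R * ln 2)" using N R by (simp add: field_simps)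
    finally have 2: "norm S2 \<le> (L (2 * R) - l) / (R * ln 2)" .
    \<comment> \<open>\<open>deriv G w / G w\<close> occurs in both logarithmic derivatives and
      cancels, so \<open>?D\<close> involves only \<open>H\<close> and the new factors.\<close>
    have D: "?D = S2 - deriv H w / H w"
      unfolding h' H' S1_def Z_def[symmetric] by simp
    have "norm ?D \<le> norm S2 + norm (deriv H w / H w)"
      unfolding D by (rule norm_triangle_ineq4)
    also have "norm (deriv H w / H w) \<le> 8 * (L (2 * R) + 1 - l) / R"
      using 1 l R by (smt (verit) divide_right_mono)
    finally show ?thesis using 2 by simp
  qed
  have lim2: "((\<lambda>R. L (2 * R) / (2 * R)) \<longlongrightarrow> 0) at_top"
    by (rule filterlim_compose[OF Llim])
       (intro filterlim_tendsto_pos_mult_at_top[OF tendsto_const] filterlim_ident, simp)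
  have inv: "((\<lambda>R::real. 1 / R) \<longlongrightarrow> 0) at_top" by real_asymp
  have "((\<lambda>R. 16 * (L (2 * R) / (2 * R)) + 8 * (1 - l) * (1 / R) + (2 / ln 2) * (L (2 * R) / (2 * R)) - (l / ln 2) * (1 / R))
     \<longlongrightarrow> 16 * 0 + 8 * (1 - l) * 0 + (2 / ln 2) * 0 - (l / ln 2) * 0) at_top"
    by (intro tendsto_intros lim2 inv)
  moreover have "16 * (L (2 * R) / (2 * R)) + 8 * (1 - l) * (1 / R) + (2 / ln 2) * (L (2 * R) / (2 * R)) - (l / ln 2) * (1 / R)
    = 8 * (L (2 * R) + 1 - l) / R + (L (2 * R) - l) / (R * ln 2)" if "R > 0" for R
    using that by (simp add: field_simps)
  ultimately have "((\<lambda>R. 8 * (L (2 * R) + 1 - l) / R + (L (2 * R) - l) / (R * ln 2)) \<longlongrightarrow> 0) at_top"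
    by (subst tendsto_cong[symmetric]) (auto intro!: eventually_mono[OF eventually_gt_at_top[of 0]])
  then have "((\<lambda>R. (\<Sum>z | dist c z \<le> R \<and> h z = 0. of_nat (m z) / (w - z)) - deriv h w / h w) \<longlongrightarrow> 0) at_top"
    by (rule Lim_null_comparison[rotated])
       (use main in \<open>auto intro!: eventually_mono[OF eventually_ge_at_top[of "max 1 (4 * dist c w)"]]\<close>)
  then show ?thesis unfolding m_def by (rule LIM_zero_cancel)
qed

section \<open>Laplace transforms on the half-line\<close>

text \<open>For non-negative terms the integrals of the norms are the \<open>a n\<close> themselves,
  so convergence of their sum already justifies the exchange. It serves for Lebesgue measure and, in
  \<open>mangoldt_sums\<close>, for counting measure.\<close>

lemma has_bochner_integral_sums_nonneg:
  fixes f :: "nat \<Rightarrow> 'a \<Rightarrow> real"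
  assumes nn: "\<And>n x. 0 \<le> f n x"
    and f: "\<And>n. has_bochner_integral M (f n) (a n)" and a: "a sums A"
    and F: "\<And>x. (\<lambda>n. f n x) sums F x"
  shows "has_bochner_integral M F A"
proof -
  have int: "integrable M (f n)" and val: "integral\<^sup>L M (f n) = a n" for n
    using f[of n] unfolding has_bochner_integral_iff by auto
  have ng: "norm (f n x) = f n x" for n x using nn[of n x] by simp
  have 1: "AE x in M. summable (\<lambda>n. norm (f n x))"
    unfolding ng using F sums_summable by blast
  have 2: "summable (\<lambda>n. \<integral>x. norm (f n x) \<partial>M)"
    unfolding ng val using a sums_summable by blast
  have "F = (\<lambda>x. \<Sum>n. f n x)" using F by (auto simp: sums_iff)
  moreover have "integrable M (\<lambda>x. \<Sum>n. f n x)"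
    by (rule integrable_suminf[OF int 1 2])
  moreover have "(\<lambda>n. integral\<^sup>L M (f n)) sums (\<integral>x. (\<Sum>n. f n x) \<partial>M)"
    by (rule sums_integral[OF int 1 2])
  ultimately show ?thesis
    unfolding has_bochner_integral_iff using a val sums_unique2 by fastforce
qed

text \<open>The value is asserted together with absolute integrability, and the indicator lets
  \<open>f\<close> be a function on the whole line, such as the even function
  \<open>Psi\<close>.\<close>

definition has_laplace :: "(real \<Rightarrow> real) \<Rightarrow> real \<Rightarrow> real \<Rightarrow> bool" where
  "has_laplace f s A \<longleftrightarrow> has_bochner_integral lborel (\<lambda>t. indicator {0..} t * (f t * exp (- s * t))) A"

lemma has_laplace_add: "has_laplace f s A \<Longrightarrow> has_laplace g s B \<Longrightarrow> has_laplace (\<lambda>t. f t + g t) s (A + B)"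
  unfolding has_laplace_def by (drule (1) has_bochner_integral_add) (simp add: algebra_simps)

lemma has_laplace_diff: "has_laplace f s A \<Longrightarrow> has_laplace g s B \<Longrightarrow> has_laplace (\<lambda>t. f t - g t) s (A - B)"
  unfolding has_laplace_def by (drule (1) has_bochner_integral_diff) (simp add: algebra_simps)

lemma has_laplace_cmult: "has_laplace f s A \<Longrightarrow> has_laplace (\<lambda>t. c * f t) s (c * A)"
  unfolding has_laplace_def
  using has_bochner_integral_mult_right[of c lborel "\<lambda>t. indicator {0..} t * (f t * exp (- s * t))" A]
  by (simp add: mult_ac)

lemma has_laplace_cong:
  assumes "\<And>t. t \<ge> 0 \<Longrightarrow> f t = g t"
  shows "has_laplace f s A \<longleftrightarrow> has_laplace g s A"
  unfolding has_laplace_def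
  by (rule has_bochner_integral_cong) (use assms in \<open>auto simp: indicator_def\<close>)

text \<open>\<open>F\<close> is a primitive of the whole integrand, exponential included.
  Non-negativity lets the limit of \<open>F\<close> at infinity certify integrability.\<close>

lemma has_laplace_nonneg_FTC:
  assumes f: "continuous_on UNIV f" and nn: "\<And>t. t \<ge> 0 \<Longrightarrow> 0 \<le> f t"
    and F: "\<And>t. t \<ge> 0 \<Longrightarrow> (F has_real_derivative f t * exp (- s * t)) (at t)"
    and lim: "(F \<longlongrightarrow> T) at_top"
  shows "has_laplace f s (T - F 0)"
  unfolding has_laplace_def
proof (rule has_bochner_integral_nn_integral)
  have m[measurable]: "f \<in> borel_measurable borel" using f by (rule borel_measurable_continuous_onI)
  show "(\<lambda>t. indicator {0..} t * (f t * exp (- s * t))) \<in> borel_measurable lborel" by measurable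
  show "AE t in lborel. 0 \<le> indicator {0..} t * (f t * exp (- s * t))"
    by (auto simp: indicator_def nn)
  have "(\<integral>\<^sup>+ t. ennreal (f t * exp (- s * t)) * indicator {0..} t \<partial>lborel) = T - F 0"
    by (rule nn_integral_FTC_atLeast[OF _ F _ lim]) (use nn in auto)
  then show "(\<integral>\<^sup>+ t. ennreal (indicator {0..} t * (f t * exp (- s * t))) \<partial>lborel) = T - F 0"
    by (subst nn_integral_cong[where v = "\<lambda>t. ennreal (f t * exp (- s * t)) * indicator {0..} t"])
       (auto simp: indicator_def)
  have "F 0 \<le> T"
  proof (rule tendsto_lowerbound[OF lim])
    have "F 0 \<le> F t" if "t \<ge> 0" for t
      by (rule DERIV_nonneg_imp_nondecreasing[OF that]) (metis F exp_ge_zero mult_nonneg_nonneg nn)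
    then show "\<forall>\<^sub>F t in at_top. F 0 \<le> F t" by (auto intro: eventually_mono[OF eventually_ge_at_top[of 0]])
  qed simp
  then show "0 \<le> T - F 0" by simp
qed

lemma has_laplace_exp:
  assumes "s > a"
  shows "has_laplace (\<lambda>t. exp (a * t)) s (1 / (s - a))"
proof -
  have "has_laplace (\<lambda>t. exp (a * t)) s (0 - (\<lambda>t. exp ((a - s) * t) / (a - s)) 0)"
  proof (rule has_laplace_nonneg_FTC)
    show "((\<lambda>t. exp ((a - s) * t) / (a - s)) has_real_derivative exp (a * t) * exp (- s * t)) (at t)" for t
    proof -
      have "((\<lambda>t. exp ((a - s) * t) / (a - s)) has_real_derivative exp ((a - s) * t)) (at t)"
        using assms by (auto intro!: derivative_eq_intros)
      moreover have "(a - s) * t = a * t + - s * t" by (simp add: algebra_simps)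
      ultimately show ?thesis by (simp only: exp_add)
    qed
    have "((\<lambda>t. exp ((a - s) * t)) \<longlongrightarrow> 0) at_top"
      using assms by real_asymp
    then show "((\<lambda>t. exp ((a - s) * t) / (a - s)) \<longlongrightarrow> 0) at_top"
      by (rule tendsto_divide_zero)
  qed (auto intro!: continuous_intros)
  moreover have "0 - (\<lambda>t. exp ((a - s) * t) / (a - s)) 0 = 1 / (s - a)"
    by (simp add: minus_divide_right)
  ultimately show ?thesis by simp
qed

lemma has_laplace_one: "s > 0 \<Longrightarrow> has_laplace (\<lambda>t. 1) s (1 / s)"
  using has_laplace_exp[of 0 s] by simp

lemma has_laplace_id:
  assumes "s > 0"
  shows "has_laplace (\<lambda>t. t) s (1 / s\<^sup>2)"
proof -
  have "has_laplace (\<lambda>t. t) s (0 - (\<lambda>t. - (t / s + 1 / s\<^sup>2) * exp (- s * t)) 0)"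
  proof (rule has_laplace_nonneg_FTC)
    show "((\<lambda>t. - (t / s + 1 / s\<^sup>2) * exp (- s * t)) has_real_derivative t * exp (- s * t)) (at t)" for t
      using assms by (auto intro!: derivative_eq_intros simp: field_simps power2_eq_square)
    show "((\<lambda>t. - (t / s + 1 / s\<^sup>2) * exp (- s * t)) \<longlongrightarrow> 0) at_top"
      using assms by real_asymp
  qed (auto intro!: continuous_intros)
  then show ?thesis by simp
qed

lemma has_laplace_square:
  assumes "s > 0"
  shows "has_laplace (\<lambda>t. t\<^sup>2) s (2 / s ^ 3)"
proof -
  have "has_laplace (\<lambda>t. t\<^sup>2) s (0 - (\<lambda>t. - (t\<^sup>2 / s + 2 * t / s\<^sup>2 + 2 / s ^ 3) * exp (- s * t)) 0)"
  proof (rule has_laplace_nonneg_FTC)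
    show "((\<lambda>t. - (t\<^sup>2 / s + 2 * t / s\<^sup>2 + 2 / s ^ 3) * exp (- s * t)) has_real_derivative t\<^sup>2 * exp (- s * t)) (at t)" for t
      using assms by (auto intro!: derivative_eq_intros simp: field_simps power2_eq_square power3_eq_cube)
    show "((\<lambda>t. - (t\<^sup>2 / s + 2 * t / s\<^sup>2 + 2 / s ^ 3) * exp (- s * t)) \<longlongrightarrow> 0) at_top"
      using assms by real_asymp
  qed (auto intro!: continuous_intros)
  then show ?thesis by simp
qed

text \<open>The cosine is subtracted from 1 to keep the integrand non-negative for
  \<open>has_laplace_nonneg_FTC\<close>; \<open>F\<close> is the primitive that vanishes at
  infinity.\<close>

lemma has_laplace_one_minus_cos:
  assumes "s > 0"
  shows "has_laplace (\<lambda>t. 1 - cos (y * t)) s (y\<^sup>2 / (s * (s\<^sup>2 + y\<^sup>2)))"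
proof -
  have p: "s\<^sup>2 + y\<^sup>2 > 0" using assms by (simp add: add_pos_nonneg)
  define F where "F = (\<lambda>t. (- 1 / s + (s * cos (y * t) - y * sin (y * t)) / (s\<^sup>2 + y\<^sup>2)) * exp (- s * t))"
  have "has_laplace (\<lambda>t. 1 - cos (y * t)) s (0 - F 0)"
  proof (rule has_laplace_nonneg_FTC)
    show "(F has_real_derivative (1 - cos (y * t)) * exp (- s * t)) (at t)" for t
    proof -
      define q where "q = s\<^sup>2 + y\<^sup>2"
      define A where "A = (- s * y * sin (y * t) - y\<^sup>2 * cos (y * t)) / q"
      define B where "B = - 1 / s + (s * cos (y * t) - y * sin (y * t)) / q"
      have q: "q > 0" using p by (simp add: q_def)
      have "((\<lambda>t. - 1 / s + (s * cos (y * t) - y * sin (y * t)) / q) has_real_derivative A) (at t)"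
        using q unfolding A_def
        by (auto intro!: derivative_eq_intros simp: power2_eq_square diff_divide_distrib mult_ac)
      moreover have "((\<lambda>t. exp (- s * t)) has_real_derivative - s * exp (- s * t)) (at t)"
        by (auto intro!: derivative_eq_intros)
      ultimately have "(F has_real_derivative A * exp (- s * t) + (- s * exp (- s * t)) * B) (at t)"
        unfolding F_def q_def[symmetric] B_def by (rule DERIV_mult)
      moreover have "A + (- s) * B = 1 - cos (y * t)"
      proof -
        have "A + (- s) * B = 1 - (s\<^sup>2 + y\<^sup>2) * cos (y * t) / q"
          using assms q unfolding A_def B_def by (simp add: divide_simps) (simp add: algebra_simps power2_eq_square)
        moreover have "(s\<^sup>2 + y\<^sup>2) * cos (y * t) / q = cos (y * t)" using q by (simp add: q_def[symmetric])
        ultimately show ?thesis by simp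
      qed
      moreover have "A * exp (- s * t) + (- s * exp (- s * t)) * B = (A + (- s) * B) * exp (- s * t)"
        by (simp add: algebra_simps)
      ultimately show ?thesis by (simp only:)
    qed
    define K where "K = 1 / s + (s + \<bar>y\<bar>) / (s\<^sup>2 + y\<^sup>2)"
    have "norm (F t) \<le> K * exp (- s * t)" for t
    proof -
      have "\<bar>s * cos (y * t)\<bar> \<le> s" "\<bar>y * sin (y * t)\<bar> \<le> \<bar>y\<bar>"
        using assms by (auto simp: abs_mult intro!: mult_left_le)
      then have "\<bar>s * cos (y * t) - y * sin (y * t)\<bar> \<le> s + \<bar>y\<bar>" by linarith
      then have "\<bar>(s * cos (y * t) - y * sin (y * t)) / (s\<^sup>2 + y\<^sup>2)\<bar> \<le> (s + \<bar>y\<bar>) / (s\<^sup>2 + y\<^sup>2)"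
        using p by (simp add: divide_right_mono)
      moreover have "\<bar>- 1 / s\<bar> = 1 / s" using assms by simp
      ultimately have "\<bar>- 1 / s + (s * cos (y * t) - y * sin (y * t)) / (s\<^sup>2 + y\<^sup>2)\<bar> \<le> K"
        unfolding K_def by linarith
      then show ?thesis unfolding F_def by (simp add: abs_mult)
    qed
    moreover have "((\<lambda>t. K * exp (- s * t)) \<longlongrightarrow> 0) at_top" using assms by real_asymp
    ultimately show "(F \<longlongrightarrow> 0) at_top"
      by (intro Lim_null_comparison[of F "\<lambda>t. K * exp (- s * t)"]) auto
  qed (auto intro!: continuous_intros)
  moreover have "0 - F 0 = y\<^sup>2 / (s * (s\<^sup>2 + y\<^sup>2))"
    using p assms unfolding F_def by (simp add: divide_simps) (simp add: algebra_simps power2_eq_square)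
  ultimately show ?thesis by simp
qed

text \<open>A translate of \<open>has_laplace_id\<close>. With \<open>c = ln n\<close> this is, up
  to a constant factor, the contribution of \<open>n\<close> to the prime sum in
  \<open>Psi\<close>.\<close>

lemma has_laplace_shifted_ramp:
  assumes "s > 0" "c \<ge> 0"
  shows "has_laplace (\<lambda>t. max 0 (t - c)) s (exp (- s * c) / s\<^sup>2)"
proof -
  have "has_bochner_integral lborel (\<lambda>t. indicator {0..} (- c + 1 * t) * ((- c + 1 * t) * exp (- s * (- c + 1 * t)))) (1 / s\<^sup>2 /\<^sub>R \<bar>1\<bar>)"
    using has_laplace_id[OF assms(1)] unfolding has_laplace_def
    by (intro lborel_has_bochner_integral_real_affine_iff[THEN iffD1]) auto
  then have "has_bochner_integral lborel (\<lambda>t. exp (- s * c) * (indicator {0..} (- c + 1 * t) * ((- c + 1 * t) * exp (- s * (- c + 1 * t))))) (exp (- s * c) * (1 / s\<^sup>2))"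
    by (intro has_bochner_integral_mult_right) simp
  moreover have "exp (- s * c) * (indicator {0..} (- c + 1 * t) * ((- c + 1 * t) * exp (- s * (- c + 1 * t)))) =
      indicator {0..} t * (max 0 (t - c) * exp (- s * t))" for t
  proof -
    have "exp (- s * c) * exp (- s * (- c + 1 * t)) = exp (- s * t)"
      by (simp add: exp_add[symmetric] algebra_simps)
    then have "exp (- s * c) * ((t - c) * exp (- s * (- c + 1 * t))) = (t - c) * exp (- s * t)"
      by (simp add: mult.left_commute)
    then show ?thesis using assms by (auto simp: indicator_def)
  qed
  ultimately show ?thesis unfolding has_laplace_def by simp
qed

lemma has_laplace_sums:
  assumes nn: "\<And>n t. t \<ge> 0 \<Longrightarrow> 0 \<le> f n t"
    and lap: "\<And>n. has_laplace (f n) s (a n)" and a: "a sums A"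
    and f: "\<And>t. t \<ge> 0 \<Longrightarrow> (\<lambda>n. f n t) sums F t"
  shows "has_laplace F s A"
  unfolding has_laplace_def
proof (rule has_bochner_integral_sums_nonneg)
  show "0 \<le> indicator {0..} t * (f n t * exp (- s * t))" for n t
    using nn[of t n] by (simp add: indicator_def)
  show "(\<lambda>n. indicator {0..} t * (f n t * exp (- s * t))) sums (indicator {0..} t * (F t * exp (- s * t)))" for t
    by (cases "t \<ge> 0") (auto intro!: sums_mult sums_mult2 f)
qed (use lap a in \<open>simp_all add: has_laplace_def\<close>)

text \<open>With \<open>x = exp (- t)\<close>, the hypotheses say that all moments on
  \<open>{0..1}\<close> of the integrable weight \<open>d t * exp (- c * t)\<close> vanish; by
  Weierstrass approximation the weight is then orthogonal to every continuous
  \<open>h\<close>.\<close>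

lemma laplace_zero_test:
  assumes lap: "\<And>n::nat. has_laplace d (c + real n) 0" and h: "continuous_on {0..1} h"
  shows "has_bochner_integral lborel (\<lambda>t. indicator {0..} t * (d t * exp (- c * t)) * h (exp (- t))) 0"
proof -
  define w where "w = (\<lambda>t. indicator {0..} t * (d t * exp (- c * t)))"
  have w: "integrable lborel w" using lap[of 0] by (auto simp: w_def has_laplace_def has_bochner_integral_iff)
  have pow: "has_bochner_integral lborel (\<lambda>t. w t * exp (- t) ^ n) 0" for n
  proof -
    have "w t * exp (- t) ^ n = indicator {0..} t * (d t * exp (- (c + real n) * t))" for t
      by (simp add: w_def exp_of_nat_mult[symmetric] exp_add[symmetric] algebra_simps)
    then show ?thesis using lap[of n] by (simp add: has_laplace_def)
  qed
  have ex: "exp (- t) \<in> {0..1}" if "t \<ge> 0" for t :: real using that by simp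
  have m: "(\<lambda>t. indicator {0..} t * h (exp (- t))) \<in> borel_measurable lborel"
  proof -
    have "(\<lambda>t. indicator {0..} t *\<^sub>R h (exp (- t))) \<in> borel_measurable borel"
      by (rule borel_measurable_continuous_on_indicator, simp,
          rule continuous_on_compose2[OF h]) (auto intro!: continuous_intros)
    then show ?thesis by simp
  qed
  have wi: "w t * h (exp (- t)) = w t * (indicator {0..} t * h (exp (- t)))" for t
    by (simp add: w_def indicator_def)
  obtain B where B: "\<And>x. x \<in> {0..1} \<Longrightarrow> \<bar>h x\<bar> \<le> B"
    using compact_imp_bounded[OF compact_continuous_image[OF h compact_Icc]] unfolding bounded_iff
    by (metis imageI real_norm_def)
  have bd: "norm (w t * h (exp (- t))) \<le> norm (B * w t)" for t
  proof (cases "t \<ge> 0")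
    case True
    have "\<bar>w t\<bar> * \<bar>h (exp (- t))\<bar> \<le> \<bar>w t\<bar> * \<bar>B\<bar>"
      using B[OF ex[OF True]] by (intro mult_left_mono) auto
    then show ?thesis by (simp add: abs_mult mult.commute)
  qed (simp add: w_def)
  have int: "integrable lborel (\<lambda>t. w t * h (exp (- t)))"
  proof (rule Bochner_Integration.integrable_bound)
    show "integrable lborel (\<lambda>t. B * w t)" using w by simp
    show "(\<lambda>t. w t * h (exp (- t))) \<in> borel_measurable lborel"
      unfolding wi by (intro borel_measurable_times m borel_measurable_integrable[OF w])
  qed (use bd in auto)
  have eps: "\<bar>\<integral>t. w t * h (exp (- t)) \<partial>lborel\<bar> \<le> e * (\<integral>t. \<bar>w t\<bar> \<partial>lborel)" if e: "e > 0" for e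
  proof -
    obtain p where p: "real_polynomial_function p" "\<And>x. x \<in> {0..1} \<Longrightarrow> \<bar>h x - p x\<bar> < e"
      using Stone_Weierstrass_real_polynomial_function[OF compact_Icc h e] by blast
    obtain a n where pa: "p = (\<lambda>x. \<Sum>i\<le>n. a i * x ^ i)"
      using p(1) real_polynomial_function_iff_sum by auto
    have "has_bochner_integral lborel (\<lambda>t. \<Sum>i\<le>n. a i * (w t * exp (- t) ^ i)) (\<Sum>i\<le>n. a i * 0)"
      by (intro has_bochner_integral_sum has_bochner_integral_mult_right pow)
    moreover have "(\<Sum>i\<le>n. a i * (w t * exp (- t) ^ i)) = w t * p (exp (- t))" for t
      by (simp add: pa sum_distrib_left mult.left_commute)
    ultimately have hp: "has_bochner_integral lborel (\<lambda>t. w t * p (exp (- t))) 0" by simp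
    then have ip: "integrable lborel (\<lambda>t. w t * p (exp (- t)))" and "(\<integral>t. w t * p (exp (- t)) \<partial>lborel) = 0"
      by (auto simp: has_bochner_integral_iff)
    then have "(\<integral>t. w t * h (exp (- t)) \<partial>lborel) = (\<integral>t. w t * h (exp (- t)) - w t * p (exp (- t)) \<partial>lborel)"
      using int by simp
    also have "\<bar>\<dots>\<bar> \<le> (\<integral>t. e * \<bar>w t\<bar> \<partial>lborel)"
    proof -
      have "norm (w t * h (exp (- t)) - w t * p (exp (- t))) \<le> e * \<bar>w t\<bar>" for t
      proof (cases "t \<ge> 0")
        case True
        have "\<bar>w t\<bar> * \<bar>h (exp (- t)) - p (exp (- t))\<bar> \<le> \<bar>w t\<bar> * e"
          using p(2)[OF ex[OF True]] by (intro mult_left_mono) auto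
        then show ?thesis by (simp add: abs_mult[symmetric] mult.commute right_diff_distrib)
      qed (simp add: w_def)
      then have "norm (\<integral>t. w t * h (exp (- t)) - w t * p (exp (- t)) \<partial>lborel) \<le> (\<integral>t. e * \<bar>w t\<bar> \<partial>lborel)"
        by (intro Bochner_Integration.integral_norm_bound_integral) (use int ip w in auto)
      then show ?thesis by simp
    qed
    finally show ?thesis by simp
  qed
  have "\<bar>\<integral>t. w t * h (exp (- t)) \<partial>lborel\<bar> \<le> 0"
  proof (rule field_le_epsilon)
    fix e :: real assume e: "e > 0"
    define I where "I = (\<integral>t. \<bar>w t\<bar> \<partial>lborel)"
    have I: "I \<ge> 0" by (simp add: I_def)
    from eps[of "e / (1 + I)"] have "\<bar>\<integral>t. w t * h (exp (- t)) \<partial>lborel\<bar> \<le> e / (1 + I) * I"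
      using e I by (simp add: I_def[symmetric])
    also have "\<dots> \<le> e" using e I by (simp add: field_simps)
    finally show "\<bar>\<integral>t. w t * h (exp (- t)) \<partial>lborel\<bar> \<le> 0 + e" by simp
  qed
  then show ?thesis using int unfolding w_def has_bochner_integral_iff by simp
qed

theorem laplace_zero_imp_zero:
  assumes lap: "\<And>n::nat. has_laplace d (c + real n) 0" and d: "continuous_on {0..} d" and t0: "t0 \<ge> 0"
  shows "d t0 = 0"
proof -
  have pos: "d t0 = 0" if t0: "t0 > 0" for t0
  proof (rule ccontr)
    assume nz: "d t0 \<noteq> 0"
    \<comment> \<open>Testing \<open>d\<close> against \<open>d\<close> itself times a cutoff at \<open>t0\<close>.\<close>
    define X where "X = (\<lambda>t. max 0 (1 - \<bar>t - t0\<bar>))"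
    \<comment> \<open>The test function has to be continuous on all of \<open>{0..1}\<close>,
      although \<open>- ln x\<close> blows up at 0. The tent \<open>X\<close> vanishes from
      \<open>t0 + 1\<close> on, so the value 0 below \<open>exp (- (t0 + 1))\<close> joins
      continuously.\<close>
    define h where "h = (\<lambda>x. if x \<le> exp (- (t0 + 1)) then 0 else d (- ln x) * X (- ln x))"
    have hc: "continuous_on {0..1} h"
    proof -
      have "continuous_on ({0..exp (- (t0 + 1))} \<union> {exp (- (t0 + 1))..1}) h"
        unfolding h_def
      proof (rule continuous_on_cases)
        show "continuous_on {exp (- (t0 + 1))..1} (\<lambda>x. d (- ln x) * X (- ln x))"
        proof -
          have "x > 0" if "x \<ge> exp (- (t0 + 1))" for x using that exp_gt_zero less_le_trans by blast
          then have "continuous_on {exp (- (t0 + 1))..1} (\<lambda>x. - ln x)"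
            by (auto intro!: continuous_intros)
          moreover have "- ln x \<in> {0..}" if "x \<in> {exp (- (t0 + 1))..1}" for x
            using that \<open>\<And>x. x \<ge> exp (- (t0 + 1)) \<Longrightarrow> x > 0\<close> by auto
          ultimately have "continuous_on {exp (- (t0 + 1))..1} (\<lambda>x. d (- ln x))"
            by (intro continuous_on_compose2[OF d]) auto
          then show ?thesis unfolding X_def
            using \<open>continuous_on {exp (- (t0 + 1))..1} (\<lambda>x. - ln x)\<close> by (intro continuous_on_mult continuous_on_max continuous_on_const continuous_on_diff continuous_on_rabs)
        qed
        show "\<forall>x. x \<in> {0..exp (- (t0 + 1))} \<and> \<not> x \<le> exp (- (t0 + 1)) \<or> x \<in> {exp (- (t0 + 1))..1} \<and> x \<le> exp (- (t0 + 1)) \<longrightarrow>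
            0 = d (- ln x) * X (- ln x)"
        proof (intro allI impI)
          fix x assume "x \<in> {0..exp (- (t0 + 1))} \<and> \<not> x \<le> exp (- (t0 + 1)) \<or> x \<in> {exp (- (t0 + 1))..1} \<and> x \<le> exp (- (t0 + 1))"
          then have "x = exp (- (t0 + 1))" by auto
          then show "0 = d (- ln x) * X (- ln x)" by (simp add: X_def)
        qed
      qed (auto intro!: continuous_intros)
      moreover have "{0..1} \<subseteq> {0..exp (- (t0 + 1))} \<union> {exp (- (t0 + 1))..(1::real)}" by auto
      ultimately show ?thesis by (rule continuous_on_subset)
    qed
    have hX: "h (exp (- t)) = d t * X t" if "t \<ge> 0" for t
      using that by (auto simp: h_def X_def)
    define g where "g = (\<lambda>t. indicator {0..} t * (d t * exp (- c * t)) * h (exp (- t)))"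
    have geq: "g t = indicator {0..} t * ((d t)\<^sup>2 * exp (- c * t) * X t)" for t
      using hX[of t] by (simp add: g_def indicator_def power2_eq_square)
    have "has_bochner_integral lborel g 0" unfolding g_def by (rule laplace_zero_test[OF lap hc])
    moreover have gnn: "g t \<ge> 0" for t by (simp add: geq X_def)
    ultimately have "AE t in lborel. g t = 0"
      using integral_nonneg_eq_0_iff_AE[of lborel g] by (auto simp: has_bochner_integral_iff)
    then obtain N where N: "N \<in> null_sets lborel" "{t. g t \<noteq> 0} \<subseteq> N"
      by (auto simp: eventually_ae_filter)
    have gc: "continuous_on {0<..} g"
    proof -
      have "continuous_on {0<..} (\<lambda>t. (d t)\<^sup>2 * exp (- c * t) * X t)"
        unfolding X_def by (intro continuous_intros continuous_on_subset[OF d]) auto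
      then show ?thesis by (rule continuous_on_eq) (simp add: geq)
    qed
    \<comment> \<open>\<open>g\<close> is non-negative with integral 0, hence zero off a null set; a
      point \<open>t0\<close> where the continuous \<open>g\<close> is positive would put a nonempty
      open set inside that null set.\<close>
    have "open ({0<..} \<inter> g -` (- {0}))"
      using gc continuous_on_open_vimage[of "{0<..}" g] by (metis Int_commute open_Compl open_greaterThan closed_singleton)
    moreover have "t0 \<in> {0<..} \<inter> g -` (- {0})"
      using t0 nz by (simp add: geq X_def)
    ultimately have "\<not> negligible ({0<..} \<inter> g -` (- {0}))"
      using open_not_negligible by blast
    moreover have "negligible N"
      using N(1) by (simp add: negligible_iff_null_sets null_sets_completionI)
    moreover have "{0<..} \<inter> g -` (- {0}) \<subseteq> N" using N(2) by auto
    ultimately show False using negligible_subset by blast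
  qed
  show ?thesis
  \<comment> \<open>The open-set argument works at \<open>t0 > 0\<close>; the end point follows by
    continuity from the right.\<close>
  proof (cases "t0 = 0")
    case True
    have "(d \<longlongrightarrow> d 0) (at_right 0)"
      using d unfolding continuous_on_def by (metis at_within_Ici_at_right atLeast_iff order_refl)
    moreover have "(d \<longlongrightarrow> 0) (at_right 0)"
      by (rule tendsto_eventually) (auto simp: eventually_at_filter pos)
    ultimately show ?thesis using True tendsto_unique[OF trivial_limit_at_right_real] by blast
  qed (use pos t0 in auto)
qed

text \<open>Expand \<open>exp ((s - s0) * u)\<close> in powers of \<open>s - s0\<close> and
  integrate term by term. Since \<open>exp (r * |u|) <= exp (r * u) + exp (- r * u)\<close>, all
  partial sums of norms are dominated by the integrands at the two points \<open>s0 + r\<close> and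
  \<open>s0 - r\<close> of \<open>S\<close>. Laplace (\<open>u = - t\<close>) and Mellin
  (\<open>u = ln x\<close>) integrals both have this shape.\<close>

theorem holomorphic_on_exp_integral:
  fixes \<phi> :: "'a \<Rightarrow> complex" and u :: "'a \<Rightarrow> real"
  assumes S: "open S" and [measurable]: "u \<in> borel_measurable M" "\<phi> \<in> borel_measurable M"
    and int: "\<And>s. s \<in> S \<Longrightarrow> integrable M (\<lambda>x. \<phi> x * exp (s * of_real (u x)))"
  shows "(\<lambda>s. \<integral>x. \<phi> x * exp (s * of_real (u x)) \<partial>M) holomorphic_on S"
proof -
  have "\<exists>r>0. (\<lambda>s. \<integral>x. \<phi> x * exp (s * of_real (u x)) \<partial>M) holomorphic_on ball s0 r" if s0: "s0 \<in> S" for s0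
  proof -
    obtain r where r: "r > 0" "cball s0 r \<subseteq> S" using S s0 open_contains_cball by blast
    have "s0 + of_real r \<in> S" "s0 - of_real r \<in> S" using r by (auto simp: subset_iff dist_norm)
    then have "integrable M (\<lambda>x. norm (\<phi> x * exp ((s0 + of_real r) * of_real (u x))) + norm (\<phi> x * exp ((s0 - of_real r) * of_real (u x))))"
      by (intro Bochner_Integration.integrable_add integrable_norm int)
    then have J: "integrable M (\<lambda>x. norm (\<phi> x * exp (s0 * of_real (u x))) * exp (r * u x) + norm (\<phi> x * exp (s0 * of_real (u x))) * exp (- r * u x))"
    proof -
      have "norm (\<phi> x * exp ((s0 + of_real y) * of_real (u x))) = norm (\<phi> x * exp (s0 * of_real (u x))) * exp (y * u x)" for x and y :: real
        by (simp add: norm_mult distrib_right exp_add)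
      from this[of _ r] this[of _ "- r"] show ?thesis
        using \<open>integrable M (\<lambda>x. norm (\<phi> x * exp ((s0 + of_real r) * of_real (u x))) + norm (\<phi> x * exp ((s0 - of_real r) * of_real (u x))))\<close>
        by simp
    qed
    define w where "w = (\<lambda>x. \<phi> x * exp (s0 * of_real (u x)))"
    have [measurable]: "w \<in> borel_measurable M" unfolding w_def by measurable
    define J where "J = (\<lambda>x. norm (w x) * exp (r * u x) + norm (w x) * exp (- r * u x))"
    have Ji: "integrable M J" using J unfolding J_def w_def .
    have part: "(\<Sum>i<n. norm (w x) * (\<bar>z\<bar> * \<bar>u x\<bar>) ^ i / fact i) \<le> J x" if "\<bar>z\<bar> \<le> r" for n x and z :: real
    proof -
      have "(\<Sum>i<n. (\<bar>z\<bar> * \<bar>u x\<bar>) ^ i / fact i) \<le> (\<Sum>i. (\<bar>z\<bar> * \<bar>u x\<bar>) ^ i / fact i)"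
        using summable_exp[of "\<bar>z\<bar> * \<bar>u x\<bar>"] by (intro sum_le_suminf) (auto simp: divide_inverse mult.commute)
      also have "\<dots> = exp (\<bar>z\<bar> * \<bar>u x\<bar>)" by (simp add: exp_def divide_inverse mult.commute)
      also have "\<dots> \<le> exp (r * \<bar>u x\<bar>)" using that by (simp add: mult_right_mono)
      also have "\<dots> \<le> exp (r * u x) + exp (- r * u x)" by (cases "u x \<ge> 0") auto
      finally have "norm (w x) * (\<Sum>i<n. (\<bar>z\<bar> * \<bar>u x\<bar>) ^ i / fact i) \<le> norm (w x) * (exp (r * u x) + exp (- r * u x))"
        by (rule mult_left_mono) simp
      then show ?thesis by (simp add: J_def distrib_left sum_distrib_left)
    qed
    define a where "a = (\<lambda>n x. w x * of_real (u x) ^ n / fact n)"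
    have [measurable]: "a n \<in> borel_measurable M" for n unfolding a_def by measurable
    have tm: "norm (a n x * z ^ n) = norm (w x) * (\<bar>norm z\<bar> * \<bar>u x\<bar>) ^ n / fact n" for n x z
      by (simp add: a_def norm_mult norm_divide norm_power power_mult_distrib mult_ac)
    have ai: "integrable M (\<lambda>x. a n x * z ^ n)" if "norm z \<le> r" for n z
    proof (rule Bochner_Integration.integrable_bound[OF Ji])
      have "norm (a n x * z ^ n) \<le> J x" for x
        using part[of "norm z" x "Suc n"] that unfolding tm
        by (simp add: sum.lessThan_Suc) (smt (verit) sum_nonneg divide_nonneg_nonneg mult_nonneg_nonneg norm_ge_zero zero_le_power abs_ge_zero fact_ge_zero)
      then show "AE x in M. norm (a n x * z ^ n) \<le> norm (J x)"
        by (auto intro!: always_eventually order_trans[OF _ abs_ge_self])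
    qed measurable
    have "(\<lambda>n. (\<integral>x. a n x \<partial>M) * (s - s0) ^ n) sums (\<integral>x. \<phi> x * exp (s * of_real (u x)) \<partial>M)" if s: "s \<in> ball s0 r" for s
    proof -
      define z where "z = s - s0"
      have z: "norm z \<le> r" using s by (simp add: z_def dist_norm norm_minus_commute)
      have sm: "(\<lambda>n. a n x * z ^ n) sums (\<phi> x * exp (s * of_real (u x)))" for x
      proof -
        have "(\<lambda>n. w x * ((z * of_real (u x)) ^ n /\<^sub>R fact n)) sums (w x * exp (z * of_real (u x)))"
          by (intro sums_mult exp_converges)
        moreover have "w x * exp (z * of_real (u x)) = \<phi> x * exp (s * of_real (u x))"
          by (simp add: w_def z_def exp_add[symmetric] algebra_simps)
        moreover have "w x * ((z * of_real (u x)) ^ n /\<^sub>R fact n) = a n x * z ^ n" for n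
          by (simp add: a_def scaleR_conv_of_real power_mult_distrib field_simps)
        ultimately show ?thesis by simp
      qed
      have 1: "AE x in M. summable (\<lambda>n. norm (a n x * z ^ n))"
        unfolding tm using part[of "norm z"] z
        by (intro always_eventually allI summableI_nonneg_bounded) auto
      have 2: "summable (\<lambda>n. \<integral>x. norm (a n x * z ^ n) \<partial>M)"
      proof (rule summableI_nonneg_bounded)
        fix n
        have "(\<Sum>i<n. \<integral>x. norm (a i x * z ^ i) \<partial>M) = (\<integral>x. (\<Sum>i<n. norm (a i x * z ^ i)) \<partial>M)"
          using ai[OF z] by (subst Bochner_Integration.integral_sum) auto
        also have "\<dots> \<le> (\<integral>x. J x \<partial>M)"
        proof (rule integral_mono)
          show "integrable M (\<lambda>x. \<Sum>i<n. norm (a i x * z ^ i))"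
            using ai[OF z] by (intro Bochner_Integration.integrable_sum integrable_norm)
          show "(\<Sum>i<n. norm (a i x * z ^ i)) \<le> J x" for x
            unfolding tm using part[of "norm z" x n] z by simp
        qed (rule Ji)
        finally show "(\<Sum>i<n. \<integral>x. norm (a i x * z ^ i) \<partial>M) \<le> (\<integral>x. J x \<partial>M)" .
      qed simp
      have "(\<lambda>n. \<integral>x. a n x * z ^ n \<partial>M) sums (\<integral>x. (\<Sum>n. a n x * z ^ n) \<partial>M)"
        by (rule sums_integral[OF ai[OF z] 1 2])
      moreover have "(\<Sum>n. a n x * z ^ n) = \<phi> x * exp (s * of_real (u x))" for x
        using sm[of x] by (simp add: sums_iff)
      ultimately show ?thesis by (simp add: z_def)
    qed
    then have "(\<lambda>s. \<integral>x. \<phi> x * exp (s * of_real (u x)) \<partial>M) holomorphic_on ball s0 r"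
      by (rule power_series_holomorphic)
    then show ?thesis using r(1) by blast
  qed
  then have "(\<lambda>s. \<integral>x. \<phi> x * exp (s * of_real (u x)) \<partial>M) analytic_on S"
    unfolding analytic_on_def by blast
  then show ?thesis by (rule analytic_imp_holomorphic)
qed

section \<open>The functional equation of the zeta function\<close>

lemma has_integral_nonneg_imp_has_bochner_integral:
  fixes f :: "real \<Rightarrow> real"
  assumes nn: "\<And>x. x \<in> S \<Longrightarrow> 0 \<le> f x" and I: "(f has_integral I) S"
    and [measurable]: "f \<in> borel_measurable borel" "S \<in> sets borel"
  shows "has_bochner_integral lborel (\<lambda>x. indicator S x * f x) I"
proof (rule has_bochner_integral_nn_integral)
  show "0 \<le> I" using has_integral_nonneg[OF I] nn by blast
  show "(\<integral>\<^sup>+ x. ennreal (indicator S x * f x) \<partial>lborel) = ennreal I"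
    by (rule nn_integral_has_integral_lebesgue[OF _ I]) (use nn in auto)
qed (use nn in \<open>auto simp: indicator_def\<close>)

lemma Gamma_integral_scaled:
  fixes x a :: real
  assumes x: "x > 0" and a: "a > 0"
  shows "has_bochner_integral lborel (\<lambda>t. indicator {0<..} t * (t powr (x - 1) * exp (- a * t))) (Gamma x / a powr x)"
proof -
  have 0: "has_bochner_integral lborel (\<lambda>t. indicator {0..} t * (t powr (x - 1) / exp t)) (Gamma x)"
    by (rule has_integral_nonneg_imp_has_bochner_integral[OF _ Gamma_integral_real[OF x]]) auto
  have "has_bochner_integral lborel (\<lambda>t. indicator {0..} (0 + a * t) * ((0 + a * t) powr (x - 1) / exp (0 + a * t))) (Gamma x /\<^sub>R \<bar>a\<bar>)"
    using a by (intro lborel_has_bochner_integral_real_affine_iff[THEN iffD1, OF _ 0]) auto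
  from has_bochner_integral_mult_right[OF this, of "a powr (1 - x)"]
  have 1: "has_bochner_integral lborel (\<lambda>t. a powr (1 - x) * (indicator {0..} (0 + a * t) * ((0 + a * t) powr (x - 1) / exp (0 + a * t)))) (a powr (1 - x) * (Gamma x / a))"
    using a by (simp add: divide_inverse mult.commute)
  have "a powr (1 - x) * (indicator {0..} (0 + a * t) * ((0 + a * t) powr (x - 1) / exp (0 + a * t))) =
     indicator {0<..} t * (t powr (x - 1) * exp (- a * t))" for t
  proof (cases "t > 0")
    case True
    have "a powr (1 - x) * (a powr (x - 1) * t powr (x - 1)) = t powr (x - 1)"
      using a by (simp add: mult.assoc[symmetric] powr_add[symmetric])
    then show ?thesis using True a by (simp add: powr_mult exp_minus divide_inverse indicator_def mult.assoc[symmetric])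
  qed (use a in \<open>auto simp: indicator_def zero_le_mult_iff\<close>)
  moreover have "a powr (1 - x) * (Gamma x / a) = Gamma x / a powr x"
    using a by (simp add: powr_diff field_simps)
  ultimately show ?thesis using 1 by simp
qed

text \<open>Obtained from \<open>Gamma_integral_scaled\<close> at exponent
  \<open>(1 + z) / 2\<close> by the substitution \<open>y = t^2\<close>.\<close>

lemma Gaussian_moment_integral:
  fixes z v :: real
  assumes z: "z > -1" and v: "v > 0"
  shows "has_bochner_integral lborel (\<lambda>t. indicator {0<..} t * (t powr z * exp (- v * t\<^sup>2)))
    (Gamma ((1 + z) / 2) / (2 * v powr ((1 + z) / 2)))"
proof -
  define I where "I = Gamma ((1 + z) / 2) / (2 * v powr ((1 + z) / 2))"
  define f where "f = (\<lambda>y::real. 1/2 * (y powr ((1 + z) / 2 - 1) * exp (- v * y)))"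
  have [measurable]: "f \<in> borel_measurable borel" unfolding f_def by measurable
  have "has_bochner_integral lborel (\<lambda>y. 1/2 * (indicator {0<..} y * (y powr ((1 + z) / 2 - 1) * exp (- v * y)))) (1/2 * (Gamma ((1 + z) / 2) / v powr ((1 + z) / 2)))"
    by (intro has_bochner_integral_mult_right Gamma_integral_scaled) (use z v in auto)
  then have b: "has_bochner_integral lborel (\<lambda>y. indicator {0<..} y *\<^sub>R f y) I"
    by (simp add: f_def I_def mult_ac)
  then have "set_integrable lebesgue {0<..} f"
    unfolding set_integrable_def using integrable_completion[of "\<lambda>y. indicator {0<..} y *\<^sub>R f y" lborel]
    by (simp add: has_bochner_integral_iff)
  moreover from this have "integral {0<..} f = I"
    using b integral_completion[of "\<lambda>y. indicator {0<..} y *\<^sub>R f y" lborel]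
    by (simp add: set_lebesgue_integral_eq_integral(2)[symmetric] set_lebesgue_integral_def has_bochner_integral_iff)
  moreover have im: "(\<lambda>x::real. x\<^sup>2) ` {0<..} = {0<..}"
  proof
    show "{0<..} \<subseteq> (\<lambda>x::real. x\<^sup>2) ` {0<..}"
    proof
      fix y :: real assume "y \<in> {0<..}"
      then show "y \<in> (\<lambda>x. x\<^sup>2) ` {0<..}" by (intro image_eqI[of _ _ "sqrt y"]) auto
    qed
  qed auto
  moreover have "(\<lambda>x. \<bar>2 * x\<bar> * f (x\<^sup>2)) absolutely_integrable_on {0<..} \<and>
      integral {0<..} (\<lambda>x. \<bar>2 * x\<bar> * f (x\<^sup>2)) = I \<longleftrightarrow>
      f absolutely_integrable_on (\<lambda>x. x\<^sup>2) ` {0<..} \<and> integral ((\<lambda>x. x\<^sup>2) ` {0<..}) f = I"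
    by (rule has_absolute_integral_change_of_variables_1')
       (auto intro!: derivative_eq_intros inj_onI simp: power2_eq_iff)
  ultimately have "(\<lambda>x. \<bar>2 * x\<bar> * f (x\<^sup>2)) absolutely_integrable_on {0<..}"
      "integral {0<..} (\<lambda>x. \<bar>2 * x\<bar> * f (x\<^sup>2)) = I" by simp_all
  then have "((\<lambda>x. \<bar>2 * x\<bar> * f (x\<^sup>2)) has_integral I) {0<..}"
    using set_lebesgue_integral_eq_integral(1) integrable_integral by blast
  then have "has_bochner_integral lborel (\<lambda>x. indicator {0<..} x * (\<bar>2 * x\<bar> * f (x\<^sup>2))) I"
    by (rule has_integral_nonneg_imp_has_bochner_integral[rotated]) (auto simp: f_def)
  moreover have "indicator {0<..} x * (\<bar>2 * x\<bar> * f (x\<^sup>2)) = indicator {0<..} x * (x powr z * exp (- v * x\<^sup>2))" for x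
  proof (cases "x > 0")
    case True
    have "x * (x\<^sup>2) powr ((1 + z) / 2 - 1) = x powr 1 * x powr (2 * ((1 + z) / 2 - 1))"
    proof -
      have x2: "x\<^sup>2 = x powr 2" using True by simp
      show ?thesis unfolding x2 powr_powr using True by simp
    qed
    also have "\<dots> = x powr z" by (simp only: powr_add[symmetric]) (simp add: field_simps)
    finally show ?thesis using True by (simp add: f_def)
  qed simp
  ultimately show ?thesis unfolding I_def by simp
qed

text \<open>Write \<open>1 / (x^2 + c^2)\<close> as the integral of
  \<open>exp (- v * (x^2 + c^2))\<close> over \<open>v > 0\<close> and interchange by Tonelli: the
  \<open>x\<close>-integral is a Gaussian moment, the remaining \<open>v\<close>-integral a Gamma
  integral. The two Gamma factors are kept as they stand, since one of them belongs to the
  \<open>1 - s\<close> side of the functional equation.\<close>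

lemma Mellin_inverse_quadratic:
  fixes z c :: real
  assumes z: "-1 < z" "z < 1" and c: "c > 0"
  shows "has_bochner_integral lborel (\<lambda>x. indicator {0<..} x * (2 * x powr z / (x\<^sup>2 + c\<^sup>2)))
    (Gamma ((1 + z) / 2) * Gamma ((1 - z) / 2) * c powr (z - 1))"
proof (rule has_bochner_integral_nn_integral)
  let ?i = "indicator {0<..} :: real \<Rightarrow> real"
  have G: "Gamma ((1 + z) / 2) > 0" "Gamma ((1 - z) / 2) > 0" using z by (auto intro!: Gamma_real_pos)
  have inner1: "(\<integral>\<^sup>+ v. ennreal (?i x * 2 * x powr z * (?i v * exp (- v * (x\<^sup>2 + c\<^sup>2)))) \<partial>lborel)
      = ennreal (?i x * (2 * x powr z / (x\<^sup>2 + c\<^sup>2)))" for x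
  proof -
    have p: "x\<^sup>2 + c\<^sup>2 > 0" using c by (simp add: add_nonneg_pos)
    have "has_bochner_integral lborel (\<lambda>v. ?i v * (v powr (1 - 1) * exp (- (x\<^sup>2 + c\<^sup>2) * v))) (Gamma 1 / (x\<^sup>2 + c\<^sup>2) powr 1)"
      by (rule Gamma_integral_scaled) (use p in auto)
    also have "(\<lambda>v. ?i v * (v powr (1 - 1) * exp (- (x\<^sup>2 + c\<^sup>2) * v))) = (\<lambda>v. ?i v * exp (- v * (x\<^sup>2 + c\<^sup>2)))"
      by (auto simp: indicator_def algebra_simps)
    finally have "has_bochner_integral lborel (\<lambda>v. ?i x * 2 * x powr z * (?i v * exp (- v * (x\<^sup>2 + c\<^sup>2)))) (?i x * 2 * x powr z * (Gamma 1 / (x\<^sup>2 + c\<^sup>2) powr 1))"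
      by (rule has_bochner_integral_mult_right)
    moreover have "?i x * 2 * x powr z * (Gamma 1 / (x\<^sup>2 + c\<^sup>2) powr 1) = ?i x * (2 * x powr z / (x\<^sup>2 + c\<^sup>2))"
      using p by simp
    ultimately have "has_bochner_integral lborel (\<lambda>v. ?i x * 2 * x powr z * (?i v * exp (- v * (x\<^sup>2 + c\<^sup>2)))) (?i x * (2 * x powr z / (x\<^sup>2 + c\<^sup>2)))"
      by (simp only:)
    then show ?thesis by (subst nn_integral_eq_integral) (auto simp: has_bochner_integral_iff)
  qed
  have inner2: "(\<integral>\<^sup>+ x. ennreal (?i x * 2 * x powr z * (?i v * exp (- v * (x\<^sup>2 + c\<^sup>2)))) \<partial>lborel)
      = ennreal (Gamma ((1 + z) / 2) * (?i v * (v powr ((1 - z) / 2 - 1) * exp (- c\<^sup>2 * v))))" for v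
  proof (cases "v > 0")
    case True
    have H: "has_bochner_integral lborel (\<lambda>x. 2 * exp (- v * c\<^sup>2) * (?i x * (x powr z * exp (- v * x\<^sup>2)))) (2 * exp (- v * c\<^sup>2) * (Gamma ((1 + z) / 2) / (2 * v powr ((1 + z) / 2))))"
      by (rule has_bochner_integral_mult_right, rule Gaussian_moment_integral) (use True z in auto)
    have e1: "2 * exp (- v * c\<^sup>2) * (?i x * (x powr z * exp (- v * x\<^sup>2))) = ?i x * 2 * x powr z * (?i v * exp (- v * (x\<^sup>2 + c\<^sup>2)))" for x
    proof -
      have e: "exp (- v * (x\<^sup>2 + c\<^sup>2)) = exp (- v * c\<^sup>2) * exp (- v * x\<^sup>2)"
        by (simp only: exp_add[symmetric] distrib_left) (simp add: add.commute)
      show ?thesis unfolding e using True by (simp add: indicator_def)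
    qed
    have e2: "2 * exp (- v * c\<^sup>2) * (Gamma ((1 + z) / 2) / (2 * v powr ((1 + z) / 2))) = Gamma ((1 + z) / 2) * (?i v * (v powr ((1 - z) / 2 - 1) * exp (- c\<^sup>2 * v)))"
    proof -
      have "(1 - z) / 2 - 1 = - ((1 + z) / 2)" by (simp add: field_simps)
      then have a: "v powr ((1 - z) / 2 - 1) = inverse (v powr ((1 + z) / 2))" by (metis powr_minus)
      have b: "exp (- v * c\<^sup>2) = exp (- c\<^sup>2 * v)" by (simp add: mult.commute)
      have c: "2 * e * (g / (2 * p)) = g * (1 * (inverse p * e))" for e g p :: real
        by (cases "p = 0") (simp_all add: field_simps)
      have d: "?i v = 1" using True by simp
      show ?thesis unfolding a b d by (rule c)
    qed
    have "has_bochner_integral lborel (\<lambda>x. ?i x * 2 * x powr z * (?i v * exp (- v * (x\<^sup>2 + c\<^sup>2)))) (Gamma ((1 + z) / 2) * (?i v * (v powr ((1 - z) / 2 - 1) * exp (- c\<^sup>2 * v))))"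
      by (rule has_bochner_integral_cong[THEN iffD1, OF refl _ e2 H], rule e1)
    then show ?thesis using G by (subst nn_integral_eq_integral) (auto simp: has_bochner_integral_iff)
  qed simp
  have "(\<integral>\<^sup>+ x. ennreal (?i x * (2 * x powr z / (x\<^sup>2 + c\<^sup>2))) \<partial>lborel) =
     (\<integral>\<^sup>+ x. (\<integral>\<^sup>+ v. ennreal (?i x * 2 * x powr z * (?i v * exp (- v * (x\<^sup>2 + c\<^sup>2)))) \<partial>lborel) \<partial>lborel)"
    by (simp only: inner1)
  also have "\<dots> = (\<integral>\<^sup>+ v. (\<integral>\<^sup>+ x. ennreal (?i x * 2 * x powr z * (?i v * exp (- v * (x\<^sup>2 + c\<^sup>2)))) \<partial>lborel) \<partial>lborel)"
    by (rule lborel_pair.Fubini') measurable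
  also have "\<dots> = (\<integral>\<^sup>+ v. ennreal (Gamma ((1 + z) / 2) * (?i v * (v powr ((1 - z) / 2 - 1) * exp (- c\<^sup>2 * v)))) \<partial>lborel)"
    by (simp only: inner2)
  also have "\<dots> = ennreal (Gamma ((1 + z) / 2) * (Gamma ((1 - z) / 2) / (c\<^sup>2) powr ((1 - z) / 2)))"
  proof -
    have "has_bochner_integral lborel (\<lambda>v. Gamma ((1 + z) / 2) * (?i v * (v powr ((1 - z) / 2 - 1) * exp (- c\<^sup>2 * v)))) (Gamma ((1 + z) / 2) * (Gamma ((1 - z) / 2) / (c\<^sup>2) powr ((1 - z) / 2)))"
      by (rule has_bochner_integral_mult_right, rule Gamma_integral_scaled) (use z c in auto)
    then show ?thesis using G by (subst nn_integral_eq_integral) (auto simp: has_bochner_integral_iff)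
  qed
  also have "(c\<^sup>2) powr ((1 - z) / 2) = c powr (1 - z)"
  proof -
    have "c\<^sup>2 = c powr 2" using c by simp
    moreover have "2 * ((1 - z) / 2) = 1 - z" by (simp add: field_simps)
    ultimately show ?thesis by (simp only: powr_powr)
  qed
  also have "Gamma ((1 + z) / 2) * (Gamma ((1 - z) / 2) / c powr (1 - z)) = Gamma ((1 + z) / 2) * Gamma ((1 - z) / 2) * c powr (z - 1)"
  proof -
    have "c powr (z - 1) = inverse (c powr (1 - z))" using powr_minus[of c "1 - z"] by simp
    then show ?thesis
      by (simp only: divide_inverse[of "Gamma ((1 - z) / 2)" "c powr (1 - z)"] mult.assoc)
  qed
  finally show "(\<integral>\<^sup>+ x. ennreal (?i x * (2 * x powr z / (x\<^sup>2 + c\<^sup>2))) \<partial>lborel) = ennreal (Gamma ((1 + z) / 2) * Gamma ((1 - z) / 2) * c powr (z - 1))" .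
  show "0 \<le> Gamma ((1 + z) / 2) * Gamma ((1 - z) / 2) * c powr (z - 1)" using G by simp
qed auto

text \<open>Differentiate the reflection formula for \<open>rGamma z * rGamma (1 - z)\<close>, where
  no poles interfere, and divide by its value. The shift by \<open>Digamma_plus1\<close> gives both
  Digamma series the denominators \<open>n + 1 + z\<close> and \<open>n + 1 - z\<close>.\<close>

lemma Digamma_reflection_plus1:
  fixes z :: complex
  assumes z: "z \<notin> \<int>"
  shows "Digamma (1 + z) - Digamma (1 - z) = 1 / z - of_real pi * cot (of_real pi * z)"
proof -
  have z0: "z \<noteq> 0" using z by auto
  have nn: "z \<notin> \<int>\<^sub>\<le>\<^sub>0" using z nonpos_Ints_Int by blast
  have nn': "1 - z \<notin> \<int>\<^sub>\<le>\<^sub>0"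
  proof
    assume "1 - z \<in> \<int>\<^sub>\<le>\<^sub>0"
    then have "1 - z \<in> \<int>" by (rule nonpos_Ints_Int)
    then have "1 - (1 - z) \<in> \<int>" by (rule Ints_diff[OF Ints_1])
    then show False using z by simp
  qed
  have s: "sin (of_real pi * z) \<noteq> 0"
  proof
    assume "sin (of_real pi * z) = 0"
    then obtain n :: int where "complex_of_real pi * z = of_real (of_int n * pi)" unfolding sin_eq_0 by blast
    then have "z = of_int n" by (simp add: mult.commute)
    then show False using z by simp
  qed
  have r: "rGamma z \<noteq> 0" "rGamma (1 - z) \<noteq> 0" using nn nn' by (auto simp: rGamma_eq_zero_iff)
  have d1: "((\<lambda>z. rGamma (1 - z)) has_field_derivative (rGamma (1 - z) * Digamma (1 - z))) (at z)"
  proof -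
    have "((\<lambda>z::complex. 1 - z) has_field_derivative - 1) (at z)" by (auto intro!: derivative_eq_intros)
    from DERIV_chain2[OF has_field_derivative_rGamma_no_nonpos_int[OF nn'] this] show ?thesis by simp
  qed
  have "((\<lambda>z. rGamma z * rGamma (1 - z)) has_field_derivative
      (- rGamma z * Digamma z) * rGamma (1 - z) + (rGamma (1 - z) * Digamma (1 - z)) * rGamma z) (at z)"
    by (rule DERIV_mult[OF has_field_derivative_rGamma_no_nonpos_int[OF nn] d1])
  then have "((\<lambda>z. sin (of_real pi * z) / of_real pi) has_field_derivative
      (- rGamma z * Digamma z) * rGamma (1 - z) + (rGamma (1 - z) * Digamma (1 - z)) * rGamma z) (at z)"
    by (simp only: rGamma_reflection_complex)
  moreover have "((\<lambda>z. sin (of_real pi * z) / of_real pi) has_field_derivative cos (of_real pi * z)) (at z)"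
    by (auto intro!: derivative_eq_intros)
  ultimately have "(- rGamma z * Digamma z) * rGamma (1 - z) + (rGamma (1 - z) * Digamma (1 - z)) * rGamma z = cos (of_real pi * z)"
    by (rule DERIV_unique)
  then have "(rGamma z * rGamma (1 - z)) * (Digamma (1 - z) - Digamma z) = cos (of_real pi * z)"
    by (simp add: algebra_simps)
  then have "sin (of_real pi * z) / of_real pi * (Digamma (1 - z) - Digamma z) = cos (of_real pi * z)"
    by (simp only: rGamma_reflection_complex)
  then have "Digamma (1 - z) - Digamma z = of_real pi * cot (of_real pi * z)"
    using s by (simp add: cot_def field_simps)
  then show ?thesis using Digamma_plus1[OF z0] by (simp add: add.commute algebra_simps)
qed

text \<open>Subtract the Digamma series at \<open>1 + z\<close> and \<open>1 - z\<close> for the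
  imaginary number \<open>z = i * x / (2 * pi)\<close>. The cotangent becomes a hyperbolic one, that
  is \<open>1 + 2 / (exp x - 1)\<close>, and the imaginary part of the reflection formula is the
  expansion, up to the factor \<open>2 * pi\<close>.\<close>

lemma Planck_partial_fractions:
  fixes x :: real
  assumes x: "x > 0"
  shows "(\<lambda>n. 2 * x / (x\<^sup>2 + (2 * pi * real (Suc n))\<^sup>2)) sums (1 / (exp x - 1) - 1 / x + 1/2)"
proof -
  define y where "y = x / (2 * pi)"
  have y: "y > 0" using x by (simp add: y_def)
  define z where "z = \<i> * complex_of_real y"
  have zI: "z \<notin> \<int>"
  proof
    assume "z \<in> \<int>"
    then have "Im z = 0" by (auto elim: Ints_cases)
    then show False using y by (simp add: z_def)
  qed
  have gen: "(\<lambda>n. inverse (of_nat (Suc n)) - inverse (w + of_nat n)) sums (Digamma w + euler_mascheroni)"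
    if "w \<noteq> 0" for w :: complex
    using summable_sums[OF summable_Digamma[OF that]] by (simp add: Digamma_def)
  have "(\<lambda>n. (inverse (of_nat (Suc n)) - inverse (1 + z + of_nat n)) - (inverse (of_nat (Suc n)) - inverse (1 - z + of_nat n)))
     sums ((Digamma (1 + z) + euler_mascheroni) - (Digamma (1 - z) + euler_mascheroni))"
  proof (rule sums_diff)
    have "1 + z \<noteq> 0" "1 - z \<noteq> 0" using y by (auto simp: z_def complex_eq_iff)
    then show "(\<lambda>n. inverse (of_nat (Suc n)) - inverse (1 + z + of_nat n)) sums (Digamma (1 + z) + euler_mascheroni)"
      by (intro gen)
    show "(\<lambda>n. inverse (of_nat (Suc n)) - inverse (1 - z + of_nat n)) sums (Digamma (1 - z) + euler_mascheroni)"
      using \<open>1 - z \<noteq> 0\<close> by (intro gen)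
  qed
  then have "(\<lambda>n. inverse (1 - z + of_nat n) - inverse (1 + z + of_nat n)) sums (Digamma (1 + z) - Digamma (1 - z))"
    by simp
  then have 1: "(\<lambda>n. Im (inverse (1 - z + of_nat n) - inverse (1 + z + of_nat n)) / (2 * pi)) sums (Im (1 / z - of_real pi * cot (of_real pi * z)) / (2 * pi))"
    unfolding Digamma_reflection_plus1[OF zI] by (intro sums_divide sums_Im)
  have 2: "Im (inverse (1 - z + of_nat n) - inverse (1 + z + of_nat n)) / (2 * pi) = 2 * x / (x\<^sup>2 + (2 * pi * real (Suc n))\<^sup>2)" for n
  proof -
    have "(1 + real n)\<^sup>2 + y\<^sup>2 > 0" by (simp add: add_pos_nonneg)
    then have "Im (inverse (1 - z + of_nat n) - inverse (1 + z + of_nat n)) = 2 * y / ((1 + real n)\<^sup>2 + y\<^sup>2)"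
      by (simp add: z_def power2_eq_square add_divide_distrib[symmetric])
    also have "(1 + real n)\<^sup>2 + y\<^sup>2 = (x\<^sup>2 + (2 * pi * real (Suc n))\<^sup>2) / (2 * pi)\<^sup>2"
      by (simp add: y_def power_divide power_mult_distrib add_divide_distrib)
    also have "2 * y / \<dots> / (2 * pi) = 2 * x / (x\<^sup>2 + (2 * pi * real (Suc n))\<^sup>2)"
    proof -
      have "2 * (x / p) / (D / p\<^sup>2) / p = 2 * x / D" if "p \<noteq> 0" for p D :: real
        using that by (simp add: power2_eq_square)
      then show ?thesis unfolding y_def by this simp
    qed
    finally show ?thesis .
  qed
  have 3: "Im (1 / z - of_real pi * cot (of_real pi * z)) / (2 * pi) = 1 / (exp x - 1) - 1 / x + 1/2"
  proof -
    define E where "E = exp (x / 2)"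
    have E: "E > 1" using x by (simp add: E_def)
    have "\<i> * (of_real pi * z) = of_real (- (x / 2))" "- (\<i> * (of_real pi * z)) = of_real (x / 2)"
      by (simp_all add: z_def y_def)
    then have e: "exp (\<i> * (of_real pi * z)) = of_real (1 / E)" "exp (- (\<i> * (of_real pi * z))) = of_real E"
      by (simp_all only: exp_of_real) (simp_all add: E_def exp_minus inverse_eq_divide)
    have c: "cos (of_real pi * z) = of_real ((1 / E + E) / 2)"
      unfolding cos_exp_eq e by simp
    have s: "sin (of_real pi * z) = \<i> * of_real ((E - 1 / E) / 2)"
      unfolding sin_exp_eq e by (simp add: field_simps)
    have "E - 1 / E \<noteq> 0" using E by (simp add: field_simps) (metis less_1_mult order_less_irrefl)
    then have "cot (of_real pi * z) = of_real ((1 / E + E) / (E - 1 / E)) / \<i>"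
    proof -
      have "of_real (N / 2) / (\<i> * of_real (D / 2)) = of_real (N / D) / \<i>" if "D \<noteq> 0" for N D :: real
        using that by (simp add: field_simps)
      then show ?thesis unfolding cot_def c s using \<open>E - 1 / E \<noteq> 0\<close> by blast
    qed
    then have ct: "cot (of_real pi * z) = - \<i> * of_real ((1 / E + E) / (E - 1 / E))"
      by simp
    have iz: "1 / z = - \<i> * of_real (1 / y)" by (simp add: z_def divide_inverse)
    have "Im (1 / z - of_real pi * cot (of_real pi * z)) = pi * ((1 / E + E) / (E - 1 / E)) - 1 / y"
      unfolding ct iz by simp
    moreover have "(1 / E + E) / (E - 1 / E) = 1 + 2 / (E\<^sup>2 - 1)"
    proof -
      have "E\<^sup>2 > 1" using E by (simp add: power2_eq_square less_1_mult)
      then show ?thesis using E by (simp add: field_simps power2_eq_square)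
    qed
    moreover have "E\<^sup>2 = exp x" by (simp add: E_def exp_double[symmetric] power2_eq_square exp_add[symmetric])
    ultimately have "Im (1 / z - of_real pi * cot (of_real pi * z)) = pi * (1 + 2 / (exp x - 1)) - 1 / y"
      by (simp only:)
    moreover have "exp x - 1 > 0" using x by simp
    moreover have "pi * (1 + 2 / w) - 1 / y = (1 / w - 1 / x + 1/2) * (2 * pi)" if "w > 0" for w
      using x that by (simp add: y_def field_simps)
    ultimately show ?thesis by simp
  qed
  show ?thesis using 1 unfolding 2 3 .
qed

text \<open>The midpoint \<open>m\<close> is a limit point of real points where \<open>f\<close> and
  \<open>g\<close> agree. This is the bridge from identities computed with real integrals and series
  to complex arguments.\<close>

lemma holomorphic_eq_of_eq_on_reals:
  assumes f: "f holomorphic_on S" and g: "g holomorphic_on S" and S: "open S" "connected S"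
    and ab: "a < b" and eq: "\<And>x. a < x \<Longrightarrow> x < b \<Longrightarrow> of_real x \<in> S \<and> f (of_real x) = g (of_real x)"
    and w: "w \<in> S"
  shows "f w = g w"
proof -
  define m where "m = (a + b) / 2"
  have m: "a < m" "m < b" using ab by (auto simp: m_def)
  have "complex_of_real m islimpt of_real ` {a<..<b}"
    unfolding islimpt_approachable
  proof (intro allI impI)
    fix e :: real assume e: "e > 0"
    define x where "x = m + min e (b - m) / 2"
    have "m < x" "x < b" "x - m < e" using e m by (auto simp: x_def min_def field_simps)
    then show "\<exists>x'\<in>of_real ` {a<..<b}. x' \<noteq> complex_of_real m \<and> dist x' (of_real m) < e"
      using m by (intro bexI[of _ "of_real x"]) (auto simp: dist_of_real dist_real_def)
  qed
  moreover have "(\<lambda>z. f z - g z) holomorphic_on S" by (intro holomorphic_intros f g)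
  ultimately have "(\<lambda>z. f z - g z) w = 0"
    by (intro analytic_continuation[of "\<lambda>z. f z - g z" S "of_real ` {a<..<b}" "of_real m" w])
       (use S w eq m in auto)
  then show ?thesis by simp
qed

lemma zeta_of_real_sums:
  assumes "s > 1"
  shows "\<exists>Z. (\<lambda>n. real (Suc n) powr (- s)) sums Z \<and> zeta (of_real s) = of_real Z \<and> Z > 0"
proof -
  have "summable (\<lambda>n. real (Suc n) powr (- s))" using assms by (intro summable_Suc_powr) auto
  then obtain Z where Z: "(\<lambda>n. real (Suc n) powr (- s)) sums Z" by (auto simp: summable_def)
  have "of_nat (Suc n) powr (- complex_of_real s) = of_real (real (Suc n) powr (- s))" for n
    using powr_of_real[of "real (Suc n)" "- s"] by simp
  then have "(\<lambda>n. of_real (real (Suc n) powr (- s))) sums zeta (of_real s)"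
    using zeta_series_sums[of "of_real s"] assms by (simp add: zeta_eq_series)
  moreover have "(\<lambda>n. complex_of_real (real (Suc n) powr (- s))) sums of_real Z"
    using Z by (rule sums_of_real)
  ultimately have "zeta (of_real s) = of_real Z" by (rule sums_unique2)
  moreover have "Z > 0"
    using Z suminf_pos[of "\<lambda>n. real (Suc n) powr (- s)"] by (auto simp: sums_iff)
  ultimately show ?thesis using Z by blast
qed

text \<open>The geometric series turns \<open>1 / (exp x - 1)\<close> into the sum of
  \<open>exp (- (n + 1) * x)\<close>, each of which gives a scaled Gamma integral.\<close>

lemma Planck_Mellin:
  fixes s :: real
  assumes s: "s > 1" and Z: "(\<lambda>n. real (Suc n) powr (- s)) sums Z"
  shows "has_bochner_integral lborel (\<lambda>x. indicator {0<..} x * (x powr (s - 1) * (1 / (exp x - 1)))) (Gamma s * Z)"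
proof (rule has_bochner_integral_sums_nonneg)
  let ?f = "\<lambda>n x. indicator {0<..} x * (x powr (s - 1) * exp (- real (Suc n) * x))"
  show "0 \<le> ?f n x" for n x by simp
  show "has_bochner_integral lborel (?f n) (Gamma s / real (Suc n) powr s)" for n
    by (rule Gamma_integral_scaled) (use s in auto)
  have "(\<lambda>n. Gamma s * real (Suc n) powr (- s)) sums (Gamma s * Z)" by (rule sums_mult[OF Z])
  then show "(\<lambda>n. Gamma s / real (Suc n) powr s) sums (Gamma s * Z)"
    by (simp only: powr_minus divide_inverse)
  show "(\<lambda>n. ?f n x) sums (indicator {0<..} x * (x powr (s - 1) * (1 / (exp x - 1))))" for x
  proof (cases "x > 0")
    case True
    have "(\<lambda>n. exp (- x) * exp (- x) ^ n) sums (exp (- x) * (1 / (1 - exp (- x))))"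
      by (intro sums_mult geometric_sums) (use True in simp)
    moreover have "exp (- x) * exp (- x) ^ n = exp (- real (Suc n) * x)" for n
      by (simp add: exp_of_nat_mult[symmetric] exp_add[symmetric] algebra_simps)
    moreover have "exp (- x) * (1 / (1 - exp (- x))) = 1 / (exp x - 1)"
      using True by (simp add: exp_minus field_simps)
    ultimately show ?thesis by (intro sums_mult) simp
  qed simp
qed

text \<open>Subtracted are the first two terms \<open>1 / x - 1/2\<close> of the expansion at 0. The
  default value 1/2 at \<open>x = 0\<close> never enters, as the integrals run over
  \<open>{0<..}\<close>.\<close>

definition planck_reg :: "real \<Rightarrow> real" where
  "planck_reg x = 1 / (exp x - 1) - 1 / x + 1/2"

text \<open>The partial fractions are transformed one by one with
  \<open>c = 2 * pi * (n + 1)\<close>; the powers \<open>c powr (s - 1)\<close> add up to a series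
  for \<open>zeta (1 - s)\<close>, which is how the reflected argument enters.\<close>

lemma planck_reg_Mellin:
  fixes s :: real
  assumes s: "-1 < s" "s < 0" and Z: "(\<lambda>n. real (Suc n) powr (- (1 - s))) sums Z"
  shows "has_bochner_integral lborel (\<lambda>x. indicator {0<..} x * (x powr (s - 1) * planck_reg x))
    (Gamma ((1 + s) / 2) * Gamma ((1 - s) / 2) * (2 * pi) powr (s - 1) * Z)"
proof (rule has_bochner_integral_sums_nonneg)
  let ?G = "Gamma ((1 + s) / 2) * Gamma ((1 - s) / 2)"
  let ?f = "\<lambda>n x. indicator {0<..} x * (2 * x powr s / (x\<^sup>2 + (2 * pi * real (Suc n))\<^sup>2))"
  show "0 \<le> ?f n x" for n x by simp
  show "has_bochner_integral lborel (?f n) (?G * (2 * pi * real (Suc n)) powr (s - 1))" for n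
    by (rule Mellin_inverse_quadratic) (use s in auto)
  have "(\<lambda>n. ?G * (2 * pi) powr (s - 1) * real (Suc n) powr (- (1 - s))) sums (?G * (2 * pi) powr (s - 1) * Z)"
    by (rule sums_mult[OF Z])
  moreover have "?G * (2 * pi) powr (s - 1) * real (Suc n) powr (- (1 - s)) = ?G * (2 * pi * real (Suc n)) powr (s - 1)" for n
    by (simp add: powr_mult)
  ultimately show "(\<lambda>n. ?G * (2 * pi * real (Suc n)) powr (s - 1)) sums (?G * (2 * pi) powr (s - 1) * Z)"
    by (simp only:)
  show "(\<lambda>n. ?f n x) sums (indicator {0<..} x * (x powr (s - 1) * planck_reg x))" for x
  proof (cases "x > 0")
    case True
    have "(\<lambda>n. x powr (s - 1) * (2 * x / (x\<^sup>2 + (2 * pi * real (Suc n))\<^sup>2))) sums (x powr (s - 1) * planck_reg x)"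
      unfolding planck_reg_def by (intro sums_mult Planck_partial_fractions True)
    moreover have "x powr (s - 1) * (2 * x / q) = 2 * x powr s / q" for q
      using True by (simp add: powr_diff)
    ultimately have "(\<lambda>n. 2 * x powr s / (x\<^sup>2 + (2 * pi * real (Suc n))\<^sup>2)) sums (x powr (s - 1) * planck_reg x)"
      by (simp only:)
    then show ?thesis by (intro sums_mult)
  qed simp
qed

lemma planck_reg_bounds:
  obtains B where "B \<ge> 0" "\<And>x. x > 0 \<Longrightarrow> 0 \<le> planck_reg x \<and> planck_reg x \<le> B * x"
proof
  define a where "a = (\<lambda>n. 2 / (2 * pi)\<^sup>2 * real (Suc n) powr (- 2))"
  have a: "summable a" unfolding a_def by (intro summable_mult summable_Suc_powr) auto
  show "suminf a \<ge> 0" using a by (intro suminf_nonneg) (auto simp: a_def)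
  fix x :: real assume x: "x > 0"
  have S: "(\<lambda>n. 2 * x / (x\<^sup>2 + (2 * pi * real (Suc n))\<^sup>2)) sums planck_reg x"
    unfolding planck_reg_def by (rule Planck_partial_fractions[OF x])
  have "2 * x / (x\<^sup>2 + (2 * pi * real (Suc n))\<^sup>2) \<le> a n * x" for n
  proof -
    have "2 * x / (x\<^sup>2 + (2 * pi * real (Suc n))\<^sup>2) \<le> 2 * x / (2 * pi * real (Suc n))\<^sup>2"
      using x by (intro divide_left_mono) (auto intro!: mult_pos_pos add_pos_pos)
    also have "\<dots> = a n * x"
    proof -
      have "real (Suc n) powr (- 2) = 1 / (real (Suc n))\<^sup>2" by (simp add: powr_minus inverse_eq_divide)
      then show ?thesis unfolding a_def power_mult_distrib by simp
    qed
    finally show ?thesis .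
  qed
  then have "planck_reg x \<le> suminf a * x"
    using S a by (intro sums_le[OF _ S sums_mult2[OF summable_sums[OF a]]]) auto
  moreover have "0 \<le> planck_reg x"
    using x by (intro sums_le[OF _ sums_zero S]) auto
  ultimately show "0 \<le> planck_reg x \<and> planck_reg x \<le> suminf a * x" by blast
qed

text \<open>Without the correction beyond 1, the Mellin integral converges for all \<open>Re s > -1\<close>.\<close>

definition planck_cut :: "real \<Rightarrow> real" where
  "planck_cut x = (if x \<le> 1 then planck_reg x else 1 / (exp x - 1))"

lemma measurable_planck [measurable]: "planck_reg \<in> borel_measurable borel" "planck_cut \<in> borel_measurable borel"
  unfolding planck_cut_def planck_reg_def by measurable

lemma has_bochner_integral_powr_0_1:
  fixes a :: real
  assumes "a > -1"
  shows "has_bochner_integral lborel (\<lambda>x. indicator {0..1} x * x powr a) (1 / (a + 1))"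
  by (rule has_integral_nonneg_imp_has_bochner_integral)
     (use has_integral_powr_from_0[OF assms, of 1] in auto)

lemma has_bochner_integral_powr_1_inf:
  fixes a :: real
  assumes "a < -1"
  shows "has_bochner_integral lborel (\<lambda>x. indicator {1..} x * x powr a) (- (1 / (a + 1)))"
  by (rule has_integral_nonneg_imp_has_bochner_integral)
     (use has_integral_powr_to_inf[OF assms, of 1] in auto)

lemma integrable_planck_cut:
  fixes s :: real
  assumes s: "s > -1"
  shows "integrable lborel (\<lambda>x. indicator {0<..} x * (x powr (s - 1) * planck_cut x))"
proof -
  obtain B where B: "B \<ge> 0" "\<And>x. x > 0 \<Longrightarrow> 0 \<le> planck_reg x \<and> planck_reg x \<le> B * x"
    by (rule planck_reg_bounds) blast
  \<comment> \<open>Beyond 1, \<open>x powr (s - 1)\<close> is at most \<open>x powr |s|\<close>;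
    the exponent \<open>|s| + 1\<close> keeps the Gamma integral convergent when \<open>s\<close> is
    negative as well. Near 0 the bound \<open>B * x\<close> gives \<open>x powr s\<close>,
    integrable since \<open>s > -1\<close>.\<close>
  define w where "w = (\<lambda>x. B * (indicator {0..1} x * x powr s) + 2 * (indicator {0<..} x * (x powr (\<bar>s\<bar> + 1 - 1) * exp (- 1 * x))))"
  have wi: "integrable lborel w"
    unfolding w_def
    by (intro Bochner_Integration.integrable_add integrable_mult_right)
       (use has_bochner_integral_powr_0_1[OF s] Gamma_integral_scaled[of "\<bar>s\<bar> + 1" 1] in \<open>auto simp: has_bochner_integral_iff\<close>)
  have bd: "norm (indicator {0<..} x * (x powr (s - 1) * planck_cut x)) \<le> norm (w x)" for x
  proof -
    have w0: "w x \<ge> 0" using B(1) by (simp add: w_def)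
    consider "x \<le> 0" | "0 < x" "x \<le> 1" | "x > 1" by linarith
    then have "norm (indicator {0<..} x * (x powr (s - 1) * planck_cut x)) \<le> w x"
    proof cases
      case 1 then show ?thesis using w0 by simp
    next
      case 2
      have "x powr (s - 1) * planck_reg x \<le> x powr (s - 1) * (B * x)"
        using B(2)[OF 2(1)] by (intro mult_left_mono) auto
      also have "\<dots> = B * x powr s" using 2 by (simp add: powr_diff)
      also have "\<dots> \<le> w x" using 2 by (simp add: w_def)
      finally show ?thesis using 2 B(2)[OF 2(1)] by (simp add: planck_cut_def)
    next
      case 3
      have "exp x \<ge> 2" using 3 exp_ge_add_one_self[of x] by linarith
      then have "exp x / (exp x - 1) \<le> 2" using 3 by (subst pos_divide_le_eq) auto
      then have "1 / (exp x - 1) \<le> 2 * exp (- x)" by (simp add: exp_minus field_simps)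
      moreover have "x powr (s - 1) \<le> x powr \<bar>s\<bar>" using 3 by (intro powr_mono) auto
      ultimately have "x powr (s - 1) * (1 / (exp x - 1)) \<le> x powr \<bar>s\<bar> * (2 * exp (- x))"
        by (intro mult_mono) (use 3 in auto)
      also have "\<dots> \<le> w x" using 3 by (simp add: w_def)
      finally show ?thesis using 3 by (simp add: planck_cut_def)
    qed
    then show ?thesis using w0 by simp
  qed
  show ?thesis
    by (rule Bochner_Integration.integrable_bound[OF wi]) (measurable, use bd in simp)
qed

text \<open>The power \<open>x powr (s - 1)\<close> is written as \<open>exp (s * ln x) / x\<close>
  to match \<open>holomorphic_on_exp_integral\<close>.\<close>

definition planck_transform :: "complex \<Rightarrow> complex" where
  "planck_transform s = (\<integral>x. of_real (indicator {0<..} x * planck_cut x / x) * exp (s * of_real (ln x)) \<partial>lborel)"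

lemma norm_planck_integrand:
  "norm (of_real (indicator {0<..} x * planck_cut x / x) * exp (s * of_real (ln x)) :: complex)
    = norm (indicator {0<..} x * (x powr (Re s - 1) * planck_cut x))"
proof (cases "x > 0")
  case True
  have "exp (Re s * ln x) = x powr Re s" using True by (simp add: powr_def)
  then show ?thesis using True by (simp add: norm_mult norm_divide powr_diff abs_mult)
qed simp

lemma holomorphic_planck_transform: "planck_transform holomorphic_on {s. Re s > -1}"
  unfolding planck_transform_def[abs_def]
proof (rule holomorphic_on_exp_integral)
  show "integrable lborel (\<lambda>x. of_real (indicator {0<..} x * planck_cut x / x) * exp (s * of_real (ln x)) :: complex)"
    if "s \<in> {s. Re s > -1}" for s
    by (rule Bochner_Integration.integrable_bound[OF integrable_planck_cut[of "Re s"]])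
       (use that in \<open>auto simp only: norm_planck_integrand mem_Collect_eq\<close>, measurable)
qed (auto simp: open_Re_gt)

lemma planck_transform_of_real:
  "planck_transform (of_real s) = of_real (\<integral>x. indicator {0<..} x * (x powr (s - 1) * planck_cut x) \<partial>lborel)"
proof -
  have "of_real (indicator {0<..} x * planck_cut x / x) * exp (of_real s * of_real (ln x)) =
      complex_of_real (indicator {0<..} x * (x powr (s - 1) * planck_cut x))" for x
  proof (cases "x > 0")
    case True
    have "exp (complex_of_real s * of_real (ln x)) = of_real (x powr s)"
      using True by (simp add: powr_def exp_of_real[symmetric])
    then show ?thesis using True by (simp add: powr_diff)
  qed simp
  then show ?thesis unfolding planck_transform_def by (simp only: integral_complex_of_real)
qed

text \<open>For real \<open>s > 1\<close> the terms removed on the unit interval integrate to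
  \<open>1 / (s - 1)\<close> and \<open>1 / (2 * s)\<close>. Both sides are holomorphic on
  \<open>Re s > -1\<close> away from 0 and 1, so the identity continues to negative
  \<open>s\<close>.\<close>

lemma Gamma_zeta_continuation:
  assumes s: "Re s > -1" "s \<noteq> 0" "s \<noteq> 1"
  shows "Gamma s * zeta s = planck_transform s + 1 / (s - 1) - 1 / (2 * s)"
proof (rule holomorphic_eq_of_eq_on_reals[of "\<lambda>s. Gamma s * zeta s" "{s. Re s > -1} - {0, 1}"
      "\<lambda>s. planck_transform s + 1 / (s - 1) - 1 / (2 * s)" 1 2])
  show "(\<lambda>s. Gamma s * zeta s) holomorphic_on {s. Re s > -1} - {0, 1}"
  proof (intro holomorphic_on_mult)
    show "Gamma holomorphic_on {s. Re s > -1} - {0, 1}"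
      by (rule holomorphic_Gamma) (auto elim!: nonpos_Ints_cases)
    show "zeta holomorphic_on {s. Re s > -1} - {0, 1}"
      by (rule holomorphic_on_subset[OF holomorphic_zeta]) auto
  qed
  show "(\<lambda>s. planck_transform s + 1 / (s - 1) - 1 / (2 * s)) holomorphic_on {s. Re s > -1} - {0, 1}"
    by (intro holomorphic_intros holomorphic_on_subset[OF holomorphic_planck_transform]) auto
  show "open ({s. Re s > -1} - {0, 1 :: complex})" by (intro open_Diff open_Re_gt) auto
  show "connected ({s. Re s > -1} - {0, 1 :: complex})"
    by (intro connected_open_delete_finite open_Re_gt connected_Re_gt) auto
  show "s \<in> {s. Re s > -1} - {0, 1}" using s by auto
  fix x :: real assume x: "1 < x" "x < 2"
  obtain Z where Z: "(\<lambda>n. real (Suc n) powr (- x)) sums Z" "zeta (of_real x) = of_real Z"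
    using zeta_of_real_sums[OF x(1)] by blast
  have 1: "has_bochner_integral lborel (\<lambda>t. indicator {0..1} t * t powr (x - 2)) (1 / (x - 2 + 1))"
    "has_bochner_integral lborel (\<lambda>t. 1/2 * (indicator {0..1} t * t powr (x - 1))) (1/2 * (1 / (x - 1 + 1)))"
    by (intro has_bochner_integral_mult_right has_bochner_integral_powr_0_1; use x in simp)+
  have "has_bochner_integral lborel (\<lambda>t. indicator {0<..} t * (t powr (x - 1) * (1 / (exp t - 1)))
      - indicator {0..1} t * t powr (x - 2) + 1/2 * (indicator {0..1} t * t powr (x - 1)))
      (Gamma x * Z - 1 / (x - 2 + 1) + 1/2 * (1 / (x - 1 + 1)))"
    by (intro has_bochner_integral_add has_bochner_integral_diff 1 Planck_Mellin x Z)
  moreover have "indicator {0<..} t * (t powr (x - 1) * (1 / (exp t - 1)))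
      - indicator {0..1} t * t powr (x - 2) + 1/2 * (indicator {0..1} t * t powr (x - 1)) =
      indicator {0<..} t * (t powr (x - 1) * planck_cut t)" for t
  proof (cases "0 < t \<and> t \<le> 1")
    case True
    have "t powr (x - 2) = t powr (x - 1) / t" using True by (simp add: powr_diff power2_eq_square)
    then show ?thesis using True by (simp add: planck_cut_def planck_reg_def algebra_simps)
  qed (auto simp: indicator_def planck_cut_def)
  ultimately have "(\<integral>t. indicator {0<..} t * (t powr (x - 1) * planck_cut t) \<partial>lborel) = Gamma x * Z - 1 / (x - 1) + 1 / (2 * x)"
    by (simp add: has_bochner_integral_iff)
  then have "planck_transform (of_real x) = of_real (Gamma x * Z - 1 / (x - 1) + 1 / (2 * x))"
    unfolding planck_transform_of_real by (simp only:)
  then show "of_real x \<in> {s. Re s > -1} - {0, 1} \<and>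
     Gamma (of_real x) * zeta (of_real x) = planck_transform (of_real x) + 1 / (of_real x - 1) - 1 / (2 * of_real x)"
    using x Z(2) by (simp add: Gamma_complex_of_real)
qed simp

text \<open>On this strip the correction terms are integrated over \<open>{1..}\<close> instead of
  the unit interval, to values of opposite sign, and cancel the rational terms of
  \<open>Gamma_zeta_continuation\<close>. What remains is \<open>Gamma s * zeta s\<close> as the
  Mellin transform of \<open>planck_reg\<close>, known in terms of \<open>zeta (1 - s)\<close>;
  Legendre duplication restores the symmetric form.\<close>

lemma zeta_functional_equation_real:
  fixes s :: real
  assumes s: "-1 < s" "s < 0"
  shows "of_real pi powr (- of_real s / 2) * Gamma (of_real s / 2) * zeta (of_real s) =
    of_real pi powr (- of_real (1 - s) / 2) * Gamma (of_real (1 - s) / 2) * zeta (of_real (1 - s))"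
proof -
  have s1: "1 - s > 1" using s by simp
  obtain Z where Z: "(\<lambda>n. real (Suc n) powr (- (1 - s))) sums Z" "zeta (of_real (1 - s)) = of_real Z"
    using zeta_of_real_sums[OF s1] by blast
  define W where "W = Gamma ((1 + s) / 2) * Gamma ((1 - s) / 2) * (2 * pi) powr (s - 1) * Z"
  have 1: "has_bochner_integral lborel (\<lambda>t. indicator {1..} t * t powr (s - 2)) (- (1 / (s - 2 + 1)))"
    "has_bochner_integral lborel (\<lambda>t. 1/2 * (indicator {1..} t * t powr (s - 1))) (1/2 * (- (1 / (s - 1 + 1))))"
    by (intro has_bochner_integral_mult_right has_bochner_integral_powr_1_inf; use s in simp)+
  have "has_bochner_integral lborel (\<lambda>t. indicator {0<..} t * (t powr (s - 1) * planck_reg t)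
     + indicator {1..} t * t powr (s - 2) - 1/2 * (indicator {1..} t * t powr (s - 1)))
     (W + - (1 / (s - 2 + 1)) - 1/2 * (- (1 / (s - 1 + 1))))"
    unfolding W_def by (intro has_bochner_integral_add has_bochner_integral_diff 1 planck_reg_Mellin s Z)
  then have "has_bochner_integral lborel (\<lambda>t. indicator {0<..} t * (t powr (s - 1) * planck_cut t))
     (W + - (1 / (s - 2 + 1)) - 1/2 * (- (1 / (s - 1 + 1))))"
  proof (rule has_bochner_integral_cong_AE[THEN iffD1, rotated 3])
    \<comment> \<open>At \<open>t = 1\<close> itself \<open>planck_cut\<close> carries no correction
      while the indicator of \<open>{1..}\<close> does, so the integrands agree only almost
      everywhere.\<close>
    have "AE t in lborel. t \<noteq> (1::real)" by (rule AE_lborel_singleton)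
    then show "AE t in lborel. indicator {0<..} t * (t powr (s - 1) * planck_reg t)
     + indicator {1..} t * t powr (s - 2) - 1/2 * (indicator {1..} t * t powr (s - 1)) = indicator {0<..} t * (t powr (s - 1) * planck_cut t)"
    proof eventually_elim
      case (elim t)
      show ?case
      proof (cases "t > 1")
        case True
        have "t powr (s - 2) = t powr (s - 1) / t" using True by (simp add: powr_diff power2_eq_square)
        then show ?thesis using True by (simp add: planck_cut_def planck_reg_def algebra_simps)
      qed (use elim in \<open>auto simp: indicator_def planck_cut_def\<close>)
    qed
  qed auto
  then have "planck_transform (of_real s) = of_real (W + - (1 / (s - 2 + 1)) - 1/2 * (- (1 / (s - 1 + 1))))"
    unfolding planck_transform_of_real by (simp add: has_bochner_integral_iff)
  then have 2: "Gamma (of_real s) * zeta (of_real s) = complex_of_real W"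
    using Gamma_zeta_continuation[of "of_real s"] s by simp
  have ni: "complex_of_real x \<notin> \<int>\<^sub>\<le>\<^sub>0" if "-1 < x" "x \<noteq> 0" for x :: real
    using that by (auto elim!: nonpos_Ints_cases simp: complex_eq_iff)
  have half: "complex_of_real s / 2 + 1 / 2 = of_real ((1 + s) / 2)" "complex_of_real s / 2 = of_real (s / 2)"
    by (simp_all add: add_divide_distrib)
  have dup: "Gamma (of_real s / 2) * Gamma (complex_of_real ((1 + s) / 2)) =
      of_real (2 powr (1 - s) * sqrt pi) * Gamma (of_real s)"
  proof -
    have "Gamma (complex_of_real s / 2) * Gamma (complex_of_real s / 2 + 1 / 2) =
        exp ((1 - 2 * (of_real s / 2)) * of_real (ln 2)) * of_real (sqrt pi) * Gamma (2 * (of_real s / 2))"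
    proof (rule Gamma_legendre_duplication)
      show "complex_of_real s / 2 \<notin> \<int>\<^sub>\<le>\<^sub>0" using ni[of "s / 2"] s by simp
      show "complex_of_real s / 2 + 1 / 2 \<notin> \<int>\<^sub>\<le>\<^sub>0" unfolding half(1) by (rule ni) (use s in auto)
    qed
    moreover have "exp ((1 - 2 * (of_real s / 2)) * of_real (ln 2)) = complex_of_real (2 powr (1 - s))"
      by (simp add: powr_def exp_of_real[symmetric])
    ultimately show ?thesis by (simp add: half(1))
  qed
  have G: "Gamma ((1 + s) / 2) > 0" using s by (intro Gamma_real_pos) auto
  have "Gamma (of_real s / 2) * zeta (of_real s) * of_real (Gamma ((1 + s) / 2)) = of_real (2 powr (1 - s) * sqrt pi) * (Gamma (of_real s) * zeta (of_real s))"
    using dup by (simp add: Gamma_complex_of_real mult_ac del: of_real_divide of_real_add)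
  also have "\<dots> = of_real (2 powr (1 - s) * sqrt pi * W)" unfolding 2 by simp
  also have "2 powr (1 - s) * sqrt pi * W = pi powr (s - 1/2) * Gamma ((1 - s) / 2) * Z * Gamma ((1 + s) / 2)"
  proof -
    have "2 powr (1 - s) * (2 * pi) powr (s - 1) * sqrt pi = (2 powr (1 - s) * 2 powr (s - 1)) * (pi powr (s - 1) * pi powr (1/2))"
      by (simp add: powr_mult powr_half_sqrt)
    also have "\<dots> = pi powr (s - 1/2)" by (simp add: powr_add[symmetric])
    finally show ?thesis unfolding W_def by (metis (no_types, opaque_lifting) mult.commute mult.left_commute)
  qed
  finally have a: "Gamma (of_real s / 2) * zeta (of_real s) = of_real (pi powr (s - 1/2) * Gamma ((1 - s) / 2) * Z)"
    using G by (simp del: of_real_divide)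
  have b: "complex_of_real pi powr (- of_real s / 2) = of_real (pi powr (- s / 2))"
    "complex_of_real pi powr (- of_real (1 - s) / 2) = of_real (pi powr (- (1 - s) / 2))"
    using powr_of_real[of pi "- s / 2"] powr_of_real[of pi "- (1 - s) / 2"] by simp_all
  have c: "pi powr (- s / 2) * pi powr (s - 1/2) = pi powr (- (1 - s) / 2)"
  proof -
    have e: "- s / 2 + (s - 1/2) = - (1 - s) / 2" by (simp add: field_simps)
    show ?thesis by (simp only: powr_add[symmetric] e)
  qed
  have d: "Gamma (complex_of_real (1 - s) / 2) = of_real (Gamma ((1 - s) / 2))"
    using Gamma_complex_of_real[of "(1 - s) / 2"] by simp
  have "of_real pi powr (- of_real s / 2) * Gamma (of_real s / 2) * zeta (of_real s) =
      of_real (pi powr (- s / 2)) * of_real (pi powr (s - 1/2) * Gamma ((1 - s) / 2) * Z)"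
    unfolding mult.assoc a b ..
  also have "\<dots> = of_real (pi powr (- s / 2) * pi powr (s - 1/2)) * of_real (Gamma ((1 - s) / 2)) * of_real Z"
    by simp
  finally show ?thesis unfolding Z(2) b c d .
qed

section \<open>The xi function\<close>

text \<open>Sum the first-order Taylor formula for \<open>x powr (1 - s)\<close> between consecutive
  integers: the differences telescope to -1, the linear terms give \<open>(1 - s) * zeta s\<close>,
  and the remainders \<open>R n\<close> are bounded by
  \<open>|s| |s - 1| (n + 1) powr (- 1 - Re s)\<close>. The half-plane \<open>Re s >= 1/2\<close>
  suffices later because of the functional equation.\<close>

lemma pole_free_zeta_bound:
  obtains C where "C > 0"
    "\<And>s. Re s \<ge> 1/2 \<Longrightarrow> s \<noteq> 1 \<Longrightarrow> norm ((s - 1) * zeta s) \<le> 1 + C * (norm s * norm (s - 1))"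
proof -
  define R where "R = (\<lambda>n s. of_nat (Suc (Suc n)) powr (1 - s)
      - (\<Sum>i\<le>1. falling i (1 - s) * of_nat (Suc n) powr (1 - s - of_nat i) / fact i) :: complex)"
  have f2: "norm (falling (Suc 1) (1 - s)) = norm s * norm (s - 1)" for s
    by (simp add: falling_def norm_mult norm_minus_commute)
  have Rb: "norm (R n s) \<le> (norm s * norm (s - 1)) * real (Suc n) powr (- 1 - d)" if "Re s \<ge> d" "d \<ge> 0" for n s d
  proof -
    have "norm (R n s) \<le> norm (falling (Suc 1) (1 - s)) * real (Suc n) powr (Re (1 - s) - of_nat (Suc 1))"
      unfolding R_def by (rule powr_Taylor_bound) (use that in auto)
    also have "\<dots> \<le> norm (falling (Suc 1) (1 - s)) * real (Suc n) powr (- 1 - d)"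
      using that by (intro mult_left_mono powr_mono) auto
    finally show ?thesis unfolding f2 .
  qed
  have Rhol: "(\<lambda>s. \<Sum>n. R n s) holomorphic_on {s. Re s > 0}"
  proof (rule holomorphic_on_suminf_local)
    show "R n holomorphic_on {s. Re s > 0}" for n
      unfolding R_def falling_def by (intro holomorphic_intros) auto
    fix x :: complex assume x: "x \<in> {s. Re s > 0}"
    define d where "d = Re x / 2"
    have d: "d > 0" using x by (simp add: d_def)
    have y: "Re y \<ge> d" if "y \<in> cball x d" for y
      using cball_Re_ge[OF that] by (simp add: d_def field_simps)
    have "compact ((\<lambda>s. norm s * norm (s - 1)) ` cball x d)"
      by (intro compact_continuous_image continuous_intros) auto
    from compact_imp_bounded[OF this] obtain B where
      "\<And>y. y \<in> cball x d \<Longrightarrow> norm (norm y * norm (y - 1)) \<le> B"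
      unfolding bounded_iff by blast
    then have B: "norm y * norm (y - 1) \<le> B" if "y \<in> cball x d" for y
      using that by (metis abs_le_D1 real_norm_def)
    have "norm (R n y) \<le> B * real (Suc n) powr (- 1 - d)" if "y \<in> cball x d" for n y
    proof -
      have "norm (R n y) \<le> (norm y * norm (y - 1)) * real (Suc n) powr (- 1 - d)"
        using y[OF that] d by (intro Rb) auto
      also have "\<dots> \<le> B * real (Suc n) powr (- 1 - d)"
        by (rule mult_right_mono[OF B[OF that]]) simp
      finally show ?thesis .
    qed
    moreover have "summable (\<lambda>n. B * real (Suc n) powr (- 1 - d))"
      using d by (intro summable_mult summable_Suc_powr) auto
    moreover have "cball x d \<subseteq> {s. Re s > 0}"
      using y d by fastforce
    ultimately show "\<exists>d>0. \<exists>M. cball x d \<subseteq> {s. Re s > 0} \<and> summable M \<and> (\<forall>n. \<forall>y\<in>cball x d. norm (R n y) \<le> M n)"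
      using d by blast
  qed (rule open_Re_gt)
  have eq: "(s - 1) * zeta s = 1 + (\<Sum>n. R n s)" if s: "Re s > 0" "s \<noteq> 1" for s
  proof (rule holomorphic_eq_of_eq_on_reals[of "\<lambda>s. (s - 1) * zeta s" "{s. Re s > 0} - {1}" "\<lambda>s. 1 + (\<Sum>n. R n s)" 1 2])
    show "(\<lambda>s. (s - 1) * zeta s) holomorphic_on {s. Re s > 0} - {1}"
      by (intro holomorphic_intros holomorphic_on_subset[OF holomorphic_zeta]) auto
    show "(\<lambda>s. 1 + (\<Sum>n. R n s)) holomorphic_on {s. Re s > 0} - {1}"
      by (intro holomorphic_intros holomorphic_on_subset[OF Rhol]) auto
    show "open ({s. Re s > 0} - {1 :: complex})" by (intro open_Diff open_Re_gt) auto
    show "connected ({s. Re s > 0} - {1 :: complex})"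
      by (intro connected_open_delete open_Re_gt connected_Re_gt) auto
    show "s \<in> {s. Re s > 0} - {1}" using s by auto
    fix x :: real assume x: "1 < x" "x < 2"
    define s where "s = complex_of_real x"
    have s: "Re s > 1" using x by (simp add: s_def)
    have "(\<lambda>n. of_nat (Suc n) powr (1 - s)) \<longlonglongrightarrow> 0"
    proof (rule tendsto_norm_zero_cancel)
      show "(\<lambda>n. norm (of_nat (Suc n) powr (1 - s))) \<longlonglongrightarrow> 0"
        unfolding norm_Suc_powr
        by (rule tendsto_neg_powr)
           (use s filterlim_compose[OF filterlim_real_sequentially filterlim_Suc] in auto)
    qed
    from telescope_sums[OF this]
    have "(\<lambda>n. of_nat (Suc (Suc n)) powr (1 - s) - of_nat (Suc n) powr (1 - s)) sums (- 1)" by simp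
    then have "(\<lambda>n. (of_nat (Suc (Suc n)) powr (1 - s) - of_nat (Suc n) powr (1 - s)) - (1 - s) * of_nat (Suc n) powr (- s))
        sums (- 1 - (1 - s) * zeta_series s)"
      by (intro sums_diff sums_mult zeta_series_sums s)
    moreover have "R n s = (of_nat (Suc (Suc n)) powr (1 - s) - of_nat (Suc n) powr (1 - s)) - (1 - s) * of_nat (Suc n) powr (- s)" for n
      unfolding R_def by (simp add: falling_def atMost_Suc)
    ultimately have "(\<Sum>n. R n s) = - 1 - (1 - s) * zeta s"
      using s by (simp add: sums_iff zeta_eq_series)
    then show "of_real x \<in> {s. Re s > 0} - {1} \<and> (of_real x - 1) * zeta (of_real x) = 1 + (\<Sum>n. R n (of_real x))"
      using x by (simp add: s_def algebra_simps)
  qed simp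
  define C where "C = (\<Sum>n. real (Suc n) powr (- 1 - 1/2))"
  have sC: "summable (\<lambda>n. real (Suc n) powr (- 1 - 1/2))" by (rule summable_Suc_powr) auto
  have "C > 0" unfolding C_def using sC by (intro suminf_pos) auto
  moreover have "norm ((s - 1) * zeta s) \<le> 1 + C * (norm s * norm (s - 1))" if s: "Re s \<ge> 1/2" "s \<noteq> 1" for s
  proof -
    have sm: "summable (\<lambda>n. (norm s * norm (s - 1)) * real (Suc n) powr (- 1 - 1/2))"
      by (intro summable_mult sC)
    have le: "norm (R n s) \<le> (norm s * norm (s - 1)) * real (Suc n) powr (- 1 - 1/2)" for n
      using Rb[of "1/2" s n] s by simp
    have "norm (\<Sum>n. R n s) \<le> (\<Sum>n. (norm s * norm (s - 1)) * real (Suc n) powr (- 1 - 1/2))"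
      by (rule norm_suminf_le[OF le sm])
    also have "\<dots> = C * (norm s * norm (s - 1))"
      unfolding C_def using sC by (subst suminf_mult) auto
    finally show ?thesis
      using eq[of s] s norm_triangle_ineq[of 1 "\<Sum>n. R n s"] by simp
  qed
  ultimately show ?thesis using that by blast
qed

section \<open>Growth of \<open>Gamma\<close> in the right half-plane\<close>

lemma norm_Gamma_le_Gamma_Re:
  assumes "Re z > 0"
  shows "norm (Gamma z) \<le> Gamma (Re z)"
proof -
  have 1: "((\<lambda>t. of_real t powr (z - 1) / of_real (exp t)) has_integral Gamma z) {0<..}"
    by (rule Gamma_integral_complex'[OF assms])
  have "((\<lambda>t. of_real t powr (of_real (Re z) - 1) / of_real (exp t)) has_integral Gamma (complex_of_real (Re z))) {0<..}"
    by (rule Gamma_integral_complex') (use assms in simp)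
  from has_integral_Re[OF this]
  have 2: "((\<lambda>t. Re (of_real t powr (of_real (Re z) - 1) / of_real (exp t))) has_integral Gamma (Re z)) {0<..}"
    by (simp add: Gamma_complex_of_real)
  have 3: "norm (of_real t powr (z - 1) / of_real (exp t)) \<le> Re (of_real t powr (of_real (Re z) - 1) / of_real (exp t))"
    if "t \<in> {0<..}" for t :: real
  proof -
    have "of_real t powr (of_real (Re z) - 1) = complex_of_real (t powr (Re z - 1))"
      using that powr_of_real[of t "Re z - 1"] by simp
    then have "Re (of_real t powr (of_real (Re z) - 1) / of_real (exp t)) = t powr (Re z - 1) / exp t"
      by (simp only: of_real_divide[symmetric] Re_complex_of_real)
    moreover have "norm (of_real t powr (z - 1)) = t powr (Re z - 1)"
      using that by (simp add: norm_powr_real_powr)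
    ultimately show ?thesis by (simp only: norm_divide norm_of_real) simp
  qed
  show ?thesis
    using Henstock_Kurzweil_Integration.integral_norm_bound_integral[OF has_integral_integrable[OF 1] has_integral_integrable[OF 2] 3]
    by (simp only: integral_unique[OF 1] integral_unique[OF 2])
qed

text \<open>\<open>Gamma\<close> is not increasing near 1, so the integrands are compared instead:
  \<open>t powr (x - 1)\<close> is at most 1 for \<open>t <= 1\<close> and at most
  \<open>t ^ n\<close> beyond.\<close>

lemma Gamma_le_one_plus_fact:
  fixes x :: real
  assumes x: "1 \<le> x" "x \<le> real n + 1"
  shows "Gamma x \<le> 1 + fact n"
proof -
  let ?f = "\<lambda>x t. indicator {0<..} t * (t powr (x - 1) * exp (- 1 * t)) :: real"
  have b: "has_bochner_integral lborel (?f y) (Gamma y)" if "y > 0" for y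
    using Gamma_integral_scaled[of y 1] that by simp
  have "Gamma x \<le> Gamma 1 + Gamma (real n + 1)"
  proof -
    have 1: "has_bochner_integral lborel (?f x) (Gamma x)" using x by (intro b) auto
    have 2: "has_bochner_integral lborel (\<lambda>t. ?f 1 t + ?f (real n + 1) t) (Gamma 1 + Gamma (real n + 1))"
      by (intro has_bochner_integral_add b) auto
    have "t powr (x - 1) \<le> t powr (1 - 1) + t powr (real n + 1 - 1)" if "t > 0" for t
    proof (cases "t \<le> 1")
      case True
      then have "t powr (x - 1) \<le> 1" using that x by (intro powr_le1) auto
      then show ?thesis using that by (simp add: add_increasing2)
    next
      case False
      then have "t powr (x - 1) \<le> t powr (real n + 1 - 1)" using x by (intro powr_mono) auto
      then show ?thesis by (simp add: add_increasing)
    qed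
    then have 3: "?f x t \<le> ?f 1 t + ?f (real n + 1) t" for t
    proof (cases "t > 0")
      case True
      have "t powr (x - 1) * exp (- 1 * t) \<le> (t powr (1 - 1) + t powr (real n + 1 - 1)) * exp (- 1 * t)"
        using \<open>\<And>t. 0 < t \<Longrightarrow> t powr (x - 1) \<le> t powr (1 - 1) + t powr (real n + 1 - 1)\<close>[OF True]
        by (rule mult_right_mono) simp
      then show ?thesis using True by (simp add: distrib_right)
    qed simp
    have "(\<integral>t. ?f x t \<partial>lborel) \<le> (\<integral>t. ?f 1 t + ?f (real n + 1) t \<partial>lborel)"
      by (rule integral_mono) (use 1 2 3 in \<open>auto simp only: has_bochner_integral_iff\<close>)
    then show ?thesis using 1 2 by (simp only: has_bochner_integral_iff)
  qed
  then show ?thesis using Gamma_fact[of n, where 'a = real] by (simp add: add.commute)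
qed

definition xi_formula :: "complex \<Rightarrow> complex" where
  "xi_formula s = 1/2 * s * (s - 1) * of_real pi powr (- s/2) * Gamma (s/2) * zeta s"

lemma Re_pos_notin_nonpos_Ints: "Re z > 0 \<Longrightarrow> z \<notin> \<int>\<^sub>\<le>\<^sub>0"
  by (auto elim!: nonpos_Ints_cases)

text \<open>Right of \<open>Re s = -2\<close> the poles disappear in \<open>Gamma (1 + s/2)\<close>
  and in the continuation \<open>F\<close> of \<open>(s - 1) * zeta s\<close>, giving
  \<open>Y\<close>. The functional equation on the real segment from -1 to 0 makes \<open>Y\<close>
  symmetric on \<open>-2 < Re s < 3\<close>, so gluing \<open>Y s\<close> with
  \<open>Y (1 - s)\<close> yields an entire function.\<close>

lemma xi_regular:
  obtains X where "X holomorphic_on UNIV" "\<And>s. X (1 - s) = X s"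
    "\<And>s. s \<noteq> 1 \<Longrightarrow> s / 2 \<notin> \<int>\<^sub>\<le>\<^sub>0 \<Longrightarrow> X s = xi_formula s"
proof -
  define D where "D = {s::complex. Re s > -2}"
  obtain F where F: "F holomorphic_on D" "\<And>s. Re s > 1 \<Longrightarrow> F s = (s - 1) * zeta_series s"
    using zeta_half_plane[of 3] by (auto simp: D_def)
  have Fz: "F s = (s - 1) * zeta s" if s: "Re s > -2" "s \<noteq> 1" for s
  proof (rule holomorphic_eq_of_eq_on_reals[of F "D - {1}" "\<lambda>s. (s - 1) * zeta s" 1 2])
    show "F holomorphic_on D - {1}" by (rule holomorphic_on_subset[OF F(1)]) auto
    show "(\<lambda>s. (s - 1) * zeta s) holomorphic_on D - {1}"
      by (intro holomorphic_intros holomorphic_on_subset[OF holomorphic_zeta]) auto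
    show "open (D - {1})" unfolding D_def by (intro open_Diff open_Re_gt) auto
    show "connected (D - {1})"
      unfolding D_def by (intro connected_open_delete open_Re_gt connected_Re_gt) auto
    show "s \<in> D - {1}" using s by (auto simp: D_def)
    show "of_real x \<in> D - {1} \<and> F (of_real x) = (of_real x - 1) * zeta (of_real x)" if "1 < x" "x < 2" for x :: real
      using that F(2)[of "of_real x"] zeta_eq_series[of "of_real x"] by (auto simp: D_def)
  qed simp
  define Y where "Y = (\<lambda>s. of_real pi powr (- s/2) * Gamma (1 + s/2) * F s)"
  have Ghol: "(\<lambda>s. Gamma (1 + s/2)) holomorphic_on D"
  proof (rule holomorphic_Gamma')
    show "(\<lambda>s::complex. 1 + s/2) holomorphic_on D" by (auto intro!: holomorphic_intros)
    show "1 + s/2 \<notin> \<int>\<^sub>\<le>\<^sub>0" if "s \<in> D" for s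
      using that by (intro Re_pos_notin_nonpos_Ints) (simp add: D_def)
  qed
  have Yhol: "Y holomorphic_on D"
    unfolding Y_def by (intro holomorphic_intros Ghol F(1)) simp_all
  have Yf: "Y s = xi_formula s" if "Re s > -2" "s \<noteq> 1" "s / 2 \<notin> \<int>\<^sub>\<le>\<^sub>0" for s
    unfolding Y_def xi_formula_def Fz[OF that(1,2)]
    using Gamma_plus1[OF that(3)] by (simp add: add.commute mult_ac)
  have ni: "complex_of_real x / 2 \<notin> \<int>\<^sub>\<le>\<^sub>0" if "-2 < x" "x \<noteq> 0" for x :: real
  proof
    assume "complex_of_real x / 2 \<in> \<int>\<^sub>\<le>\<^sub>0"
    then obtain n where "complex_of_real x / 2 = - of_nat n" by (auto elim!: nonpos_Ints_cases')
    then have "Re (complex_of_real x / 2) = Re (- of_nat n)" by (rule arg_cong)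
    then have x: "x = - 2 * real n" by simp
    then have "n = 0" using that by simp
    then show False using x that by simp
  qed
  define E where "E = D \<inter> {s. Re s < 3}"
  have Yr: "(Y \<circ> (\<lambda>s. 1 - s)) holomorphic_on {s. Re s < 3}"
    by (rule holomorphic_on_compose_gen[OF _ Yhol]) (auto intro!: holomorphic_intros simp: D_def)
  have sym: "Y s = Y (1 - s)" if "Re s > -2" "Re s < 3" for s
  proof -
    have "Y s = (Y \<circ> (\<lambda>s. 1 - s)) s"
    proof (rule holomorphic_eq_of_eq_on_reals[of Y E "Y \<circ> (\<lambda>s. 1 - s)" "-1" 0])
      show "Y holomorphic_on E" by (rule holomorphic_on_subset[OF Yhol]) (auto simp: E_def)
      show "(Y \<circ> (\<lambda>s. 1 - s)) holomorphic_on E" by (rule holomorphic_on_subset[OF Yr]) (auto simp: E_def)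
      show "open E" unfolding E_def D_def by (intro open_Int open_Re_gt open_halfspace_Re_lt)
      show "connected E" unfolding E_def D_def
        by (intro convex_connected convex_Int convex_halfspace_Re_gt convex_halfspace_Re_lt)
      show "s \<in> E" using that by (simp add: E_def D_def)
      fix x :: real assume x: "-1 < x" "x < 0"
      have "Y (of_real x) = xi_formula (of_real x)"
        by (rule Yf) (use x ni in auto)
      also have "\<dots> = xi_formula (of_real (1 - x))"
        using zeta_functional_equation_real[OF x] unfolding xi_formula_def
        by (simp add: mult.assoc) (simp add: algebra_simps)
      also have "\<dots> = Y (of_real (1 - x))"
        by (rule Yf[symmetric]) (use x ni[of "1 - x"] in auto)
      finally show "of_real x \<in> E \<and> Y (of_real x) = (Y \<circ> (\<lambda>s. 1 - s)) (of_real x)"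
        using x by (simp add: E_def D_def)
    qed simp
    then show ?thesis by simp
  qed
  define X where "X = (\<lambda>s. if Re s > -1 then Y s else Y (1 - s))"
  have XY: "X s = Y s" if "Re s > -2" for s using sym[of s] that by (auto simp: X_def)
  have XY': "X s = Y (1 - s)" if "Re s < 3" for s using sym[of s] that by (auto simp: X_def)
  have "X holomorphic_on D \<union> {s. Re s < 3}"
  proof (rule holomorphic_on_Un)
    show "X holomorphic_on D" by (rule holomorphic_transform[OF Yhol]) (simp add: XY D_def)
    show "X holomorphic_on {s. Re s < 3}" by (rule holomorphic_transform[OF Yr]) (simp add: XY')
  qed (auto simp: D_def open_Re_gt open_halfspace_Re_lt)
  moreover have "D \<union> {s. Re s < 3} = UNIV" by (auto simp: D_def)
  ultimately have Xhol: "X holomorphic_on UNIV" by simp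
  have "X (1 - s) = X s" for s
    using XY[of s] XY[of "1 - s"] XY'[of s] XY'[of "1 - s"]
    by (cases "Re s < 3") auto
  moreover have "X s = xi_formula s" if s: "s \<noteq> 1" "s / 2 \<notin> \<int>\<^sub>\<le>\<^sub>0" for s
  proof -
    \<comment> \<open>The exceptional set is countable and closed, so its complement is open and
      connected; this lets the formula spread from the segment \<open>1 < x < 2\<close> past all
      poles of \<open>Gamma (s/2)\<close>.\<close>
    define U where "U = - insert 1 ((\<lambda>z. 2 * z) ` (\<int>\<^sub>\<le>\<^sub>0 :: complex set))"
    have U: "z \<in> U \<longleftrightarrow> z \<noteq> 1 \<and> z / 2 \<notin> \<int>\<^sub>\<le>\<^sub>0" for z
      unfolding U_def by (auto intro!: image_eqI[of _ _ "z / 2"])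
    have cl: "closed ((\<lambda>z. 2 * z) ` (\<int>\<^sub>\<le>\<^sub>0 :: complex set))"
      by (rule closed_subset_Ints) (auto elim!: nonpos_Ints_cases)
    have cnt: "countable (insert 1 ((\<lambda>z. 2 * z) ` (\<int>\<^sub>\<le>\<^sub>0 :: complex set)))"
    proof (intro countable_insert countable_image)
      have "(\<int>\<^sub>\<le>\<^sub>0 :: complex set) \<subseteq> range (\<lambda>n::nat. - of_nat n)" by (auto elim!: nonpos_Ints_cases')
      then show "countable (\<int>\<^sub>\<le>\<^sub>0 :: complex set)" by (rule countable_subset) auto
    qed
    show ?thesis
    proof (rule holomorphic_eq_of_eq_on_reals[of X U xi_formula 1 2])
      show "X holomorphic_on U" by (rule holomorphic_on_subset[OF Xhol]) auto
      show "xi_formula holomorphic_on U"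
        unfolding xi_formula_def[abs_def]
        by (intro holomorphic_intros holomorphic_Gamma' holomorphic_on_subset[OF holomorphic_zeta]) (auto simp: U)
      show "open U" unfolding U_def using cl by (intro open_Compl closed_insert)
      show "connected U" unfolding U_def Compl_eq_Diff_UNIV
        by (intro connected_open_diff_countable cnt) auto
      show "s \<in> U" using s by (simp add: U)
      show "of_real x \<in> U \<and> X (of_real x) = xi_formula (of_real x)" if "1 < x" "x < 2" for x :: real
        using that ni[of x] by (auto simp: U XY Yf)
    qed simp
  qed
  ultimately show ?thesis using Xhol that by blast
qed

text \<open>All exceptional points of \<open>xi_formula\<close> are integers, hence isolated, and
  around each of them the entire \<open>X\<close> agrees with it; \<open>remove_sings\<close>
  therefore returns the values of \<open>X\<close>.\<close>

lemma xi_holomorphic: "xi holomorphic_on UNIV"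
  and xi_reflect: "xi (1 - s) = xi s"
  and xi_eq_formula: "s \<noteq> 1 \<Longrightarrow> s / 2 \<notin> \<int>\<^sub>\<le>\<^sub>0 \<Longrightarrow> xi s = xi_formula s"
proof -
  obtain X where X: "X holomorphic_on UNIV" "\<And>s. X (1 - s) = X s"
    "\<And>s. s \<noteq> 1 \<Longrightarrow> s / 2 \<notin> \<int>\<^sub>\<le>\<^sub>0 \<Longrightarrow> X s = xi_formula s"
    by (rule xi_regular) blast
  have "xi s = X s" for s
  proof -
    have "closed (\<int> - {s})" by (rule closed_subset_Ints) auto
    then have "eventually (\<lambda>w. w \<in> - (\<int> - {s}) - {s}) (at s)"
      by (intro eventually_at_in_open open_Compl) auto
    then have "eventually (\<lambda>w. X w = xi_formula w) (at s)"
    proof eventually_elim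
      case (elim w)
      then have w: "w \<notin> \<int>" by auto
      then have "w \<noteq> 1" by auto
      moreover have "w / 2 \<notin> \<int>\<^sub>\<le>\<^sub>0"
      proof
        assume "w / 2 \<in> \<int>\<^sub>\<le>\<^sub>0"
        then have "2 * (w / 2) \<in> \<int>" using nonpos_Ints_Int by (intro Ints_mult) auto
        then show False using w by simp
      qed
      ultimately show ?case by (rule X(3))
    qed
    moreover have "X \<midarrow>s\<rightarrow> X s"
      using X(1) by (metis UNIV_I continuous_on_def holomorphic_on_imp_continuous_on)
    ultimately have "xi_formula \<midarrow>s\<rightarrow> X s" by (rule Lim_transform_eventually[rotated])
    then have "remove_sings xi_formula s = X s" by (rule remove_sings_eqI)
    then show ?thesis by (simp add: xi_def xi_formula_def[abs_def])
  qed
  then have "xi = X" by (rule ext)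
  then show "xi holomorphic_on UNIV" "xi (1 - s) = xi s"
    "s \<noteq> 1 \<Longrightarrow> s / 2 \<notin> \<int>\<^sub>\<le>\<^sub>0 \<Longrightarrow> xi s = xi_formula s"
    using X by simp_all
qed

lemma xi_growth_right:
  obtains C where "C > 0"
    "\<And>s. Re s \<ge> 0 \<Longrightarrow> norm (xi (1/2 + s)) \<le>
       (1 + exp ((norm s + 3) * ln (norm s + 3))) * (1 + C * (norm s + 1)\<^sup>2)"
proof -
  obtain C0 where C0: "C0 > 0"
    "\<And>s. Re s \<ge> 1/2 \<Longrightarrow> s \<noteq> 1 \<Longrightarrow> norm ((s - 1) * zeta s) \<le> 1 + C0 * (norm s * norm (s - 1))"
    by (rule pole_free_zeta_bound) blast
  \<comment> \<open>The zeta bound excludes the point 1; \<open>norm (xi 1)\<close> accounts for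
    it.\<close>
  define C where "C = C0 + norm (xi 1)"
  have C: "C > 0" "C0 \<le> C" using C0(1) by (auto simp: C_def add_pos_nonneg)
  have "norm (xi (1/2 + s)) \<le> (1 + exp ((norm s + 3) * ln (norm s + 3))) * (1 + C * (norm s + 1)\<^sup>2)"
    if s: "Re s \<ge> 0" for s
  proof (cases "1/2 + s = 1")
    case True
    have "norm (xi (1/2 + s)) \<le> 1 * (1 + C * 1)" using True C0(1) by (simp add: C_def)
    also have "\<dots> \<le> (1 + exp ((norm s + 3) * ln (norm s + 3))) * (1 + C * (norm s + 1)\<^sup>2)"
      using C by (intro mult_mono add_left_mono mult_left_mono) (auto simp: one_le_power)
    finally show ?thesis .
  next
    case False
    define w where "w = 1/2 + s"
    have w: "Re w \<ge> 1/2" "w \<noteq> 1" using s False by (auto simp: w_def)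
    have wn: "w / 2 \<notin> \<int>\<^sub>\<le>\<^sub>0"
      using w by (intro Re_pos_notin_nonpos_Ints) simp
    have "xi w = of_real pi powr (- w/2) * Gamma (1 + w/2) * ((w - 1) * zeta w)"
      unfolding xi_eq_formula[OF w(2) wn] xi_formula_def
      using Gamma_plus1[OF wn] by (simp add: add.commute mult_ac)
    then have "norm (xi w) = norm (of_real pi powr (- w/2) :: complex) * norm (Gamma (1 + w/2)) * norm ((w - 1) * zeta w)"
      by (simp add: norm_mult)
    also have "\<dots> \<le> 1 * (1 + exp ((norm s + 3) * ln (norm s + 3))) * (1 + C * (norm s + 1)\<^sup>2)"
    proof (intro mult_mono)
      have "norm (of_real pi powr (- w/2) :: complex) = pi powr (- Re w / 2)"
        by (simp add: norm_powr_real_powr)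
      also have "\<dots> \<le> pi powr 0" using w pi_ge_two by (intro powr_mono) auto
      finally show "norm (of_real pi powr (- w/2) :: complex) \<le> 1" by simp
      \<comment> \<open>\<open>Re (1 + w/2)\<close> is at most \<open>norm s / 2 + 5/4\<close>,
        hence at most \<open>n + 1\<close>. The crude bound \<open>n ^ n\<close> for the factorial
        is good enough, as only the order of growth matters.\<close>
      define n where "n = nat \<lceil>norm s\<rceil> + 1"
      have n: "norm s + 1 \<le> real n" "real n \<le> norm s + 3" 
        using norm_ge_zero[of s] unfolding n_def by linarith+
      have "Re s \<le> norm s" by (rule complex_Re_le_cmod)
      then have "norm (Gamma (1 + w/2)) \<le> Gamma (Re (1 + w/2))"
        using w by (intro norm_Gamma_le_Gamma_Re) simp
      also have "\<dots> \<le> 1 + fact n"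
        using w n \<open>Re s \<le> norm s\<close> s by (intro Gamma_le_one_plus_fact) (auto simp: w_def)
      also have "fact n \<le> real n ^ n"
        using fact_le_power[of n, where 'a = real] by simp
      also have "real n ^ n \<le> (norm s + 3) powr (norm s + 3)"
      proof -
        have "real n ^ n = real n powr real n" using n norm_ge_zero[of s] by (intro powr_realpow[symmetric]) linarith
        also have "\<dots> \<le> (norm s + 3) powr real n" using n by (intro powr_mono2) auto
        also have "\<dots> \<le> (norm s + 3) powr (norm s + 3)" using n norm_ge_zero[of s] by (intro powr_mono) linarith+
        finally show ?thesis .
      qed
      also have "(norm s + 3) powr (norm s + 3) = exp ((norm s + 3) * ln (norm s + 3))"
      proof -
        have "norm s + 3 > 0" using norm_ge_zero[of s] by linarith
        then show ?thesis by (simp add: powr_def)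
      qed
      finally show "norm (Gamma (1 + w/2)) \<le> 1 + exp ((norm s + 3) * ln (norm s + 3))" by simp
      have "norm w \<le> norm s + 1"
        unfolding w_def using norm_triangle_ineq[of "1/2" s] by simp
      moreover have "norm (w - 1) \<le> norm s + 1"
        unfolding w_def using norm_triangle_ineq[of "s" "-1/2"] by simp
      ultimately have "norm w * norm (w - 1) \<le> (norm s + 1) * (norm s + 1)"
        by (intro mult_mono) auto
      then have "C0 * (norm w * norm (w - 1)) \<le> C * (norm s + 1)\<^sup>2"
        using C C0(1) by (intro mult_mono) (auto simp: power2_eq_square)
      then show "norm ((w - 1) * zeta w) \<le> 1 + C * (norm s + 1)\<^sup>2"
        using C0(2)[OF w] by linarith
    qed (use C in auto)
    finally show ?thesis by (simp add: w_def)
  qed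
  then show ?thesis using that C(1) by blast
qed

lemma xi_growth:
  obtains C where "C > 0"
    "\<And>s. norm (xi (1/2 + s)) \<le> (1 + exp ((norm s + 3) * ln (norm s + 3))) * (1 + C * (norm s + 1)\<^sup>2)"
proof -
  obtain C where C: "C > 0" "\<And>s. Re s \<ge> 0 \<Longrightarrow> norm (xi (1/2 + s)) \<le>
       (1 + exp ((norm s + 3) * ln (norm s + 3))) * (1 + C * (norm s + 1)\<^sup>2)"
    by (rule xi_growth_right) blast
  have "xi (1/2 + s) = xi (1/2 + - s)" for s using xi_reflect[of "1/2 + s"] by (simp add: algebra_simps)
  then have "norm (xi (1/2 + s)) \<le> (1 + exp ((norm s + 3) * ln (norm s + 3))) * (1 + C * (norm s + 1)\<^sup>2)" for s
    using C(2)[of s] C(2)[of "- s"] by (cases "Re s \<ge> 0") (simp_all del: add_uminus_conv_diff)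
  then show ?thesis using that C(1) by blast
qed

text \<open>The odd Taylor coefficients cancel, and \<open>h\<close> has the even ones as its own.
  Its values are defined through \<open>csqrt\<close>; the power series gives holomorphy across the
  branch cut.\<close>

lemma even_entire_function_of_square:
  assumes E: "E holomorphic_on UNIV" and even: "\<And>s. E (- s) = E (s :: complex)"
  obtains h where "h holomorphic_on UNIV" "\<And>s. E s = h (s\<^sup>2)"
proof -
  define a where "a = (\<lambda>n. (deriv ^^ n) E 0 / fact n)"
  have a: "(\<lambda>n. a n * s ^ n) sums E s" for s
  proof -
    have "E holomorphic_on ball 0 (norm s + 1)" by (rule holomorphic_on_subset[OF E]) simp
    from holomorphic_power_series[OF this, of s] show ?thesis by (simp add: a_def)
  qed
  define g where "g = (\<lambda>w. E (csqrt w))"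
  have ev: "(\<lambda>n. a (2 * n) * (s\<^sup>2) ^ n) sums E s" for s
  proof -
    have "(\<lambda>n. (a n * s ^ n + a n * (- s) ^ n) / 2) sums ((E s + E (- s)) / 2)"
      by (intro sums_divide sums_add a)
    moreover have "(a n * s ^ n + a n * (- s) ^ n) / 2 = (if even n then a n * s ^ n else 0)" for n
      by simp
    ultimately have "(\<lambda>n. if even n then a n * s ^ n else 0) sums E s" by (simp add: even)
    then have "(\<lambda>n. (\<lambda>n. if even n then a n * s ^ n else 0) (2 * n)) sums E s"
      by (subst sums_mono_reindex) (auto simp: strict_mono_def elim!: evenE)
    then show ?thesis by (simp add: power_mult)
  qed
  have g: "(\<lambda>n. a (2 * n) * w ^ n) sums g w" for w
    using ev[of "csqrt w"] by (simp add: g_def)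
  have "g holomorphic_on ball 0 r" for r
    by (rule power_series_holomorphic[of _ _ "\<lambda>n. a (2 * n)"]) (use g in simp)
  then have "g holomorphic_on (\<Union>r\<in>UNIV. ball 0 r)"
    by (intro holomorphic_on_UN_open) auto
  moreover have "(\<Union>r\<in>UNIV. ball (0::complex) r) = UNIV"
    using lt_ex gt_ex by (auto simp: mem_ball_0)
  ultimately have "g holomorphic_on UNIV" by simp
  moreover have "E s = g (s\<^sup>2)" for s
    using ev[of s] g[of "s\<^sup>2"] sums_unique2 by blast
  ultimately show ?thesis using that by blast
qed

section \<open>The Laplace transform of Psi\<close>

lemma ln_powr_summable:
  fixes w :: real
  assumes "w > 1"
  shows "summable (\<lambda>n. ln (real (Suc n)) * real (Suc n) powr (- w))"
proof (rule summable_comparison_test')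
  define d where "d = (w - 1) / 2"
  have d: "d > 0" using assms by (simp add: d_def)
  show "summable (\<lambda>n. 1 / d * real (Suc n) powr (- (w - d)))"
    using assms by (intro summable_mult summable_Suc_powr) (simp add: d_def field_simps)
  fix n :: nat
  have "ln (real (Suc n)) \<le> real (Suc n) powr d / d"
    by (rule ln_powr_bound) (use d in auto)
  then have "ln (real (Suc n)) * real (Suc n) powr (- w) \<le> real (Suc n) powr d / d * real (Suc n) powr (- w)"
    by (rule mult_right_mono) simp
  also have "\<dots> = 1 / d * (real (Suc n) powr d * real (Suc n) powr (- w))" by simp
  also have "real (Suc n) powr d * real (Suc n) powr (- w) = real (Suc n) powr (- (w - d))"
    by (simp only: powr_add[symmetric]) simp
  finally show "norm (ln (real (Suc n)) * real (Suc n) powr (- w)) \<le> 1 / d * real (Suc n) powr (- (w - d))"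
    by simp
qed

lemma has_field_derivative_zeta:
  fixes w :: real
  assumes w: "w > 1"
  shows "(zeta has_field_derivative - of_real (\<Sum>n. ln (real (Suc n)) * real (Suc n) powr (- w))) (at (of_real w))"
proof -
  define c where "c = (1 + w) / 2"
  have c: "1 < c" "c < w" using w by (auto simp: c_def)
  define f where "f = (\<lambda>n s. of_nat (Suc n) powr (- s) :: complex)"
  define f' where "f' = (\<lambda>n s. - (ln (of_nat (Suc n)) * of_nat (Suc n) powr (- s)) :: complex)"
  define S where "S = {s::complex. Re s > c}"
  have wS: "of_real w \<in> S" using c by (simp add: S_def)
  have "((\<lambda>s. \<Sum>n. f n s) has_field_derivative (\<Sum>n. f' n (of_real w))) (at (of_real w))"
  proof (rule has_field_derivative_series'(2)[of S f f' "of_real w"])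
    show "convex S" by (simp add: S_def convex_halfspace_Re_gt)
    show "(f n has_field_derivative f' n s) (at s within S)" for n s
    proof -
      have "(f n has_field_derivative f' n s) (at s)"
      proof -
        have n0: "of_nat (Suc n) \<noteq> (0 :: complex)" by (simp del: of_nat_Suc)
        have m: "((\<lambda>s::complex. - s) has_field_derivative - 1) (at s)" by (auto intro!: derivative_eq_intros)
        show ?thesis
          using DERIV_chain2[OF has_field_derivative_powr_right[OF n0] m] unfolding f_def f'_def by simp
      qed
      then show ?thesis by (rule has_field_derivative_at_within)
    qed
    show "uniformly_convergent_on S (\<lambda>n s. \<Sum>i<n. f' i s)"
    proof (rule Weierstrass_m_test'_ev[OF always_eventually])
      show "summable (\<lambda>n. ln (real (Suc n)) * real (Suc n) powr (- c))" by (rule ln_powr_summable[OF c(1)])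
      show "\<forall>n. \<forall>s\<in>S. norm (f' n s) \<le> ln (real (Suc n)) * real (Suc n) powr (- c)"
      proof (intro allI ballI)
        fix n s assume s: "s \<in> S"
        have "ln (of_nat (Suc n)) = complex_of_real (ln (real (Suc n)))"
          using Ln_of_real[of "real (Suc n)"] by (simp del: of_nat_Suc)
        then have "norm (f' n s) = ln (real (Suc n)) * real (Suc n) powr (- Re s)"
          unfolding f'_def norm_minus_cancel norm_mult norm_Suc_powr by (simp only: norm_of_real) simp
        also have "\<dots> \<le> ln (real (Suc n)) * real (Suc n) powr (- c)"
          using s by (intro mult_left_mono powr_mono) (auto simp: S_def)
        finally show "norm (f' n s) \<le> ln (real (Suc n)) * real (Suc n) powr (- c)" .
      qed
    qed
    show "of_real w \<in> S" by fact
    show "summable (\<lambda>n. f n (of_real w))"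
      using zeta_series_sums[of "of_real w"] w by (auto simp: f_def sums_iff)
    show "of_real w \<in> interior S" using wS by (simp add: S_def interior_open open_Re_gt)
  qed
  moreover have "(\<Sum>n. f' n (of_real w)) = - of_real (\<Sum>n. ln (real (Suc n)) * real (Suc n) powr (- w))"
  proof -
    have "f' n (of_real w) = - of_real (ln (real (Suc n)) * real (Suc n) powr (- w))" for n
    proof -
      have "ln (of_nat (Suc n)) = complex_of_real (ln (real (Suc n)))"
        using Ln_of_real[of "real (Suc n)"] by (simp del: of_nat_Suc)
      moreover have "of_nat (Suc n) powr (- of_real w) = complex_of_real (real (Suc n) powr (- w))"
        using powr_of_real[of "real (Suc n)" "- w"] by (simp del: of_nat_Suc)
      ultimately show ?thesis unfolding f'_def by (simp only: of_real_mult)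
    qed
    moreover have "(\<lambda>n. - complex_of_real (ln (real (Suc n)) * real (Suc n) powr (- w))) sums
        - of_real (\<Sum>n. ln (real (Suc n)) * real (Suc n) powr (- w))"
      by (intro sums_minus sums_of_real summable_sums ln_powr_summable w)
    ultimately show ?thesis by (simp only: sums_iff)
  qed
  moreover have "eventually (\<lambda>s. zeta s = (\<Sum>n. f n s)) (nhds (of_real w))"
  proof -
    have "eventually (\<lambda>s. s \<in> S) (nhds (of_real w))"
      using wS by (intro eventually_nhds_in_open) (auto simp: S_def open_Re_gt)
    then show ?thesis
      by eventually_elim (use c in \<open>auto simp: S_def zeta_eq_series zeta_series_def f_def\<close>)
  qed
  ultimately show ?thesis by (subst DERIV_cong_ev[OF refl _ refl]) auto
qed

text \<open>\<open>ln n\<close> is the sum of \<open>mangoldt d\<close> over the divisors of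
  \<open>n\<close>. Exchanging the non-negative double sum leaves, for fixed \<open>d\<close>, the
  sum over the multiples of \<open>d\<close>, which contributes
  \<open>real d powr (- w) * Z\<close>.\<close>

lemma mangoldt_sums:
  fixes w :: real
  assumes w: "w > 1" and Z: "(\<lambda>n. real (Suc n) powr (- w)) sums Z"
  shows "(\<lambda>d. mangoldt d * real d powr (- w) * Z) sums (\<Sum>n. ln (real (Suc n)) * real (Suc n) powr (- w))"
proof (rule has_bochner_integral_count_space_nat, rule has_bochner_integral_sums_nonneg)
  let ?f = "\<lambda>n d. if d dvd Suc n then mangoldt d * real (Suc n) powr (- w) else 0"
  show "0 \<le> ?f n d" for n d by (simp add: mangoldt_nonneg)
  show "has_bochner_integral (count_space UNIV) (?f n) (ln (real (Suc n)) * real (Suc n) powr (- w))" for n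
  proof -
    have fin: "finite {d. d dvd Suc n}" by simp
    have "has_bochner_integral (count_space UNIV) (\<lambda>d. \<Sum>e | e dvd Suc n. (mangoldt e * real (Suc n) powr (- w)) * indicator {e} d)
        (\<Sum>e | e dvd Suc n. (mangoldt e * real (Suc n) powr (- w)) * measure (count_space UNIV) {e})"
      by (intro has_bochner_integral_sum has_bochner_integral_mult_right has_bochner_integral_real_indicator) auto
    moreover have "(\<Sum>e | e dvd Suc n. (mangoldt e * real (Suc n) powr (- w)) * indicator {e} d) = ?f n d" for d
      using fin by (simp add: indicator_def of_bool_def if_distrib sum.delta cong: if_cong)
    moreover have "(\<Sum>e | e dvd Suc n. (mangoldt e * real (Suc n) powr (- w)) * measure (count_space UNIV) {e}) =
        ln (real (Suc n)) * real (Suc n) powr (- w)"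
      using mangoldt_sum[of "Suc n", where 'a = real] by (simp add: measure_count_space sum_distrib_right[symmetric])
    ultimately show ?thesis by (simp only:)
  qed
  show "(\<lambda>n. ln (real (Suc n)) * real (Suc n) powr (- w)) sums (\<Sum>n. ln (real (Suc n)) * real (Suc n) powr (- w))"
    by (intro summable_sums ln_powr_summable w)
  show "(\<lambda>n. ?f n d) sums (mangoldt d * real d powr (- w) * Z)" for d
  proof (cases "d = 0")
    case False
    \<comment> \<open>The index of a term is one less than the integer it stands for, so
      \<open>g\<close> lists the indices of the multiples of \<open>d\<close>.\<close>
    define g where "g = (\<lambda>m. d * Suc m - 1)"
    have Sg: "Suc (g m) = d * Suc m" for m using False by (simp add: g_def)
    have "strict_mono g" unfolding strict_mono_def using False Sg by (metis Suc_less_eq Suc_mono mult_less_cancel1 neq0_conv)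
    moreover have "?f n d = 0" if "n \<notin> range g" for n
    proof -
      have "\<not> d dvd Suc n"
      proof
        assume "d dvd Suc n"
        then obtain k where k: "Suc n = d * k" by blast
        then obtain m where "k = Suc m" by (cases k) auto
        then have "n = g m" using k Sg[of m] by simp
        then show False using that by blast
      qed
      then show ?thesis by simp
    qed
    ultimately have "(\<lambda>m. ?f (g m) d) sums (mangoldt d * real d powr (- w) * Z) \<longleftrightarrow>
        (\<lambda>n. ?f n d) sums (mangoldt d * real d powr (- w) * Z)"
      by (rule sums_mono_reindex)
    moreover have "?f (g m) d = mangoldt d * real d powr (- w) * real (Suc m) powr (- w)" for m
    proof -
      have "real (d * Suc m) powr (- w) = real d powr (- w) * real (Suc m) powr (- w)"
        by (simp only: of_nat_mult powr_mult)
      then show ?thesis unfolding Sg by simp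
    qed
    ultimately show ?thesis using sums_mult[OF Z, of "mangoldt d * real d powr (- w)"] by simp
  qed simp
qed

lemma sum_odd_inverse_squares: "(\<lambda>n. 1 / (2 * real n + 1)\<^sup>2) sums (pi\<^sup>2 / 8)"
proof -
  define f where "f = (\<lambda>n. 1 / (real n + 1)\<^sup>2)"
  have f: "f sums (pi\<^sup>2 / 6)" using inverse_squares_sums by (simp add: f_def add.commute)
  have "(\<lambda>n. sum f {n * 2..<n * 2 + 2}) sums (pi\<^sup>2 / 6)"
    by (rule sums_group[OF f]) simp
  then have "(\<lambda>n. sum f {n * 2..<n * 2 + 2} - 1/4 * f n) sums (pi\<^sup>2 / 6 - 1/4 * (pi\<^sup>2 / 6))"
    by (intro sums_diff sums_mult f)
  moreover have "sum f {n * 2..<n * 2 + 2} - 1/4 * f n = 1 / (2 * real n + 1)\<^sup>2" for n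
  proof -
    have "{n * 2..<n * 2 + 2} = {2 * n, 2 * n + 1}" by auto
    moreover have "f (2 * n + 1) = 1/4 * f n"
    proof -
      have "real (2 * n + 1) + 1 = 2 * (real n + 1)" by simp
      then show ?thesis unfolding f_def by (simp only: power_mult_distrib) simp
    qed
    ultimately show ?thesis by (simp add: f_def)
  qed
  ultimately show ?thesis by simp
qed

lemma catalan_sums: "(\<lambda>n. (-1) ^ n / real (2 * n + 1) ^ 2) sums catalan"
proof -
  have "summable (\<lambda>n. 1 / (2 * real n + 1)\<^sup>2)" using sum_odd_inverse_squares by (rule sums_summable)
  then have "summable (\<lambda>n. (-1) ^ n / real (2 * n + 1) ^ 2)"
    by (rule summable_comparison_test'[where N = 0]) (simp add: norm_divide norm_power add.commute)
  then show ?thesis unfolding catalan_def by (rule summable_sums)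
qed

text \<open>The origin of the constant \<open>C\<close> in \<open>Psi\<close>: adding the
  alternating series of odd inverse squares to the plain one doubles the terms at
  \<open>4 n + 1\<close> and kills those at \<open>4 n + 3\<close>.\<close>

lemma trigamma_quarter_sums: "(\<lambda>n. 1 / (2 * real n + 1/2)\<^sup>2) sums (1/4 * (pi\<^sup>2 + 8 * catalan))"
proof -
  define b where "b = (\<lambda>n. 1 / (2 * real n + 1)\<^sup>2 + (-1) ^ n / real (2 * n + 1) ^ 2)"
  have "b sums (pi\<^sup>2 / 8 + catalan)"
    unfolding b_def by (intro sums_add sum_odd_inverse_squares catalan_sums)
  then have "(\<lambda>n. sum b {n * 2..<n * 2 + 2}) sums (pi\<^sup>2 / 8 + catalan)"
    by (rule sums_group) simp
  then have "(\<lambda>n. 2 * sum b {n * 2..<n * 2 + 2}) sums (2 * (pi\<^sup>2 / 8 + catalan))"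
    by (rule sums_mult)
  moreover have "2 * sum b {n * 2..<n * 2 + 2} = 1 / (2 * real n + 1/2)\<^sup>2" for n
  proof -
    have "{n * 2..<n * 2 + 2} = {2 * n, 2 * n + 1}" by auto
    then have "2 * sum b {n * 2..<n * 2 + 2} = 4 / (4 * real n + 1)\<^sup>2"
      by (simp add: b_def add.commute)
    also have "4 * real n + 1 = 2 * (2 * real n + 1/2)" by simp
    also have "4 / (2 * (2 * real n + 1/2))\<^sup>2 = 1 / (2 * real n + 1/2)\<^sup>2" by (simp only: power_mult_distrib) simp
    finally show ?thesis .
  qed
  ultimately show ?thesis by (simp add: algebra_simps)
qed

text \<open>The function \<open>F\<close> of the overview, one summand per factor of
  \<open>xi_formula\<close> at \<open>1/2 + s\<close>; the series over \<open>mangoldt\<close> is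
  \<open>- zeta' / zeta\<close>.\<close>

definition xi_log_deriv :: "real \<Rightarrow> real" where
  "xi_log_deriv s = 1 / (s - 1/2) + 1 / (s + 1/2) - ln pi / 2 + Digamma (1/4 + s/2) / 2
     - (\<Sum>d. mangoldt d * real d powr (- (1/2 + s)))"

text \<open>Derivatives in the form \<open>f z * a\<close> make logarithmic derivatives add up along
  a product.\<close>

lemma DERIV_log_mult:
  fixes f g :: "complex \<Rightarrow> complex"
  assumes "(f has_field_derivative f z * a) (at z)" "(g has_field_derivative g z * b) (at z)"
  shows "((\<lambda>x. f x * g x) has_field_derivative (f z * g z) * (a + b)) (at z)"
  by (rule DERIV_cong[OF DERIV_mult[OF assms]]) (simp add: algebra_simps)

lemma exp_minus_mult_le_one:
  fixes b t :: real
  shows "0 \<le> b \<Longrightarrow> 0 \<le> t \<Longrightarrow> exp (- b * t) \<le> 1"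
  by simp

lemma mangoldt_Dirichlet_series:
  fixes w :: real
  assumes w: "w > 1"
  obtains Z where "Z > 0" "zeta (of_real w) = of_real Z"
    "(\<lambda>d. mangoldt d * real d powr (- w)) sums ((\<Sum>n. ln (real (Suc n)) * real (Suc n) powr (- w)) / Z)"
proof -
  obtain Z where Z: "(\<lambda>n. real (Suc n) powr (- w)) sums Z" "zeta (of_real w) = of_real Z" "Z > 0"
    using zeta_of_real_sums[OF w] by blast
  have "(\<lambda>d. mangoldt d * real d powr (- w) * Z / Z) sums ((\<Sum>n. ln (real (Suc n)) * real (Suc n) powr (- w)) / Z)"
    by (intro sums_divide mangoldt_sums w Z(1))
  then show ?thesis using that[of Z] Z by simp
qed

lemma xi_log_derivative:
  assumes s: "s > 1/2"
  shows "xi (1/2 + of_real s) \<noteq> 0"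
    and "(xi has_field_derivative xi (1/2 + of_real s) * of_real (xi_log_deriv s)) (at (1/2 + of_real s))"
proof -
  define w where "w = 1/2 + s"
  define z where "z = complex_of_real w"
  have w: "w > 1" using s by (simp add: w_def)
  have zw: "1/2 + complex_of_real s = z" by (simp add: z_def w_def)
  obtain Z where Z: "Z > 0" "zeta (of_real w) = of_real Z"
    "(\<lambda>d. mangoldt d * real d powr (- w)) sums ((\<Sum>n. ln (real (Suc n)) * real (Suc n) powr (- w)) / Z)"
    using mangoldt_Dirichlet_series[OF w] by blast
  define L where "L = (\<Sum>d. mangoldt d * real d powr (- w))"
  have L: "(\<Sum>n. ln (real (Suc n)) * real (Suc n) powr (- w)) = L * Z"
    using Z(1,3) by (simp add: L_def sums_iff field_simps)
  have nI: "u / 2 \<notin> \<int>\<^sub>\<le>\<^sub>0" if "Re u > 0" for u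
    using that by (intro Re_pos_notin_nonpos_Ints) simp
  have z0: "Re z > 0" "z \<noteq> 0" "z \<noteq> 1" using w by (auto simp: z_def)
  have xiz: "xi z = xi_formula z" using z0 nI by (intro xi_eq_formula) auto
  have "Gamma (z/2) \<noteq> 0" using nI[OF z0(1)] by (simp add: Gamma_eq_zero_iff)
  moreover have "zeta z \<noteq> 0" using Z by (simp add: z_def)
  ultimately show "xi (1/2 + of_real s) \<noteq> 0"
    unfolding zw xiz xi_formula_def using z0 by simp
  have d1: "((\<lambda>s::complex. 1/2 * s) has_field_derivative (1/2 * z) * (1 / z)) (at z)"
    using z0 by (auto intro!: derivative_eq_intros)
  have d2: "((\<lambda>s::complex. s - 1) has_field_derivative (z - 1) * (1 / (z - 1))) (at z)"
    using z0 by (auto intro!: derivative_eq_intros)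
  have d3: "((\<lambda>s. of_real pi powr (- s/2) :: complex) has_field_derivative (of_real pi powr (- z/2)) * of_real (- ln pi / 2)) (at z)"
  proof -
    have m: "((\<lambda>s::complex. - s / 2) has_field_derivative - 1 / 2) (at z)" by (auto intro!: derivative_eq_intros)
    have p0: "complex_of_real pi \<noteq> 0" by simp
    have "Ln (complex_of_real pi) = of_real (ln pi)" by (rule Ln_of_real) simp
    then show ?thesis
      using DERIV_chain2[OF has_field_derivative_powr_right[OF p0] m] by (simp add: mult.commute)
  qed
  have d4: "((\<lambda>s::complex. Gamma (s/2)) has_field_derivative Gamma (z/2) * (Digamma (z/2) / 2)) (at z)"
  proof -
    have m: "((\<lambda>s::complex. s / 2) has_field_derivative 1 / 2) (at z)" by (auto intro!: derivative_eq_intros)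
    show ?thesis
      using DERIV_chain2[OF has_field_derivative_Gamma[OF nI[OF z0(1)]] m] by simp
  qed
  have d5: "(zeta has_field_derivative zeta z * (- of_real L)) (at z)"
    using has_field_derivative_zeta[OF w] unfolding L z_def Z(2) by (simp add: mult.commute)
  have "(xi_formula has_field_derivative xi_formula z *
      (1 / z + 1 / (z - 1) + of_real (- ln pi / 2) + Digamma (z/2) / 2 + - of_real L)) (at z)"
    unfolding xi_formula_def[abs_def] by (intro DERIV_log_mult d1 d2 d3 d4 d5)
  moreover have "eventually (\<lambda>u. xi u = xi_formula u) (nhds z)"
  proof -
    have "eventually (\<lambda>u. u \<in> {u. Re u > 1}) (nhds z)"
      using w by (intro eventually_nhds_in_open open_Re_gt) (simp add: z_def)
    then show ?thesis by eventually_elim (use nI in \<open>auto intro!: xi_eq_formula\<close>)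
  qed
  ultimately have "(xi has_field_derivative xi z *
      (1 / z + 1 / (z - 1) + of_real (- ln pi / 2) + Digamma (z/2) / 2 + - of_real L)) (at z)"
    unfolding xiz by (subst DERIV_cong_ev[OF refl _ refl])
  moreover have "1 / z + 1 / (z - 1) + of_real (- ln pi / 2) + Digamma (z/2) / 2 + - of_real L = of_real (xi_log_deriv s)"
  proof -
    have "z / 2 = of_real (1/4 + s/2)" by (simp add: z_def w_def)
    then have "Digamma (z / 2) = of_real (Digamma (1/4 + s/2))" using s by (simp only: Polygamma_of_real)
    then show ?thesis
      unfolding xi_log_deriv_def L_def w_def[symmetric]
      by (simp add: z_def w_def algebra_simps)
  qed
  ultimately show "(xi has_field_derivative xi (1/2 + of_real s) * of_real (xi_log_deriv s)) (at (1/2 + of_real s))"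
    unfolding zw by simp
qed

text \<open>The constant \<open>pi^2 + 8 * catalan\<close> is the Lerch sum at \<open>t = 0\<close>.
  Subtracting termwise exhibits the last part of \<open>Psi\<close> as a series of the non-negative
  functions \<open>(1 - exp (- b * t)) / b^2\<close> with \<open>b = 2 * n + 1/2\<close>.\<close>

lemma lerch_part_sums:
  assumes t: "t \<ge> 0"
  shows "(\<lambda>n. 1 / (2 * real n + 1/2)\<^sup>2 * (1 - exp (- (2 * real n + 1/2) * t))) sums
    (1/4 * ((pi\<^sup>2 + 8 * catalan) - exp (- t/2) * lerch_phi (exp (- 2*t)) 2 (1/4)))"
proof -
  have e: "(real n + 1/4) powr (- 2) = 4 * (1 / (2 * real n + 1/2)\<^sup>2)" for n
  proof -
    have q: "real n + 1/4 = (2 * real n + 1/2) / 2" by simp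
    have "(real n + 1/4) powr (- 2) = 1 / (real n + 1/4)\<^sup>2" by (simp add: powr_minus inverse_eq_divide)
    also have "\<dots> = 4 * (1 / (2 * real n + 1/2)\<^sup>2)" unfolding q by (simp only: power_divide) simp
    finally show ?thesis .
  qed
  have sm: "summable (\<lambda>n. (real n + 1/4) powr (- 2) * exp (- 2*t) ^ n)"
  proof (rule summable_comparison_test')
    show "summable (\<lambda>n. 4 * (1 / (2 * real n + 1/2)\<^sup>2))"
      using trigamma_quarter_sums by (intro summable_mult) (rule sums_summable)
    show "norm ((real n + 1/4) powr (- 2) * exp (- 2*t) ^ n) \<le> 4 * (1 / (2 * real n + 1/2)\<^sup>2)" for n
      unfolding e[symmetric] using t by (simp add: mult_left_le power_le_one)
  qed
  have "(\<lambda>n. 1 / (2 * real n + 1/2)\<^sup>2 - 1/4 * (exp (- t/2) * ((real n + 1/4) powr (- 2) * exp (- 2*t) ^ n))) sums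
     (1/4 * (pi\<^sup>2 + 8 * catalan) - 1/4 * (exp (- t/2) * lerch_phi (exp (- 2*t)) 2 (1/4)))"
    unfolding lerch_phi_def by (intro sums_diff sums_mult trigamma_quarter_sums summable_sums sm)
  moreover have "1 / (2 * real n + 1/2)\<^sup>2 - 1/4 * (exp (- t/2) * ((real n + 1/4) powr (- 2) * exp (- 2*t) ^ n)) =
     1 / (2 * real n + 1/2)\<^sup>2 * (1 - exp (- (2 * real n + 1/2) * t))" for n
  proof -
    have "exp (- t/2) * exp (- 2*t) ^ n = exp (- (2 * real n + 1/2) * t)"
      by (simp add: exp_of_nat_mult[symmetric] exp_add[symmetric] algebra_simps)
    then have "1/4 * (exp (- t/2) * ((real n + 1/4) powr (- 2) * exp (- 2*t) ^ n)) = 1/4 * (real n + 1/4) powr (- 2) * exp (- (2 * real n + 1/2) * t)"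
      by (simp add: mult_ac)
    then show ?thesis unfolding e by (simp add: right_diff_distrib)
  qed
  ultimately show ?thesis by (simp add: right_diff_distrib)
qed

text \<open>The transform of the term with \<open>b = 2 * n + 1/2\<close> equals
  \<open>(1 / b - 1 / (b + s)) / s^2\<close>, and \<open>1 / b - 1 / (b + s)\<close> is half the
  difference of the terms of two Digamma series.\<close>

lemma has_laplace_lerch_part:
  assumes s: "s > 0"
  shows "has_laplace (\<lambda>t. 1/4 * ((pi\<^sup>2 + 8 * catalan) - exp (- t/2) * lerch_phi (exp (- 2*t)) 2 (1/4))) s
    ((Digamma (1/4 + s/2) - Digamma (1/4)) / 2 / s\<^sup>2)"
proof (rule has_laplace_sums)
  let ?b = "\<lambda>n. 2 * real n + 1/2"
  show "0 \<le> 1 / (?b n)\<^sup>2 * (1 - exp (- ?b n * t))" if "t \<ge> 0" for n t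
    using exp_minus_mult_le_one[of "?b n" t] that by (intro mult_nonneg_nonneg) (simp, linarith)
  show "has_laplace (\<lambda>t. 1 / (?b n)\<^sup>2 * (1 - exp (- ?b n * t))) s (1 / (?b n)\<^sup>2 * (1 / s - 1 / (s - - ?b n)))" for n
    by (intro has_laplace_cmult has_laplace_diff has_laplace_one has_laplace_exp s) (use s in linarith)
  show "(\<lambda>n. 1 / (?b n)\<^sup>2 * (1 - exp (- ?b n * t))) sums
    (1/4 * ((pi\<^sup>2 + 8 * catalan) - exp (- t/2) * lerch_phi (exp (- 2*t)) 2 (1/4)))" if "t \<ge> 0" for t
    by (rule lerch_part_sums[OF that])
  have dig: "(\<lambda>n. inverse (real (Suc n)) - inverse (x + real n)) sums (Digamma x + euler_mascheroni)"
    if "x \<noteq> 0" for x :: real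
    using summable_sums[OF summable_Digamma[OF that]] by (simp add: Digamma_def)
  have "(\<lambda>n. ((inverse (real (Suc n)) - inverse ((1/4 + s/2) + real n)) - (inverse (real (Suc n)) - inverse (1/4 + real n))) / 2 / s\<^sup>2) sums
    (((Digamma (1/4 + s/2) + euler_mascheroni) - (Digamma (1/4) + euler_mascheroni)) / 2 / s\<^sup>2)"
    by (intro sums_divide sums_diff dig) (use s in auto)
  moreover have "((inverse (real (Suc n)) - inverse ((1/4 + s/2) + real n)) - (inverse (real (Suc n)) - inverse (1/4 + real n))) / 2 / s\<^sup>2
     = 1 / (?b n)\<^sup>2 * (1 / s - 1 / (s - - ?b n))" for n
  proof -
    define b where "b = ?b n"
    have b: "b > 0" by (simp add: b_def)
    have 1: "1/4 + real n = b / 2" "(1/4 + s/2) + real n = (b + s) / 2" by (simp_all add: b_def add_divide_distrib)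
    have "(inverse (b / 2) - inverse ((b + s) / 2)) / 2 / s\<^sup>2 = 1 / b\<^sup>2 * (1 / s - 1 / (s + b))"
    proof -
      have "inverse (b / 2) - inverse ((b + s) / 2) = 2 * s / (b * (b + s))" using b s by (simp add: field_simps)
      moreover have "1 / s - 1 / (s + b) = b / (s * (b + s))" using b s by (simp add: field_simps)
      ultimately show ?thesis using b s by (simp add: power2_eq_square)
    qed
    then show ?thesis unfolding 1 by (simp add: b_def)
  qed
  ultimately show "(\<lambda>n. 1 / (?b n)\<^sup>2 * (1 / s - 1 / (s - - ?b n))) sums ((Digamma (1/4 + s/2) - Digamma (1/4)) / 2 / s\<^sup>2)"
    by simp
qed

definition prime_part :: "real \<Rightarrow> real" where
  "prime_part t = (\<Sum>n | 1 \<le> n \<and> real n \<le> exp t. mangoldt n / sqrt (real n) * (t - ln (real n)))"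

text \<open>The range of summation in \<open>prime_part\<close> moves with \<open>t\<close>.
  Positive parts allow any fixed longer range, which makes continuity and the Laplace transform
  visible term by term.\<close>

lemma prime_part_eq:
  assumes N: "exp t \<le> real N"
  shows "prime_part t = (\<Sum>n\<le>N. mangoldt n / sqrt (real n) * max 0 (t - ln (real n)))"
  unfolding prime_part_def
proof (rule sum.mono_neutral_cong_left)
  show "{n. 1 \<le> n \<and> real n \<le> exp t} \<subseteq> {..N}" using N by auto
  show "\<forall>n\<in>{..N} - {n. 1 \<le> n \<and> real n \<le> exp t}. mangoldt n / sqrt (real n) * max 0 (t - ln (real n)) = 0"
  proof
    fix n assume n: "n \<in> {..N} - {n. 1 \<le> n \<and> real n \<le> exp t}"
    show "mangoldt n / sqrt (real n) * max 0 (t - ln (real n)) = 0"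
    proof (cases "n = 0")
      case False
      then have "exp t < real n" using n by auto
      then have "t < ln (real n)" using False by (metis exp_less_cancel_iff exp_ln of_nat_0_less_iff neq0_conv)
      then show ?thesis by simp
    qed simp
  qed
  show "mangoldt n / sqrt (real n) * (t - ln (real n)) = mangoldt n / sqrt (real n) * max 0 (t - ln (real n))"
    if "n \<in> {n. 1 \<le> n \<and> real n \<le> exp t}" for n
  proof -
    have "ln (real n) \<le> t" using that by (metis (mono_tags, lifting) exp_gt_zero ln_exp ln_le_cancel_iff mem_Collect_eq of_nat_0_less_iff less_le_trans zero_less_one)
    then show ?thesis by simp
  qed
qed simp

lemma has_laplace_prime_part:
  assumes s: "s > 1/2"
  shows "has_laplace prime_part s ((\<Sum>d. mangoldt d * real d powr (- (1/2 + s))) / s\<^sup>2)"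
proof (rule has_laplace_sums)
  let ?f = "\<lambda>n t. mangoldt n / sqrt (real n) * max 0 (t - ln (real n)) :: real"
  show "0 \<le> ?f n t" for n t by (simp add: mangoldt_nonneg)
  show "has_laplace (?f n) s (mangoldt n * real n powr (- (1/2 + s)) / s\<^sup>2)" for n
  proof (cases "n = 0")
    case True
    then show ?thesis using has_laplace_cmult[OF has_laplace_one[of s], of 0] s by simp
  next
    case False
    have "has_laplace (?f n) s (mangoldt n / sqrt (real n) * (exp (- s * ln (real n)) / s\<^sup>2))"
      by (intro has_laplace_cmult has_laplace_shifted_ramp) (use s False in auto)
    moreover have "mangoldt n / sqrt (real n) * (exp (- s * ln (real n)) / s\<^sup>2) = mangoldt n * real n powr (- (1/2 + s)) / s\<^sup>2"
    proof -
      have 1: "exp (- s * ln (real n)) = real n powr (- s)" using False by (simp add: powr_def)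
      have 2: "1 / sqrt (real n) = real n powr (- (1/2))"
        using False by (simp add: powr_minus powr_half_sqrt inverse_eq_divide)
      have 3: "real n powr (- (1/2)) * real n powr (- s) = real n powr (- (1/2 + s))"
        by (simp only: powr_add[symmetric]) simp
      have "mangoldt n / sqrt (real n) * (exp (- s * ln (real n)) / s\<^sup>2) =
          mangoldt n * (1 / sqrt (real n) * exp (- s * ln (real n))) / s\<^sup>2" by simp
      then show ?thesis unfolding 1 2 3 .
    qed
    ultimately show ?thesis by simp
  qed
  have w: "1/2 + s > 1" using s by simp
  obtain X where "(\<lambda>d. mangoldt d * real d powr (- (1/2 + s))) sums X"
    by (rule mangoldt_Dirichlet_series[OF w]) (rule that)
  then show "(\<lambda>n. mangoldt n * real n powr (- (1/2 + s)) / s\<^sup>2) sums ((\<Sum>d. mangoldt d * real d powr (- (1/2 + s))) / s\<^sup>2)"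
    by (intro sums_divide summable_sums) (rule sums_summable)
  show "(\<lambda>n. ?f n t) sums prime_part t" if "t \<ge> 0" for t
  proof -
    define N where "N = nat \<lceil>exp t\<rceil>"
    have N: "exp t \<le> real N" unfolding N_def by linarith
    have "?f n t = 0" if "n \<notin> {..N}" for n
    proof -
      have "exp t < real n" using that N by auto
      then have "t < ln (real n)" by (metis exp_gt_zero exp_less_cancel_iff exp_ln less_trans)
      then show ?thesis by simp
    qed
    then have "(\<lambda>n. ?f n t) sums (\<Sum>n\<le>N. ?f n t)" by (intro sums_finite) auto
    then show ?thesis by (simp add: prime_part_eq[OF N])
  qed
qed

lemma Psi_eq:
  assumes "t \<ge> 0"
  shows "Psi t = 4 * (exp (1/2 * t) + exp (- 1/2 * t) - 2 * 1) - prime_part t + (Digamma (1/4) - ln pi) / 2 * t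
     + 1/4 * ((pi\<^sup>2 + 8 * catalan) - exp (- t/2) * lerch_phi (exp (- 2*t)) 2 (1/4))"
  using assms by (simp add: Psi_def Psi_nonneg_def prime_part_def)

theorem has_laplace_Psi:
  assumes s: "s > 1/2"
  shows "has_laplace Psi s (xi_log_deriv s / s\<^sup>2)"
proof -
  define L where "L = (\<Sum>d. mangoldt d * real d powr (- (1/2 + s)) :: real)"
  define D where "D = (Digamma (1/4 + s/2) :: real)"
  define D0 where "D0 = (Digamma (1/4) :: real)"
  define l where "l = ln pi"
  have "has_laplace (\<lambda>t. 4 * (exp (1/2 * t) + exp (- 1/2 * t) - 2 * 1) - prime_part t + (D0 - l) / 2 * t
     + 1/4 * ((pi\<^sup>2 + 8 * catalan) - exp (- t/2) * lerch_phi (exp (- 2*t)) 2 (1/4))) s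
     (4 * (1 / (s - 1/2) + 1 / (s - - 1/2) - 2 * (1 / s)) - L / s\<^sup>2 + (D0 - l) / 2 * (1 / s\<^sup>2)
     + (D - D0) / 2 / s\<^sup>2)"
    unfolding L_def D_def D0_def l_def
    by (intro has_laplace_add has_laplace_diff has_laplace_cmult has_laplace_exp has_laplace_one
        has_laplace_id has_laplace_prime_part has_laplace_lerch_part) (use s in auto)
  then have "has_laplace Psi s (4 * (1 / (s - 1/2) + 1 / (s - - 1/2) - 2 * (1 / s)) - L / s\<^sup>2 + (D0 - l) / 2 * (1 / s\<^sup>2)
     + (D - D0) / 2 / s\<^sup>2)"
    by (subst has_laplace_cong[where g = "\<lambda>t. 4 * (exp (1/2 * t) + exp (- 1/2 * t) - 2 * 1) - prime_part t + (D0 - l) / 2 * t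
     + 1/4 * ((pi\<^sup>2 + 8 * catalan) - exp (- t/2) * lerch_phi (exp (- 2*t)) 2 (1/4))"])
       (auto simp: Psi_eq D0_def l_def)
  \<comment> \<open>The coefficients 4 and -2 in \<open>Psi\<close> are tuned to this identity: the
    exponentials then account exactly for the factors \<open>s\<close> and \<open>s - 1\<close> of
    \<open>xi_formula\<close>.\<close>
  moreover have "4 * (1 / (s - 1/2) + 1 / (s - - 1/2) - 2 * (1 / s)) = (1 / (s - 1/2) + 1 / (s + 1/2)) / s\<^sup>2"
  proof -
    have "s - 1/2 \<noteq> 0" "s + 1/2 \<noteq> 0" "s \<noteq> 0" using s by auto
    then show ?thesis by (simp add: divide_simps) (simp add: algebra_simps power2_eq_square)
  qed
  ultimately have "has_laplace Psi s ((1 / (s - 1/2) + 1 / (s + 1/2)) / s\<^sup>2 - L / s\<^sup>2 + (D0 - l) / 2 * (1 / s\<^sup>2)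
     + (D - D0) / 2 / s\<^sup>2)" by simp
  \<comment> \<open>The \<open>Digamma (1/4)\<close> in the linear term of \<open>Psi\<close>
    cancels the one left over from the Lerch part.\<close>
  also have "(1 / (s - 1/2) + 1 / (s + 1/2)) / s\<^sup>2 - L / s\<^sup>2 + (D0 - l) / 2 * (1 / s\<^sup>2) + (D - D0) / 2 / s\<^sup>2
     = xi_log_deriv s / s\<^sup>2"
    unfolding xi_log_deriv_def L_def[symmetric] D_def[symmetric] l_def[symmetric]
    by (simp add: add_divide_distrib diff_divide_distrib)
  finally show ?thesis .
qed

lemma continuous_on_prime_part: "continuous_on UNIV prime_part"
proof -
  have "continuous_on (\<Union>T\<in>UNIV. {..<T}) prime_part"
  proof (rule continuous_on_open_UN)
    fix T :: real
    define N where "N = nat \<lceil>exp T\<rceil>"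
    have "exp t \<le> real N" if "t < T" for t
      using that exp_less_cancel_iff[of t T] unfolding N_def by linarith
    then have "prime_part t = (\<Sum>n\<le>N. mangoldt n / sqrt (real n) * max 0 (t - ln (real n)))" if "t \<in> {..<T}" for t
      using that by (intro prime_part_eq) auto
    moreover have "continuous_on {..<T} (\<lambda>t. \<Sum>n\<le>N. mangoldt n / sqrt (real n) * max 0 (t - ln (real n)))"
      by (intro continuous_intros)
    ultimately show "continuous_on {..<T} prime_part" by (auto intro: continuous_on_eq)
  qed auto
  moreover have "(\<Union>T\<in>UNIV. {..<T::real}) = UNIV" using gt_ex by auto
  ultimately show ?thesis by simp
qed

lemma continuous_on_Psi_nonneg: "continuous_on {0..} Psi"
proof -
  define R where "R = (\<lambda>t. 1/4 * ((pi\<^sup>2 + 8 * catalan) - exp (- t/2) * lerch_phi (exp (- 2*t)) 2 (1/4)))"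
  let ?f = "\<lambda>n t. 1 / (2 * real n + 1/2)\<^sup>2 * (1 - exp (- (2 * real n + 1/2) * t))"
  have "uniform_limit {0..} (\<lambda>N t. \<Sum>n<N. ?f n t) (\<lambda>t. \<Sum>n. ?f n t) sequentially"
  proof (rule Weierstrass_m_test)
    show "summable (\<lambda>n. 1 / (2 * real n + 1/2)\<^sup>2)" using trigamma_quarter_sums by (rule sums_summable)
    show "norm (?f n t) \<le> 1 / (2 * real n + 1/2)\<^sup>2" if "t \<in> {0..}" for n t
    proof -
      have "\<bar>1 - exp (- (2 * real n + 1/2) * t)\<bar> \<le> 1"
      proof -
        have "exp (- (2 * real n + 1/2) * t) \<le> 1"
          by (rule exp_minus_mult_le_one) (use that in auto)
        moreover have "exp (- (2 * real n + 1/2) * t) \<ge> 0" by (rule exp_ge_zero)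
        ultimately show ?thesis by (intro abs_leI) linarith+
      qed
      then have "1 / (2 * real n + 1/2)\<^sup>2 * \<bar>1 - exp (- (2 * real n + 1/2) * t)\<bar> \<le> 1 / (2 * real n + 1/2)\<^sup>2"
        by (rule mult_left_le) simp
      then show ?thesis by (simp only: real_norm_def abs_mult) simp
    qed
  qed
  then have "continuous_on {0..} (\<lambda>t. \<Sum>n. ?f n t)"
    by (rule uniform_limit_theorem[rotated]) (auto intro!: always_eventually continuous_intros)
  moreover have "(\<Sum>n. ?f n t) = R t" if "t \<in> {0..}" for t
    using lerch_part_sums[of t] that unfolding R_def by (simp only: sums_iff atLeast_iff)
  ultimately have Rc: "continuous_on {0..} R" by (auto intro: continuous_on_eq)
  have "continuous_on {0..} (\<lambda>t. 4 * (exp (1/2 * t) + exp (- 1/2 * t) - 2 * 1) - prime_part t + (Digamma (1/4) - ln pi) / 2 * t + R t)"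
    by (intro continuous_intros Rc continuous_on_subset[OF continuous_on_prime_part]) auto
  then show ?thesis
    by (rule continuous_on_eq) (simp add: Psi_eq R_def)
qed

lemma Psi_even: "Psi (- t) = Psi t"
  by (simp add: Psi_def)

lemma continuous_on_Psi: "continuous_on UNIV Psi"
proof -
  have "continuous_on UNIV (\<lambda>t. Psi \<bar>t\<bar>)"
    by (rule continuous_on_compose2[OF continuous_on_Psi_nonneg]) (auto intro!: continuous_intros)
  then show ?thesis by (simp add: Psi_def)
qed

section \<open>From screw functions to the Riemann hypothesis\<close>

text \<open>Halving \<open>t\<close> until it drops below 1 costs a factor 4 each time, the same
  factor by which \<open>t^2\<close> shrinks.\<close>

lemma quadratic_growth_of_doubling:
  fixes D :: "real \<Rightarrow> real"
  assumes B: "\<And>t. 0 \<le> t \<Longrightarrow> t \<le> 1 \<Longrightarrow> D t \<le> B" "B \<ge> 0"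
    and dbl: "\<And>t. D (2 * t) \<le> 4 * D t" and t: "t \<ge> 0"
  shows "D t \<le> B + 4 * B * t\<^sup>2"
proof -
  have big: "D t \<le> 4 * B * t\<^sup>2" if "1 < t" "t \<le> 2 ^ k" for t k
    using that
  proof (induction k arbitrary: t)
    case (Suc k)
    have d: "D t \<le> 4 * D (t / 2)" using dbl[of "t / 2"] by simp
    show ?case
    proof (cases "t / 2 \<le> 1")
      case True
      then have "D (t / 2) \<le> B" using Suc.prems by (intro B) auto
      moreover have "B * 1 \<le> B * t\<^sup>2" using B(2) Suc.prems by (intro mult_left_mono) auto
      ultimately show ?thesis using d by linarith
    next
      case False
      then have "D (t / 2) \<le> 4 * B * (t / 2)\<^sup>2" using Suc.prems by (intro Suc.IH) auto
      then show ?thesis using d by (simp add: power_divide)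
    qed
  qed simp
  show ?thesis
  proof (cases "t \<le> 1")
    case True
    then have "D t \<le> B" using t by (intro B)
    then show ?thesis using B(2) by (simp add: add_increasing2)
  next
    case False
    obtain k where "t < 2 ^ k" using real_arch_pow[of 2 t] by auto
    then have "D t \<le> 4 * B * t\<^sup>2" using False by (intro big[of t k]) auto
    then show ?thesis using B(2) by simp
  qed
qed

lemma screw_class_Psi_growth:
  assumes "(\<lambda>t. complex_of_real (- Psi t)) \<in> screw_class \<infinity>"
  obtains A where "\<And>t. t \<ge> 0 \<Longrightarrow> \<bar>Psi t\<bar> \<le> A * (1 + t\<^sup>2)"
proof -
  let ?g = "\<lambda>t. complex_of_real (- Psi t)"
  have pd: "(\<Sum>i<n. \<Sum>j<n. screw_kernel ?g (t i) (t j) * \<xi> i * cnj (\<xi> j)) \<in> \<real>\<^sub>\<ge>\<^sub>0"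
    for n :: nat and t :: "nat \<Rightarrow> real" and \<xi> :: "nat \<Rightarrow> complex"
    using assms unfolding screw_class_def by simp
  define D where "D = (\<lambda>t. Psi t - Psi 0)"
  \<comment> \<open>A single point \<open>t\<close> with weight 1: the kernel there is
    \<open>2 * D t\<close>.\<close>
  have nn: "D t \<ge> 0" for t
    using pd[of "\<lambda>_. t" "\<lambda>_. 1" 1] by (simp add: screw_kernel_def Psi_even complex_nonneg_Reals_iff D_def)
  \<comment> \<open>Points \<open>t\<close> and \<open>- t\<close> with weights 1: the diagonal
    entries are \<open>2 * D t\<close>, the off-diagonal ones \<open>2 * D t - D (2 * t)\<close>, so
    \<open>8 * D t - 2 * D (2 * t)\<close> is non-negative.\<close>
  have dbl: "D (2 * t) \<le> 4 * D t" for t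
    using pd[of "\<lambda>i. if i = 0 then t else - t" "\<lambda>_. 1" 2]
    by (simp add: screw_kernel_def Psi_even complex_nonneg_Reals_iff D_def numeral_2_eq_2 Psi_even[of "t + t", simplified]
         flip: mult_2)
  have "compact (Psi ` {0..1})"
    by (intro compact_continuous_image continuous_on_subset[OF continuous_on_Psi]) auto
  from compact_imp_bounded[OF this] obtain B0 where "\<And>y. y \<in> Psi ` {0..1} \<Longrightarrow> norm y \<le> B0"
    unfolding bounded_iff by blast
  then have B0: "\<bar>Psi t\<bar> \<le> B0" if "t \<in> {0..1}" for t using that by auto
  define B where "B = 2 * B0"
  have "B0 \<ge> 0" using B0[of 0] by auto
  then have B: "B \<ge> 0" by (simp add: B_def)
  have DB: "D t \<le> B" if "0 \<le> t" "t \<le> 1" for t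
    using B0[of t] B0[of 0] that by (auto simp: D_def B_def)
  have "\<bar>Psi t\<bar> \<le> (B0 + 4 * B) * (1 + t\<^sup>2)" if t: "t \<ge> 0" for t
  proof -
    have "D t \<le> B + 4 * B * t\<^sup>2" by (rule quadratic_growth_of_doubling[where D = D and B = B, OF DB B dbl t])
    moreover have "\<bar>Psi t\<bar> \<le> B0 + D t" using nn[of t] B0[of 0] by (auto simp: D_def)
    moreover have "B0 * t\<^sup>2 \<ge> 0" "B * t\<^sup>2 \<ge> 0" using \<open>B0 \<ge> 0\<close> B by auto
    ultimately show ?thesis using B by (simp add: algebra_simps)
  qed
  then show ?thesis using that by blast
qed

text \<open>The quotient \<open>xi' / xi\<close> cannot be used before zeros are excluded. Instead
  the division-free form \<open>E' = s^2 * T * E\<close> is continued from a real segment, with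
  \<open>T\<close> the Laplace transform of \<open>Psi\<close>, holomorphic for
  \<open>Re s > 0\<close> by the growth bound.\<close>

lemma xi_nonzero_right_half_plane:
  assumes A: "\<And>t. t \<ge> 0 \<Longrightarrow> \<bar>Psi t\<bar> \<le> A * (1 + t\<^sup>2)" and s0: "Re s0 > 0"
  shows "xi (1/2 + s0) \<noteq> 0"
proof -
  define S where "S = {s::complex. Re s > 0}"
  have oS: "open S" and cS: "convex S" by (auto simp: S_def open_Re_gt convex_halfspace_Re_gt)
  have [measurable]: "Psi \<in> borel_measurable borel"
    using continuous_on_Psi by (rule borel_measurable_continuous_onI)
  define \<phi> where "\<phi> = (\<lambda>t. complex_of_real (indicator {0..} t * Psi t))"
  define T where "T = (\<lambda>s. \<integral>t. \<phi> t * exp (s * of_real (- t)) \<partial>lborel)"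
  have Thol: "T holomorphic_on S"
    unfolding T_def
  proof (rule holomorphic_on_exp_integral)
    fix s assume "s \<in> S"
    then have s: "Re s > 0" by (simp add: S_def)
    have "has_laplace (\<lambda>t. A * (1 + t\<^sup>2)) (Re s) (A * (1 / Re s + 2 / Re s ^ 3))"
      by (intro has_laplace_cmult has_laplace_add has_laplace_one has_laplace_square s)
    then have "integrable lborel (\<lambda>t. indicator {0..} t * (A * (1 + t\<^sup>2) * exp (- Re s * t)))"
      by (simp add: has_laplace_def has_bochner_integral_iff)
    then show "integrable lborel (\<lambda>t. \<phi> t * exp (s * of_real (- t)))"
    proof (rule Bochner_Integration.integrable_bound)
      show "(\<lambda>t. \<phi> t * exp (s * of_real (- t))) \<in> borel_measurable lborel"
        unfolding \<phi>_def by measurable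
      have "norm (\<phi> t * exp (s * of_real (- t))) \<le> norm (indicator {0..} t * (A * (1 + t\<^sup>2) * exp (- Re s * t)))" for t
      proof (cases "t \<ge> 0")
        case True
        have "\<bar>Psi t\<bar> * exp (- Re s * t) \<le> A * (1 + t\<^sup>2) * exp (- Re s * t)"
          using A[OF True] by (rule mult_right_mono) simp
        also have "\<dots> \<le> \<bar>A * (1 + t\<^sup>2) * exp (- Re s * t)\<bar>" by simp
        finally show ?thesis using True by (simp add: \<phi>_def norm_mult)
      qed (simp add: \<phi>_def)
      then show "AE t in lborel. norm (\<phi> t * exp (s * of_real (- t))) \<le> norm (indicator {0..} t * (A * (1 + t\<^sup>2) * exp (- Re s * t)))"
        by simp
    qed
  next
    show "\<phi> \<in> borel_measurable lborel" unfolding \<phi>_def by measurable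
  qed (auto simp: oS)
  have Treal: "T (of_real s) = of_real (xi_log_deriv s / s\<^sup>2)" if s: "s > 1/2" for s
  proof -
    have "\<phi> t * exp (of_real s * of_real (- t)) = complex_of_real (indicator {0..} t * (Psi t * exp (- s * t)))" for t
      by (simp add: \<phi>_def exp_of_real[symmetric])
    moreover have "(\<integral>t. indicator {0..} t * (Psi t * exp (- s * t)) \<partial>lborel) = xi_log_deriv s / s\<^sup>2"
      using has_laplace_Psi[OF s] by (simp add: has_laplace_def has_bochner_integral_iff)
    ultimately show ?thesis unfolding T_def by (simp only: integral_complex_of_real)
  qed
  define E where "E = (\<lambda>s. xi (1/2 + s))"
  have Ehol: "E holomorphic_on UNIV"
    unfolding E_def by (rule holomorphic_on_compose_gen[OF _ xi_holomorphic, unfolded o_def]) (auto intro!: holomorphic_intros)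
  have Ed: "(E has_field_derivative deriv E s) (at s)" for s
    using Ehol holomorphic_derivI by blast
  have Edr: "deriv E (of_real s) = E (of_real s) * of_real (xi_log_deriv s)" if s: "s > 1/2" for s
  proof (rule DERIV_imp_deriv)
    have "((\<lambda>s::complex. 1/2 + s) has_field_derivative 1) (at (of_real s))" by (auto intro!: derivative_eq_intros)
    from DERIV_chain2[OF xi_log_derivative(2)[OF s] this]
    show "(E has_field_derivative E (of_real s) * of_real (xi_log_deriv s)) (at (of_real s))"
      by (simp add: E_def)
  qed
  have ode: "deriv E s = s\<^sup>2 * T s * E s" if s: "s \<in> S" for s
  proof (rule holomorphic_eq_of_eq_on_reals[of "deriv E" S "\<lambda>s. s\<^sup>2 * T s * E s" 1 2])
    show "deriv E holomorphic_on S"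
      by (rule holomorphic_on_subset[OF holomorphic_deriv[OF Ehol]]) auto
    show "(\<lambda>s. s\<^sup>2 * T s * E s) holomorphic_on S"
      by (intro holomorphic_intros Thol holomorphic_on_subset[OF Ehol]) auto
    show "connected S" by (rule convex_connected[OF cS])
    fix x :: real assume x: "1 < x" "x < 2"
    have "of_real (x\<^sup>2) * of_real (xi_log_deriv x / x\<^sup>2) = complex_of_real (xi_log_deriv x)"
      using x by (simp only: of_real_mult[symmetric]) simp
    then show "of_real x \<in> S \<and> deriv E (of_real x) = (of_real x)\<^sup>2 * T (of_real x) * E (of_real x)"
      using x Edr[of x] Treal[of x] by (simp add: S_def mult.commute)
  qed (use s oS in auto)
  \<comment> \<open>\<open>E\<close> solves a linear differential equation, so a single zero would force \<open>E = 0\<close>.\<close>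
  obtain Q where Q: "\<And>s. s \<in> S \<Longrightarrow> (Q has_field_derivative (s\<^sup>2 * T s)) (at s)"
  proof -
    have "(\<lambda>s. s\<^sup>2 * T s) holomorphic_on S" by (intro holomorphic_intros Thol)
    from holomorphic_convex_primitive'[OF cS oS this] show ?thesis using that oS by (metis at_within_open)
  qed
  have "((\<lambda>s. E s * exp (- Q s)) has_field_derivative 0) (at s within S)" if s: "s \<in> S" for s
  proof -
    have "((\<lambda>s. E s * exp (- Q s)) has_field_derivative
        deriv E s * exp (- Q s) + (exp (- Q s) * - (s\<^sup>2 * T s)) * E s) (at s)"
      by (intro DERIV_mult Ed) (auto intro!: derivative_eq_intros Q[OF s])
    moreover have "deriv E s * exp (- Q s) + (exp (- Q s) * - (s\<^sup>2 * T s)) * E s = 0"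
      unfolding ode[OF s] by (simp only: mult_minus_right mult_minus_left) (simp only: mult_ac add.right_inverse)
    ultimately show ?thesis by (simp only: has_field_derivative_at_within)
  qed
  then have "\<exists>c. \<forall>s\<in>S. E s * exp (- Q s) = c"
    by (rule has_field_derivative_zero_constant[OF cS])
  then obtain c where c: "\<And>s. s \<in> S \<Longrightarrow> E s * exp (- Q s) = c" by blast
  have "complex_of_real 1 \<in> S" by (simp add: S_def)
  moreover have "E (of_real 1) \<noteq> 0" unfolding E_def by (rule xi_log_derivative(1)) simp
  ultimately have "c \<noteq> 0" using c[of "of_real 1"] by auto
  then show ?thesis using c[of s0] s0 by (auto simp: S_def E_def)
qed

lemma screw_class_imp_RH:
  assumes "(\<lambda>t. complex_of_real (- Psi t)) \<in> screw_class \<infinity>"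
  shows riemann_hypothesis
  unfolding riemann_hypothesis_def
proof (intro allI impI)
  fix s assume z: "xi s = 0"
  obtain A where A: "\<And>t. t \<ge> 0 \<Longrightarrow> \<bar>Psi t\<bar> \<le> A * (1 + t\<^sup>2)"
    using screw_class_Psi_growth[OF assms] by blast
  have "\<not> Re s > 1/2" using xi_nonzero_right_half_plane[OF A, of "s - 1/2"] z by auto
  moreover have "\<not> Re s < 1/2"
    using xi_nonzero_right_half_plane[OF A, of "1/2 - s"] z xi_reflect[of s] by (auto simp: algebra_simps)
  ultimately show "Re s = 1/2" by linarith
qed

section \<open>From the Riemann hypothesis to screw functions\<close>

text \<open>The positivity condition of \<open>screw_class\<close> at infinite radius, isolated for
  real kernels so that closure under sums, non-negative multiples and pointwise limits can be used;
  the coefficients stay complex.\<close>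

definition pd_kernel :: "(real \<Rightarrow> real \<Rightarrow> real) \<Rightarrow> bool" where
  "pd_kernel K \<longleftrightarrow> (\<forall>(n::nat) (t :: nat \<Rightarrow> real) (\<xi> :: nat \<Rightarrow> complex).
     (\<Sum>i<n. \<Sum>j<n. of_real (K (t i) (t j)) * \<xi> i * cnj (\<xi> j)) \<in> \<real>\<^sub>\<ge>\<^sub>0)"

lemma pd_kernel_rank_one: "pd_kernel (\<lambda>t u. a t * a u)"
  unfolding pd_kernel_def
proof (intro allI)
  fix n :: nat and t :: "nat \<Rightarrow> real" and \<xi> :: "nat \<Rightarrow> complex"
  define z where "z = (\<Sum>i<n. of_real (a (t i)) * \<xi> i)"
  have "(\<Sum>i<n. \<Sum>j<n. of_real (a (t i) * a (t j)) * \<xi> i * cnj (\<xi> j)) = z * cnj z"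
    unfolding z_def by (simp add: sum_product mult_ac)
  also have "\<dots> = of_real ((norm z)\<^sup>2)" by (rule complex_norm_square[symmetric])
  finally show "(\<Sum>i<n. \<Sum>j<n. of_real (a (t i) * a (t j)) * \<xi> i * cnj (\<xi> j)) \<in> \<real>\<^sub>\<ge>\<^sub>0"
    by (simp only: nonneg_Reals_of_real_iff) simp
qed

lemma pd_kernel_add: "pd_kernel K \<Longrightarrow> pd_kernel L \<Longrightarrow> pd_kernel (\<lambda>t u. K t u + L t u)"
  unfolding pd_kernel_def
  by (simp add: distrib_right sum.distrib nonneg_Reals_add_I)

lemma pd_kernel_cmult:
  assumes "c \<ge> 0" "pd_kernel K"
  shows "pd_kernel (\<lambda>t u. c * K t u)"
  unfolding pd_kernel_def
proof (intro allI)
  fix n :: nat and t :: "nat \<Rightarrow> real" and \<xi> :: "nat \<Rightarrow> complex"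
  have "(\<Sum>i<n. \<Sum>j<n. of_real (c * K (t i) (t j)) * \<xi> i * cnj (\<xi> j)) =
      of_real c * (\<Sum>i<n. \<Sum>j<n. of_real (K (t i) (t j)) * \<xi> i * cnj (\<xi> j))"
    by (simp add: sum_distrib_left mult.assoc)
  then show "(\<Sum>i<n. \<Sum>j<n. of_real (c * K (t i) (t j)) * \<xi> i * cnj (\<xi> j)) \<in> \<real>\<^sub>\<ge>\<^sub>0"
    using assms by (simp add: pd_kernel_def nonneg_Reals_mult_I)
qed

lemma pd_kernel_sum:
  assumes "finite A" "\<And>z. z \<in> A \<Longrightarrow> pd_kernel (K z)"
  shows "pd_kernel (\<lambda>t u. \<Sum>z\<in>A. K z t u)"
  using assms
proof (induction A rule: finite_induct)
  case empty
  then show ?case by (simp add: pd_kernel_def)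
qed (simp add: pd_kernel_add)

lemma pd_kernel_limit:
  assumes K: "\<And>n. pd_kernel (K n)" and lim: "\<And>t u. (\<lambda>n. K n t u) \<longlonglongrightarrow> L t u"
  shows "pd_kernel L"
  unfolding pd_kernel_def
proof (intro allI)
  fix n :: nat and t :: "nat \<Rightarrow> real" and \<xi> :: "nat \<Rightarrow> complex"
  have "(\<lambda>m. \<Sum>i<n. \<Sum>j<n. of_real (K m (t i) (t j)) * \<xi> i * cnj (\<xi> j)) \<longlonglongrightarrow>
      (\<Sum>i<n. \<Sum>j<n. of_real (L (t i) (t j)) * \<xi> i * cnj (\<xi> j))"
    by (intro tendsto_intros lim)
  moreover have "(\<Sum>i<n. \<Sum>j<n. of_real (K m (t i) (t j)) * \<xi> i * cnj (\<xi> j)) \<in> \<real>\<^sub>\<ge>\<^sub>0" for m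
    using K[of m] by (simp add: pd_kernel_def)
  ultimately show "(\<Sum>i<n. \<Sum>j<n. of_real (L (t i) (t j)) * \<xi> i * cnj (\<xi> j)) \<in> \<real>\<^sub>\<ge>\<^sub>0"
    by (rule closed_sequentially[OF closed_nonneg_Reals_complex, rotated])
qed

text \<open>A zero \<open>1/2 + i \<gamma>\<close> of \<open>xi\<close> is recorded by \<open>y = \<gamma>^2\<close>; the value at \<open>y = 0\<close> is the limit.\<close>

definition zero_term :: "real \<Rightarrow> real \<Rightarrow> real" where
  "zero_term y t = (if y = 0 then t\<^sup>2 else 2 * (1 - cos (sqrt y * t)) / y)"

lemma zero_term_nonneg: "y \<ge> 0 \<Longrightarrow> zero_term y t \<ge> 0"
  by (simp add: zero_term_def)

lemma zero_term_even: "zero_term y (- t) = zero_term y t"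
  by (simp add: zero_term_def)

lemma continuous_on_zero_term: "continuous_on A (zero_term y)"
  unfolding zero_term_def by (cases "y = 0") (auto intro!: continuous_intros)

lemma has_laplace_zero_term:
  assumes y: "y \<ge> 0" and s: "s > 0"
  shows "has_laplace (zero_term y) s (2 / s / (s\<^sup>2 + y))"
proof (cases "y = 0")
  case True
  then show ?thesis
    using has_laplace_square[OF s] s by (simp add: zero_term_def[abs_def] power2_eq_square power3_eq_cube mult.assoc)
next
  case False
  have "has_laplace (\<lambda>t. 2 / y * (1 - cos (sqrt y * t))) s (2 / y * ((sqrt y)\<^sup>2 / (s * (s\<^sup>2 + (sqrt y)\<^sup>2))))"
    by (intro has_laplace_cmult has_laplace_one_minus_cos s)
  moreover have "(\<lambda>t. 2 / y * (1 - cos (sqrt y * t))) = zero_term y" using False by (auto simp: zero_term_def)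
  moreover have "2 / y * ((sqrt y)\<^sup>2 / (s * (s\<^sup>2 + (sqrt y)\<^sup>2))) = 2 / s / (s\<^sup>2 + y)" using False y by simp
  ultimately show ?thesis by simp
qed

text \<open>Combines \<open>2 * (1 - cos x) <= x^2\<close> with the bound 4. The majorant separates
  \<open>t\<close> from \<open>y\<close>, and its \<open>y\<close> part is half the Laplace
  transform of \<open>zero_term y\<close> at \<open>s = 1\<close>, whose sum over the zeros is known
  to converge.\<close>

lemma zero_term_le:
  assumes y: "y \<ge> 0"
  shows "zero_term y t \<le> (t\<^sup>2 + 4) * (1 / (1 + y))"
proof (cases "y = 0")
  case False
  define x where "x = sqrt y * t"
  have "cos x = 1 - 2 * (sin (x / 2))\<^sup>2" using cos_double_sin[of "x / 2"] by simp
  moreover have "(sin (x / 2))\<^sup>2 \<le> (x / 2)\<^sup>2"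
    using abs_sin_x_le_abs_x[of "x / 2"] by (simp only: abs_le_square_iff)
  ultimately have "2 * (1 - cos x) \<le> x\<^sup>2" by (simp add: power_divide)
  also have "x\<^sup>2 = y * t\<^sup>2" using y by (simp add: x_def power_mult_distrib)
  finally have 1: "2 * (1 - cos x) \<le> y * t\<^sup>2" .
  have "2 * (1 - v) \<le> 4" if "- 1 \<le> v" for v :: real using that by simp
  then have 2: "2 * (1 - cos x) \<le> 4" using cos_ge_minus_one by blast
  have "2 * (1 - cos x) * y \<le> 4 * y" using 2 y by (rule mult_right_mono)
  then have "2 * (1 - cos x) * (1 + y) \<le> (t\<^sup>2 + 4) * y" using 1 by (simp add: algebra_simps)
  then have "2 * (1 - cos x) / y \<le> (t\<^sup>2 + 4) / (1 + y)"
    using y False by (simp add: divide_simps)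
  then show ?thesis using False by (simp add: zero_term_def x_def)
qed (simp add: zero_term_def)

text \<open>With \<open>x = sqrt y\<close>, the kernel is \<open>2 / y\<close> times the real part
  of \<open>(1 - exp (i x t)) * (1 - exp (- i x u))\<close>, a sum of two rank-one kernels; for
  \<open>y = 0\<close> it degenerates to \<open>2 * t * u\<close>.\<close>

lemma pd_kernel_zero_term:
  assumes y: "y \<ge> 0"
  shows "pd_kernel (\<lambda>t u. zero_term y t + zero_term y u - zero_term y (t - u))"
proof (cases "y = 0")
  case True
  have "zero_term y t + zero_term y u - zero_term y (t - u) = 2 * (t * u)" for t u
    using True by (simp add: zero_term_def power2_eq_square algebra_simps)
  then show ?thesis using pd_kernel_cmult[OF _ pd_kernel_rank_one[of "\<lambda>t. t"], of 2] by simp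
next
  case False
  define a where "a = (\<lambda>t. 1 - cos (sqrt y * t))"
  define b where "b = (\<lambda>t. sin (sqrt y * t))"
  have "zero_term y t + zero_term y u - zero_term y (t - u) = 2 / y * (a t * a u + b t * b u)" for t u
  proof -
    have "cos (sqrt y * (t - u)) = cos (sqrt y * t) * cos (sqrt y * u) + sin (sqrt y * t) * sin (sqrt y * u)"
      by (simp add: right_diff_distrib cos_diff)
    then show ?thesis using False
      by (simp add: zero_term_def a_def b_def field_simps)
  qed
  moreover have "pd_kernel (\<lambda>t u. 2 / y * (a t * a u + b t * b u))"
    by (intro pd_kernel_cmult pd_kernel_add pd_kernel_rank_one) (use y in simp)
  ultimately show ?thesis by simp
qed

lemma RH_partial_fractions:
  assumes RH: riemann_hypothesis
  obtains Z :: "nat \<Rightarrow> complex set" and m :: "complex \<Rightarrow> nat" where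
    "Z 0 = {}" "\<And>n. finite (Z n)" "\<And>n. Z n \<subseteq> Z (Suc n)" "\<And>n z. z \<in> Z n \<Longrightarrow> Re z \<le> 0"
    "\<And>s. s > 1/2 \<Longrightarrow> (\<lambda>n. \<Sum>z\<in>Z n. real (m z) * (2 / s / (s\<^sup>2 + - Re z))) \<longlonglongrightarrow> xi_log_deriv s / s\<^sup>2"
proof -
  define E where "E = (\<lambda>s. xi (1/2 + s))"
  have Ehol: "E holomorphic_on UNIV"
    unfolding E_def by (rule holomorphic_on_compose_gen[OF _ xi_holomorphic, unfolded o_def]) (auto intro!: holomorphic_intros)
  have Eeven: "E (- s) = E s" for s
    using xi_reflect[of "1/2 + s"] by (simp add: E_def algebra_simps)
  obtain h where h: "h holomorphic_on UNIV" "\<And>s. E s = h (s\<^sup>2)"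
    using even_entire_function_of_square[OF Ehol Eeven] by blast
  \<comment> \<open>The centre of the discs must not be a zero of \<open>h\<close>. The square of
    \<open>s = 1\<close> qualifies, since \<open>xi (3/2)\<close> is known to be nonzero.\<close>
  define c where "c = complex_of_real (1\<^sup>2)"
  have hreal: "h ((of_real s)\<^sup>2) \<noteq> 0" if "s > 1/2" for s
    using xi_log_derivative(1)[OF that] h(2)[of "of_real s"] by (simp add: E_def)
  have hc: "h c \<noteq> 0" using hreal[of 1] by (simp add: c_def)
  \<comment> \<open>\<open>csqrt z\<close> is a zero of \<open>E\<close>, so under the Riemann
    hypothesis it is purely imaginary and \<open>z\<close> is minus the square of a real
    number.\<close>
  have zeros: "Im z = 0 \<and> Re z \<le> 0" if "h z = 0" for z
  proof -
    have "E (csqrt z) = 0" using that h(2)[of "csqrt z"] by simp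
    then have "Re (csqrt z) = 0" using RH unfolding riemann_hypothesis_def E_def by fastforce
    moreover have "z = (csqrt z)\<^sup>2" by simp
    ultimately have "z = (\<i> * of_real (Im (csqrt z)))\<^sup>2" by (metis complex_eq add_0 of_real_0 mult.commute)
    then have "z = of_real (- (Im (csqrt z))\<^sup>2)" by (simp add: power_mult_distrib)
    then show ?thesis by (metis Im_complex_of_real Re_complex_of_real neg_le_0_iff_le zero_le_power2)
  qed
  obtain C where C: "C > 0"
    "\<And>s. norm (xi (1/2 + s)) \<le> (1 + exp ((norm s + 3) * ln (norm s + 3))) * (1 + C * (norm s + 1)\<^sup>2)"
    by (rule xi_growth) blast
  \<comment> \<open>\<open>norm w <= R + 1\<close> and \<open>|s| = sqrt (norm w)\<close> turn the
    growth bound in \<open>s\<close> into one in \<open>w\<close>; \<open>L R\<close> is of size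
    \<open>sqrt R * ln R\<close>, hence \<open>o(R)\<close>.\<close>
  define L where "L = (\<lambda>R. ln ((1 + exp ((sqrt (R + 1) + 3) * ln (sqrt (R + 1) + 3))) * (1 + C * (sqrt (R + 1) + 1)\<^sup>2)))"
  have Lb: "norm (h w) \<le> exp (L R)" if R: "R > 0" "dist c w \<le> R" for R w
  proof -
    have "norm w \<le> norm (w - c) + norm c" using norm_triangle_ineq[of "w - c" c] by simp
    then have "norm w \<le> R + 1" using R by (simp add: c_def dist_norm norm_minus_commute)
    define q where "q = norm (csqrt w)"
    define r where "r = sqrt (R + 1)"
    have q: "0 \<le> q" "q \<le> r" using \<open>norm w \<le> R + 1\<close> by (simp_all add: q_def r_def)
    have "norm (h w) = norm (xi (1/2 + csqrt w))" using h(2)[of "csqrt w"] by (simp add: E_def)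
    also have "\<dots> \<le> (1 + exp ((q + 3) * ln (q + 3))) * (1 + C * (q + 1)\<^sup>2)"
      unfolding q_def by (rule C(2))
    also have "\<dots> \<le> (1 + exp ((r + 3) * ln (r + 3))) * (1 + C * (r + 1)\<^sup>2)"
    proof (intro mult_mono add_left_mono mult_left_mono power_mono)
      have "(q + 3) * ln (q + 3) \<le> (r + 3) * ln (r + 3)"
        using q by (intro mult_mono) auto
      then show "exp ((q + 3) * ln (q + 3)) \<le> exp ((r + 3) * ln (r + 3))" by simp
    qed (use C q in \<open>auto simp: add_nonneg_nonneg\<close>)
    also have "\<dots> = exp (L R)"
    proof -
      have "0 < 1 + exp ((r + 3) * ln (r + 3))" by (simp add: add_pos_pos)
      moreover have "0 < 1 + C * (r + 1)\<^sup>2" using C(1) by (intro add_pos_nonneg) auto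
      ultimately show ?thesis unfolding L_def r_def[symmetric] by (simp only: exp_ln mult_pos_pos)
    qed
    finally show ?thesis .
  qed
  have Llim: "((\<lambda>R. L R / R) \<longlongrightarrow> 0) at_top"
    unfolding L_def using C(1) by real_asymp
  define m where "m = (\<lambda>z. nat (zorder h z))"
  define Z where "Z = (\<lambda>n. {z. dist c z \<le> real n \<and> h z = 0})"
  have lim: "(\<lambda>n. \<Sum>z\<in>Z n. real (m z) * (2 / s / (s\<^sup>2 + - Re z))) \<longlonglongrightarrow> xi_log_deriv s / s\<^sup>2" if s: "s > 1/2" for s
  proof -
    define w where "w = (complex_of_real s)\<^sup>2"
    have hw: "h w \<noteq> 0" using hreal[OF s] by (simp add: w_def)
    have "((\<lambda>R. \<Sum>z | dist c z \<le> R \<and> h z = 0. of_nat (m z) / (w - z)) \<longlongrightarrow> deriv h w / h w) at_top"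
      unfolding m_def by (rule log_deriv_zeros[OF h(1) hc Lb Llim hw])
    from filterlim_compose[OF this filterlim_real_sequentially]
    have "(\<lambda>n. \<Sum>z\<in>Z n. of_nat (m z) / (w - z)) \<longlonglongrightarrow> deriv h w / h w"
      by (simp add: Z_def)
    \<comment> \<open>Differentiating \<open>E s = h (s^2)\<close> gives
      \<open>xi_log_deriv s = 2 * s * h' / h\<close>; division by \<open>s^2\<close> leaves the
      factor \<open>2 / s\<close>.\<close>
    then have "(\<lambda>n. of_real (2 / s) * (\<Sum>z\<in>Z n. of_nat (m z) / (w - z))) \<longlonglongrightarrow> of_real (2 / s) * (deriv h w / h w)"
      by (rule tendsto_mult_left)
    moreover have "of_real (2 / s) * (\<Sum>z\<in>Z n. of_nat (m z) / (w - z)) =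
        complex_of_real (\<Sum>z\<in>Z n. real (m z) * (2 / s / (s\<^sup>2 + - Re z)))" for n
    proof -
      have "of_real (2 / s) * (of_nat (m z) / (w - z)) = complex_of_real (real (m z) * (2 / s / (s\<^sup>2 + - Re z)))"
        if "z \<in> Z n" for z
      proof -
        have "z = of_real (Re z)" using zeros[of z] that by (simp add: Z_def complex_eq_iff)
        then have "w - z = of_real (s\<^sup>2 + - Re z)" unfolding w_def by (metis of_real_diff of_real_power diff_conv_add_uminus)
        then show ?thesis by simp
      qed
      then show ?thesis by (simp add: sum_distrib_left)
    qed
    moreover have "of_real (2 / s) * (deriv h w / h w) = complex_of_real (xi_log_deriv s / s\<^sup>2)"
    proof -
      have "(h has_field_derivative deriv h w) (at w)" using h(1) holomorphic_derivI by blast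
      moreover have "((\<lambda>s::complex. s\<^sup>2) has_field_derivative 2 * of_real s) (at (of_real s))"
        by (auto intro!: derivative_eq_intros)
      ultimately have "((\<lambda>s. h (s\<^sup>2)) has_field_derivative deriv h w * (2 * of_real s)) (at (of_real s))"
        unfolding w_def by (rule DERIV_chain2)
      then have 1: "(E has_field_derivative deriv h w * (2 * of_real s)) (at (of_real s))"
        by (simp add: h(2)[symmetric])
      have "((\<lambda>s::complex. 1/2 + s) has_field_derivative 1) (at (of_real s))" by (auto intro!: derivative_eq_intros)
      from DERIV_chain2[OF xi_log_derivative(2)[OF s] this]
      have "(E has_field_derivative h w * of_real (xi_log_deriv s)) (at (of_real s))"
        using h(2)[of "of_real s"] by (simp add: E_def w_def)
      with 1 have "deriv h w * (2 * of_real s) = h w * of_real (xi_log_deriv s)" by (rule DERIV_unique)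
      then have "deriv h w / h w = of_real (xi_log_deriv s) / (2 * of_real s)" using hw s by (simp add: field_simps)
      then show ?thesis using s by (simp add: power2_eq_square)
    qed
    ultimately have "(\<lambda>n. complex_of_real (\<Sum>z\<in>Z n. real (m z) * (2 / s / (s\<^sup>2 + - Re z)))) \<longlonglongrightarrow> of_real (xi_log_deriv s / s\<^sup>2)"
      by (simp only:)
    then show ?thesis by (simp only: tendsto_of_real_iff)
  qed
  show ?thesis
  proof (rule that[of Z m])
    show "Z 0 = {}" using hc by (auto simp: Z_def)
    show "finite (Z n)" for n unfolding Z_def by (rule entire_finite_zeros_cball[OF h(1) hc])
    show "Z n \<subseteq> Z (Suc n)" for n by (auto simp: Z_def)
    show "Re z \<le> 0" if "z \<in> Z n" for n z using zeros[of z] that by (simp add: Z_def)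
    show "(\<lambda>n. \<Sum>z\<in>Z n. real (m z) * (2 / s / (s\<^sup>2 + - Re z))) \<longlonglongrightarrow> xi_log_deriv s / s\<^sup>2" if "s > 1/2" for s
      by (rule lim[OF that])
  qed
qed

lemma RH_imp_Psi_sums:
  assumes RH: riemann_hypothesis
  obtains Z :: "nat \<Rightarrow> complex set" and m :: "complex \<Rightarrow> nat" where
    "\<And>n. finite (Z n)" "\<And>n z. z \<in> Z n \<Longrightarrow> Re z \<le> 0"
    "\<And>t. (\<lambda>n. \<Sum>z\<in>Z n. real (m z) * zero_term (- Re z) t) \<longlonglongrightarrow> Psi t"
proof -
  obtain Z :: "nat \<Rightarrow> complex set" and m where Z: "Z 0 = {}" "\<And>n. finite (Z n)" "\<And>n. Z n \<subseteq> Z (Suc n)"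
    "\<And>n z. z \<in> Z n \<Longrightarrow> Re z \<le> 0"
    and lim: "\<And>s. s > 1/2 \<Longrightarrow> (\<lambda>n. \<Sum>z\<in>Z n. real (m z) * (2 / s / (s\<^sup>2 + - Re z))) \<longlonglongrightarrow> xi_log_deriv s / s\<^sup>2"
    by (rule RH_partial_fractions[OF RH]) (rule that)
  \<comment> \<open>Convergence is known only along the growing discs. The differences
    \<open>W n\<close> regroup the sum into a genuine series of non-negative blocks, as
    \<open>has_laplace_sums\<close> requires; \<open>Z 0 = {}\<close> makes it start from
    nothing.\<close>
  define W where "W = (\<lambda>n. Z (Suc n) - Z n)"
  have W: "finite (W n)" "z \<in> W n \<Longrightarrow> - Re z \<ge> 0" for n z
    using Z(2) Z(4)[of z "Suc n"] by (auto simp: W_def)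
  have telescope: "(\<Sum>n<N. \<Sum>z\<in>W n. f z) = (\<Sum>z\<in>Z N. f z)" for N and f :: "complex \<Rightarrow> real"
  proof (induction N)
    case (Suc N)
    have "(\<Sum>z\<in>Z (Suc N). f z) = (\<Sum>z\<in>W N. f z) + (\<Sum>z\<in>Z N. f z)"
      unfolding W_def by (rule sum.subset_diff[OF Z(3) Z(2)])
    then show ?case using Suc by simp
  qed (simp add: Z(1))
  define d where "d = (\<lambda>n t. \<Sum>z\<in>W n. real (m z) * zero_term (- Re z) t)"
  define a where "a = (\<lambda>s n. \<Sum>z\<in>W n. real (m z) * (2 / s / (s\<^sup>2 + - Re z)))"
  have a: "a s sums (xi_log_deriv s / s\<^sup>2)" if "s > 1/2" for s
    using lim[OF that] unfolding sums_def a_def telescope .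
  \<comment> \<open>At \<open>s = 1\<close> a zero contributes \<open>2 / (1 + y)\<close>, so the
    convergence of \<open>a 1\<close> is exactly the summability of the majorants from
    \<open>zero_term_le\<close>.\<close>
  define b where "b = (\<lambda>n. \<Sum>z\<in>W n. real (m z) * (1 / (1 + - Re z)))"
  have "a 1 n = 2 * b n" for n
    unfolding a_def b_def sum_distrib_left by (intro sum.cong refl) simp
  then have "b = (\<lambda>n. a 1 n / 2)" by auto
  moreover have "summable (\<lambda>n. a 1 n / 2)" using a[of 1] by (intro summable_divide) (auto simp: sums_iff)
  ultimately have b: "summable b" by simp
  have d_nn: "d n t \<ge> 0" for n t
    unfolding d_def using W by (intro sum_nonneg mult_nonneg_nonneg zero_term_nonneg) auto
  have d_le: "d n t \<le> (t\<^sup>2 + 4) * b n" for n t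
  proof -
    have "d n t \<le> (\<Sum>z\<in>W n. real (m z) * ((t\<^sup>2 + 4) * (1 / (1 + - Re z))))"
      unfolding d_def by (intro sum_mono mult_left_mono zero_term_le W) auto
    also have "\<dots> = (t\<^sup>2 + 4) * b n"
      unfolding b_def sum_distrib_left by (intro sum.cong refl) (simp only: mult.left_commute)
    finally show ?thesis .
  qed
  define \<phi> where "\<phi> = (\<lambda>t. \<Sum>n. d n t)"
  have \<phi>: "(\<lambda>n. d n t) sums \<phi> t" for t
  proof -
    have "summable (\<lambda>n. d n t)"
    proof (rule summable_comparison_test')
      show "summable (\<lambda>n. (t\<^sup>2 + 4) * b n)" by (intro summable_mult b)
      show "norm (d n t) \<le> (t\<^sup>2 + 4) * b n" for n using d_nn d_le by simp
    qed
    then show ?thesis unfolding \<phi>_def by (rule summable_sums)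
  qed
  have \<phi>c: "continuous_on UNIV \<phi>"
  proof -
    have "continuous_on (\<Union>T\<in>UNIV. {- T<..<T}) \<phi>"
    proof (rule continuous_on_open_UN)
      fix T :: real
      have "uniform_limit {- T<..<T} (\<lambda>N t. \<Sum>n<N. d n t) (\<lambda>t. \<Sum>n. d n t) sequentially"
      proof (rule Weierstrass_m_test)
        show "summable (\<lambda>n. (T\<^sup>2 + 4) * b n)" by (intro summable_mult b)
        fix n t assume "t \<in> {- T<..<T}"
        then have "\<bar>t\<bar> \<le> \<bar>T\<bar>" by auto
        then have "t\<^sup>2 \<le> T\<^sup>2" by (simp only: abs_le_square_iff)
        moreover have "b n \<ge> 0" using d_nn[of n 0] d_le[of n 0] by simp
        ultimately have "(t\<^sup>2 + 4) * b n \<le> (T\<^sup>2 + 4) * b n" by (intro mult_right_mono) auto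
        then show "norm (d n t) \<le> (T\<^sup>2 + 4) * b n" using d_nn[of n t] d_le[of n t] by simp
      qed
      moreover have "continuous_on {- T<..<T} (\<lambda>t. \<Sum>n<N. d n t)" for N
        unfolding d_def by (intro continuous_intros continuous_on_zero_term)
      ultimately show "continuous_on {- T<..<T} \<phi>"
        unfolding \<phi>_def by (intro uniform_limit_theorem[rotated]) auto
    qed auto
    moreover have "(\<Union>T\<in>UNIV. {- T<..<T}) = (UNIV :: real set)"
    proof -
      have "x \<in> {- (\<bar>x\<bar> + 1)<..<\<bar>x\<bar> + 1}" for x :: real by auto
      then show ?thesis by blast
    qed
    ultimately show ?thesis by simp
  qed
  have \<phi>l: "has_laplace \<phi> s (xi_log_deriv s / s\<^sup>2)" if s: "s > 1/2" for s
  proof (rule has_laplace_sums[OF d_nn _ a[OF s] \<phi>])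
    have "has_laplace (\<lambda>t. \<Sum>z\<in>A. real (m z) * zero_term (- Re z) t) s (\<Sum>z\<in>A. real (m z) * (2 / s / (s\<^sup>2 + - Re z)))"
      if "finite A" "\<And>z. z \<in> A \<Longrightarrow> - Re z \<ge> 0" for A
      using that
    proof (induction A rule: finite_induct)
      case empty
      then show ?case by (simp add: has_laplace_def has_bochner_integral_iff)
    next
      case (insert z A)
      have "has_laplace (\<lambda>t. real (m z) * zero_term (- Re z) t + (\<Sum>z\<in>A. real (m z) * zero_term (- Re z) t)) s
          (real (m z) * (2 / s / (s\<^sup>2 + - Re z)) + (\<Sum>z\<in>A. real (m z) * (2 / s / (s\<^sup>2 + - Re z))))"
        by (intro has_laplace_add has_laplace_cmult has_laplace_zero_term insert.IH insert.prems) (use s in auto)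
      then show ?case using insert.hyps by simp
    qed
    then show "has_laplace (d n) s (a s n)" for n
      unfolding d_def a_def using W by blast
  qed
  \<comment> \<open>Both sides are continuous and have equal transforms at
    \<open>1, 2, 3, ...\<close>, all beyond 1/2, so the uniqueness theorem applies with
    \<open>c = 1\<close>.\<close>
  have pos: "Psi t = \<phi> t" if t: "t \<ge> 0" for t
  proof -
    have "has_laplace (\<lambda>t. Psi t - \<phi> t) (1 + real n) 0" for n
    proof -
      have "1 + real n > 1/2" by simp
      from has_laplace_diff[OF has_laplace_Psi[OF this] \<phi>l[OF this]] show ?thesis by simp
    qed
    moreover have "continuous_on {0..} (\<lambda>t. Psi t - \<phi> t)"
      by (intro continuous_intros continuous_on_subset[OF continuous_on_Psi] continuous_on_subset[OF \<phi>c]) auto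
    ultimately have "Psi t - \<phi> t = 0" using t by (rule laplace_zero_imp_zero)
    then show ?thesis by simp
  qed
  have even: "\<phi> (- t) = \<phi> t" for t by (simp add: \<phi>_def d_def zero_term_even)
  have eq: "Psi t = \<phi> t" for t
    using pos[of t] pos[of "- t"] even[of t] Psi_even[of t] by (cases "t \<ge> 0") auto
  have "(\<lambda>n. \<Sum>z\<in>Z n. real (m z) * zero_term (- Re z) t) \<longlonglongrightarrow> Psi t" for t
    using \<phi>[of t] unfolding sums_def d_def telescope eq .
  then show ?thesis using that Z(2,4) by blast
qed

lemma RH_imp_screw_class:
  assumes RH: riemann_hypothesis
  shows "(\<lambda>t. complex_of_real (- Psi t)) \<in> screw_class \<infinity>"
proof -
  obtain Z :: "nat \<Rightarrow> complex set" and m where Z: "\<And>n. finite (Z n)" "\<And>n z. z \<in> Z n \<Longrightarrow> Re z \<le> 0"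
    and lim: "\<And>t. (\<lambda>n. \<Sum>z\<in>Z n. real (m z) * zero_term (- Re z) t) \<longlonglongrightarrow> Psi t"
    using RH_imp_Psi_sums[OF RH] by metis
  define K where "K = (\<lambda>n t u. \<Sum>z\<in>Z n. real (m z) *
      (zero_term (- Re z) t + zero_term (- Re z) u - zero_term (- Re z) (t - u)))"
  have "pd_kernel (K n)" for n
    unfolding K_def using Z(2)
    by (intro pd_kernel_sum pd_kernel_cmult pd_kernel_zero_term Z(1)) auto
  moreover have "(\<lambda>n. K n t u) \<longlonglongrightarrow> Psi t + Psi u - Psi (t - u)" for t u
  proof -
    have "(\<lambda>n. (\<Sum>z\<in>Z n. real (m z) * zero_term (- Re z) t) + (\<Sum>z\<in>Z n. real (m z) * zero_term (- Re z) u)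
        - (\<Sum>z\<in>Z n. real (m z) * zero_term (- Re z) (t - u))) \<longlonglongrightarrow> Psi t + Psi u - Psi (t - u)"
      by (intro tendsto_intros lim)
    then show ?thesis
      by (simp add: K_def distrib_left right_diff_distrib sum.distrib sum_subtractf)
  qed
  ultimately have pd: "pd_kernel (\<lambda>t u. Psi t + Psi u - Psi (t - u))" by (rule pd_kernel_limit)
  \<comment> \<open>Read off from the expansion, every \<open>zero_term\<close> being 0 at 0. It
    removes the summand \<open>g 0\<close> from the screw kernel.\<close>
  have "Psi 0 = 0"
  proof -
    have "zero_term y 0 = 0" for y by (simp add: zero_term_def)
    then show ?thesis using lim[of 0] LIMSEQ_unique[OF _ tendsto_const[of "0::real"]] by simp
  qed
  then have "screw_kernel (\<lambda>t. complex_of_real (- Psi t)) t u = of_real (Psi t + Psi u - Psi (t - u))" for t u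
    by (simp add: screw_kernel_def Psi_even)
  then show ?thesis
    using pd unfolding screw_class_def pd_kernel_def
    by (auto simp: Psi_even intro!: continuous_intros continuous_on_subset[OF continuous_on_Psi])
qed

theorem theorem1p2:
  shows "riemann_hypothesis \<longleftrightarrow> (\<lambda>t::real. complex_of_real (- Psi t)) \<in> screw_class \<infinity>"
  using RH_imp_screw_class screw_class_imp_RH by blast

end
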